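(* Let $A$ be a finite dimensional non-nilpotent associative algebra with a generalized $H$-action over an algebraically closed field $F$ of characteristic $0$. Here $H$ is a finite dimensional associative algebra with $1$ acting on $A$ in such a way that the Jacobson radical $J:=J(A)$ is $H$-invariant and $A=B\oplus J$ (direct sum of $H$-submodules), where $B$ is a subalgebra and $B=B_1\oplus\dots\oplus B_q$ (direct sum of $H$-invariant ideals of $B$) with $B_i$ being $H$-simple semisimple algebras. Then there exist constants $C_1,C_2>0$, $r_1,r_2\in\mathbb{R}$, $d\in\mathbb{N}$ such that $$C_1n^{r_1}d^n\leqslant c_n^H(A)\leqslant C_2n^{r_2}d^n\quad\text{for all } n\in\mathbb{N}.$$
   Context: Algebras acted upon are not assumed to be unital; $\mathbb{N}=\{1,2,\dots\}$. Let $H$ be an associative algebra with $1$. An associative algebra $A$ is an algebra with a generalized $H$-action if it is endowed with a homomorphism of algebras with $1$, $H\to\mathrm{End}_F(A)$, and for every $h\in H$ there exist (finitely many) $h'_i,h''_i,h'''_i,h''''_i\in H$ such that $$h(ab)=\sum_i\bigl((h'_ia)(h''_ib)+(h'''_ib)(h''''_ia)\bigr)\quad\text{for all } a,b\in A.$$ An $H$-simple algebra is a nonzero algebra with such an action having no $H$-invariant two-sided ideals except $0$ and itself. Let $(\gamma_\beta)_{\beta\in\Lambda}$ be a basis of $H$. $F\langle X|H\rangle$ is the free associative algebra over $F$ with free formal generators $x_i^{\gamma_\beta}$, $\beta\in\Lambda$, $i\in\mathbb{N}$; for $h=\sum_\beta\alpha_\beta\gamma_\beta$ put $x_i^h:=\sum_\beta\alpha_\beta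 x_i^{\gamma_\beta}$, and $x_i:=x_i^1$. Its elements are called $H$-polynomials. An $H$-polynomial $f(x_1,\dots,x_n)$ is evaluated at $a_1,\dots,a_n\in A$ by substituting $ha_i$ for $x_i^h$. It is an $H$-identity of $A$ if $f(a_1,\dots,a_n)=0$ for all $a_i\in A$; $\mathrm{Id}^H(A)$ is the set of $H$-identities. Let $$P_n^H=\langle x^{h_1}_{\sigma(1)}x^{h_2}_{\sigma(2)}\cdots x^{h_n}_{\sigma(n)}\mid h_i\in H,\ \sigma\in S_n\rangle_F\subset F\langle X|H\rangle.$$ The $n$th $H$-codimension of $A$ is $c_n^H(A):=\dim\bigl(P_n^H/(P_n^H\cap\mathrm{Id}^H(A))\bigr)$. $A$ is nilpotent if all products of $p$ elements of $A$ vanish for some $p\in\mathbb{N}$. *)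

theory Defs
  imports
    Complex_Main
    "HOL-Computational_Algebra.Polynomial"
    "HOL-Library.Poly_Mapping"
    "HOL-Combinatorics.Permutations"
begin

section \<open>Associative algebras, not necessarily unital\<close>

locale algebra_over = vector_space scale
  for scale :: "'f::field \<Rightarrow> 'a::ring \<Rightarrow> 'a" +
  assumes scale_mult_left: "scale c (x * y) = scale c x * y"
    and scale_mult_right: "scale c (x * y) = x * scale c y"

definition finite_dim :: "('f::field \<Rightarrow> 'v::ab_group_add \<Rightarrow> 'v) \<Rightarrow> bool" where
  "finite_dim scale \<longleftrightarrow> (\<exists>B. finite B \<and> module.span scale B = UNIV)"

text \<open>Product of a nonempty list; the value on the empty list is junk, as there need not be a unit.\<close>

fun nprod :: "'a::ring list \<Rightarrow> 'a" where
  "nprod [] = 0"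
| "nprod [x] = x"
| "nprod (x # y # zs) = x * nprod (y # zs)"

definition nilpotent_algebra :: "'a::ring itself \<Rightarrow> bool" where
  "nilpotent_algebra _ \<longleftrightarrow> (\<exists>p\<ge>1. \<forall>xs :: 'a list. length xs = p \<longrightarrow> nprod xs = 0)"

text \<open>In what follows, \<open>S\<close> is the carrier of a subalgebra of the ambient algebra.\<close>

definition subalgebra :: "('f::field \<Rightarrow> 'a::ring \<Rightarrow> 'a) \<Rightarrow> 'a set \<Rightarrow> bool" where
  "subalgebra scale S \<longleftrightarrow> module.subspace scale S \<and> (\<forall>x\<in>S. \<forall>y\<in>S. x * y \<in> S)"

definition left_ideal_of :: "('f::field \<Rightarrow> 'a::ring \<Rightarrow> 'a) \<Rightarrow> 'a set \<Rightarrow> 'a set \<Rightarrow> bool" where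
  "left_ideal_of scale S I \<longleftrightarrow>
     module.subspace scale I \<and> I \<subseteq> S \<and> (\<forall>a\<in>S. \<forall>x\<in>I. a * x \<in> I)"

definition ideal_of :: "('f::field \<Rightarrow> 'a::ring \<Rightarrow> 'a) \<Rightarrow> 'a set \<Rightarrow> 'a set \<Rightarrow> bool" where
  "ideal_of scale S I \<longleftrightarrow>
     module.subspace scale I \<and> I \<subseteq> S \<and> (\<forall>a\<in>S. \<forall>x\<in>I. a * x \<in> I \<and> x * a \<in> I)"

text \<open>A left ideal is modular (regular) if the algebra has a right unit modulo it. In an algebra
  without unit, the Jacobson radical is the intersection of the maximal left ideals that are
  modular; it is the whole algebra if there are none.\<close>

definition modular_left_ideal_of ::
  "('f::field \<Rightarrow> 'a::ring \<Rightarrow> 'a) \<Rightarrow> 'a set \<Rightarrow> 'a set \<Rightarrow> bool" where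
  "modular_left_ideal_of scale S I \<longleftrightarrow>
     left_ideal_of scale S I \<and> (\<exists>e\<in>S. \<forall>a\<in>S. a - a * e \<in> I)"

definition maximal_left_ideal_of ::
  "('f::field \<Rightarrow> 'a::ring \<Rightarrow> 'a) \<Rightarrow> 'a set \<Rightarrow> 'a set \<Rightarrow> bool" where
  "maximal_left_ideal_of scale S I \<longleftrightarrow>
     left_ideal_of scale S I \<and> I \<noteq> S \<and>
     (\<forall>K. left_ideal_of scale S K \<and> I \<subseteq> K \<longrightarrow> K = I \<or> K = S)"

definition jacobson_radical :: "('f::field \<Rightarrow> 'a::ring \<Rightarrow> 'a) \<Rightarrow> 'a set \<Rightarrow> 'a set" where
  "jacobson_radical scale S =
     S \<inter> \<Inter> {I. modular_left_ideal_of scale S I \<and> maximal_left_ideal_of scale S I}"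

definition semisimple_algebra :: "('f::field \<Rightarrow> 'a::ring \<Rightarrow> 'a) \<Rightarrow> 'a set \<Rightarrow> bool" where
  "semisimple_algebra scale S \<longleftrightarrow> jacobson_radical scale S = {0}"

definition internal_direct_sum :: "'i set \<Rightarrow> ('i \<Rightarrow> 'a::ab_group_add set) \<Rightarrow> 'a set \<Rightarrow> bool" where
  "internal_direct_sum I S V \<longleftrightarrow>
     V = {\<Sum>i\<in>I. f i | f. \<forall>i\<in>I. f i \<in> S i} \<and>
     (\<forall>f. (\<forall>i\<in>I. f i \<in> S i) \<and> (\<Sum>i\<in>I. f i) = 0 \<longrightarrow> (\<forall>i\<in>I. f i = 0))"


section \<open>Generalized actions\<close>

text \<open>The first group of axioms says that \<open>h \<mapsto> act h\<close> is a homomorphism of unital algebras from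
  \<open>H\<close> to the algebra of linear operators on \<open>A\<close>.\<close>

locale generalized_action =
  H: algebra_over sH + A: algebra_over sA
  for sH :: "'f::field \<Rightarrow> 'h::ring_1 \<Rightarrow> 'h"
    and sA :: "'f \<Rightarrow> 'a::ring \<Rightarrow> 'a" +
  fixes act :: "'h \<Rightarrow> 'a \<Rightarrow> 'a"
  assumes act_linear: "Vector_Spaces.linear sA sA (act h)"
    and act_add: "act (g + h) a = act g a + act h a"
    and act_scale: "act (sH c h) a = sA c (act h a)"
    and act_one: "act 1 a = a"
    and act_mult: "act (g * h) a = act g (act h a)"
    and act_prod: "\<exists>qs :: ('h \<times> 'h \<times> 'h \<times> 'h) list. \<forall>a b.
      act h (a * b) =
        (\<Sum>(h1, h2, h3, h4)\<leftarrow>qs. act h1 a * act h2 b + act h3 b * act h4 a)"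

definition H_invariant :: "('h \<Rightarrow> 'a \<Rightarrow> 'a) \<Rightarrow> 'a set \<Rightarrow> bool" where
  "H_invariant act S \<longleftrightarrow> (\<forall>h. \<forall>a\<in>S. act h a \<in> S)"

definition H_simple ::
  "('f::field \<Rightarrow> 'a::ring \<Rightarrow> 'a) \<Rightarrow> ('h \<Rightarrow> 'a \<Rightarrow> 'a) \<Rightarrow> 'a set \<Rightarrow> bool" where
  "H_simple scale act S \<longleftrightarrow>
     subalgebra scale S \<and> H_invariant act S \<and> S \<noteq> {0} \<and>
     (\<forall>I. ideal_of scale S I \<and> H_invariant act I \<longrightarrow> I = {0} \<or> I = S)"


section \<open>\<open>H\<close>-polynomials\<close>

text \<open>The type \<open>'g free_monoid \<Rightarrow>\<^sub>0 'f\<close> is the monoid algebra of the free monoid, i.e. the free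
  unital associative algebra on \<open>'g\<close>.\<close>

datatype 'g free_monoid = Word (letters: "'g list")

instantiation free_monoid :: (type) monoid_add
begin

definition zero_free_monoid :: "'a free_monoid" where
  "zero_free_monoid = Word []"

definition plus_free_monoid :: "'a free_monoid \<Rightarrow> 'a free_monoid \<Rightarrow> 'a free_monoid" where
  "plus_free_monoid u v = Word (letters u @ letters v)"

instance
  by standard (simp_all add: zero_free_monoid_def plus_free_monoid_def)

end

text \<open>The letter \<open>(i, \<beta>)\<close> stands for the generator \<open>x\<^sub>i\<^sub>+\<^sub>1\<close> with exponent \<open>\<gamma> \<beta>\<close>,
  where the family \<open>\<gamma>\<close> is a basis of \<open>H\<close>: variables are numbered from 0.\<close>

type_synonym ('l, 'f) H_poly = "(nat \<times> 'l) free_monoid \<Rightarrow>\<^sub>0 'f"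

definition poly_scale :: "'f::field \<Rightarrow> ('g \<Rightarrow>\<^sub>0 'f) \<Rightarrow> ('g \<Rightarrow>\<^sub>0 'f)" where
  "poly_scale c = Poly_Mapping.map ((*) c)"

lemma lookup_poly_scale: "Poly_Mapping.lookup (poly_scale c p) w = c * Poly_Mapping.lookup p w"
  by (simp add: poly_scale_def Poly_Mapping.map.rep_eq when_def)

lemma vector_space_poly_scale: "vector_space (poly_scale :: 'f::field \<Rightarrow> ('g \<Rightarrow>\<^sub>0 'f) \<Rightarrow> _)"
  by standard (auto intro!: poly_mapping_eqI simp: lookup_poly_scale lookup_add algebra_simps)

definition is_basis :: "('f::field \<Rightarrow> 'h::ab_group_add \<Rightarrow> 'h) \<Rightarrow> ('l \<Rightarrow> 'h) \<Rightarrow> bool" where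
  "is_basis sH \<gamma> \<longleftrightarrow>
     inj \<gamma> \<and> \<not> module.dependent sH (range \<gamma>) \<and> module.span sH (range \<gamma>) = UNIV"

definition coord ::
  "('f::field \<Rightarrow> 'h::ab_group_add \<Rightarrow> 'h) \<Rightarrow> ('l \<Rightarrow> 'h) \<Rightarrow> 'h \<Rightarrow> 'l \<Rightarrow> 'f" where
  "coord sH \<gamma> h \<beta> = module.representation sH (range \<gamma>) h (\<gamma> \<beta>)"

text \<open>The variable number \<open>i\<close> with an arbitrary exponent \<open>h\<close>, expanded in the basis.\<close>

definition H_var ::
  "('f::field \<Rightarrow> 'h::ab_group_add \<Rightarrow> 'h) \<Rightarrow> ('l \<Rightarrow> 'h) \<Rightarrow> nat \<Rightarrow> 'h \<Rightarrow> ('l, 'f) H_poly" where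
  "H_var sH \<gamma> i h =
     (\<Sum>\<beta> | coord sH \<gamma> h \<beta> \<noteq> 0. poly_scale (coord sH \<gamma> h \<beta>) (Poly_Mapping.single (Word [(i, \<beta>)]) 1))"

text \<open>\<open>H\<close>-polynomials have no constant term, so that they can be evaluated in a non-unital algebra.\<close>

definition H_polynomials :: "('l, 'f::field) H_poly set" where
  "H_polynomials = {p. Poly_Mapping.lookup p 0 = 0}"

definition H_eval ::
  "('f::field \<Rightarrow> 'a::ring \<Rightarrow> 'a) \<Rightarrow> ('h \<Rightarrow> 'a \<Rightarrow> 'a) \<Rightarrow> ('l \<Rightarrow> 'h) \<Rightarrow> (nat \<Rightarrow> 'a) \<Rightarrow> ('l, 'f) H_poly \<Rightarrow> 'a"
  where
  "H_eval sA act \<gamma> a p =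
     (\<Sum>w\<in>Poly_Mapping.keys p. sA (Poly_Mapping.lookup p w) (nprod (map (\<lambda>(i, \<beta>). act (\<gamma> \<beta>) (a i)) (letters w))))"

lemma H_eval_alt:
  assumes "vector_space sA" "finite K" "Poly_Mapping.keys p \<subseteq> K"
  shows "H_eval sA act \<gamma> a p =
    (\<Sum>w\<in>K. sA (Poly_Mapping.lookup p w) (nprod (map (\<lambda>(i, \<beta>). act (\<gamma> \<beta>) (a i)) (letters w))))"
proof -
  interpret vector_space sA by fact
  show ?thesis unfolding H_eval_def
    by (rule sum.mono_neutral_left) (use assms in \<open>auto simp: in_keys_iff\<close>)
qed

text \<open>Evaluation at \<open>a\<close> sends the variable number \<open>i\<close> with exponent \<open>h\<close> to \<open>h (a i)\<close>, for every \<open>h\<close>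
  and not just for the basis elements.\<close>

lemma H_eval_H_var:
  fixes sA :: "'f::field \<Rightarrow> 'a::ring \<Rightarrow> 'a"
  assumes "generalized_action sH sA act" and "is_basis sH \<gamma>"
  shows "H_eval sA act \<gamma> a (H_var sH \<gamma> i h) = act h (a i)"
proof -
  interpret generalized_action sH sA act by fact
  let ?c = "coord sH \<gamma> h"
  let ?S = "{\<beta>. ?c \<beta> \<noteq> 0}"
  have inj: "inj \<gamma>" and ind: "H.independent (range \<gamma>)" and sp: "h \<in> H.span (range \<gamma>)"
    using assms(2) by (auto simp: is_basis_def)
  have img: "\<gamma> ` ?S = {v. H.representation (range \<gamma>) h v \<noteq> 0}"
    using H.representation_ne_zero by (fastforce simp: coord_def)
  have fin: "finite ?S"
    using H.finite_representation[of "range \<gamma>" h] img inj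
    by (metis finite_imageD inj_on_subset subset_UNIV)
  have "(\<Sum>v | H.representation (range \<gamma>) h v \<noteq> 0. sH (H.representation (range \<gamma>) h v) v) = h"
    by (rule H.sum_nonzero_representation_eq[OF ind sp])
  then have h: "h = (\<Sum>\<beta>\<in>?S. sH (?c \<beta>) (\<gamma> \<beta>))"
    unfolding img[symmetric] by (subst (asm) sum.reindex) (use inj in \<open>auto simp: coord_def intro: inj_on_subset\<close>)
  have act0: "act 0 x = 0" for x using act_add[of 0 0 x] by simp
  have acts: "act (\<Sum>\<beta>\<in>T. sH (?c \<beta>) (\<gamma> \<beta>)) x = (\<Sum>\<beta>\<in>T. sA (?c \<beta>) (act (\<gamma> \<beta>) x))" for T x
    by (induction T rule: infinite_finite_induct) (auto simp: act0 act_add act_scale)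
  let ?w = "\<lambda>\<beta>. Word [(i, \<beta>)]"
  have lk: "Poly_Mapping.lookup (H_var sH \<gamma> i h) (?w \<beta>) = ?c \<beta>" for \<beta>
    using fin by (simp add: H_var_def lookup_sum lookup_poly_scale lookup_single when_def if_distrib[of "\<lambda>x. _ * x"] cong: if_cong)
  have keys: "Poly_Mapping.keys (H_var sH \<gamma> i h) \<subseteq> ?w ` ?S"
    unfolding H_var_def
    by (rule order.trans[OF Poly_Mapping.keys_sum])
       (auto simp: in_keys_iff lookup_poly_scale lookup_single when_def split: if_splits)
  have "H_eval sA act \<gamma> a (H_var sH \<gamma> i h) = (\<Sum>w\<in>?w ` ?S. sA (Poly_Mapping.lookup (H_var sH \<gamma> i h) w) (nprod (map (\<lambda>(i, \<beta>). act (\<gamma> \<beta>) (a i)) (letters w))))"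
    by (rule H_eval_alt) (use keys fin A.vector_space_axioms in auto)
  also have "\<dots> = (\<Sum>\<beta>\<in>?S. sA (?c \<beta>) (act (\<gamma> \<beta>) (a i)))"
    by (subst sum.reindex) (auto simp: inj_on_def lk)
  also have "\<dots> = act h (a i)" using acts[of ?S "a i"] h by simp
  finally show ?thesis .
qed

definition H_identities ::
  "('f::field \<Rightarrow> 'a::ring \<Rightarrow> 'a) \<Rightarrow> ('h \<Rightarrow> 'a \<Rightarrow> 'a) \<Rightarrow> ('l \<Rightarrow> 'h) \<Rightarrow> ('l, 'f) H_poly set" where
  "H_identities sA act \<gamma> = {p \<in> H_polynomials. \<forall>a. H_eval sA act \<gamma> a p = 0}"

definition multilinear_H_polys ::
  "('f::field \<Rightarrow> 'h::ab_group_add \<Rightarrow> 'h) \<Rightarrow> ('l \<Rightarrow> 'h) \<Rightarrow> nat \<Rightarrow> ('l, 'f) H_poly set" where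
  "multilinear_H_polys sH \<gamma> n =
     module.span poly_scale
       {prod_list (map (\<lambda>k. H_var sH \<gamma> (\<sigma> k) (h k)) [0..<n]) | h \<sigma>. \<sigma> permutes {..<n}}"


section \<open>Codimensions\<close>

definition coset :: "'v::ab_group_add set \<Rightarrow> 'v \<Rightarrow> 'v set" where
  "coset W v = (+) v ` W"

text \<open>The cosets of \<open>e 0, \<dots>, e (k - 1)\<close> form a basis of the quotient space \<open>V / W\<close>.\<close>

definition quotient_basis ::
  "('f::field \<Rightarrow> 'v::ab_group_add \<Rightarrow> 'v) \<Rightarrow> 'v set \<Rightarrow> 'v set \<Rightarrow> nat \<Rightarrow> (nat \<Rightarrow> 'v) \<Rightarrow> bool" where
  "quotient_basis scale V W k e \<longleftrightarrow>
     (\<forall>i<k. e i \<in> V) \<and>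
     (\<forall>X \<in> coset W ` V.
       \<exists>!c. (\<forall>i\<ge>k. c i = 0) \<and> coset W (\<Sum>i<k. scale (c i) (e i)) = X)"

definition quotient_dim ::
  "('f::field \<Rightarrow> 'v::ab_group_add \<Rightarrow> 'v) \<Rightarrow> 'v set \<Rightarrow> 'v set \<Rightarrow> nat" where
  "quotient_dim scale V W = (THE k. \<exists>e. quotient_basis scale V W k e)"

context vector_space begin

lemma coset_eq_iff: assumes "subspace W" shows "coset W u = coset W v \<longleftrightarrow> u - v \<in> W"
proof
  assume "coset W u = coset W v"
  moreover have "u + 0 \<in> coset W u" unfolding coset_def using assms subspace_0 by blast
  ultimately obtain w where "w \<in> W" "u = v + w" by (auto simp: coset_def)
  then show "u - v \<in> W" by simp
next
  assume d: "u - v \<in> W"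
  have *: "x + w \<in> coset W y" if "w \<in> W" "x - y \<in> W" for x y w
  proof -
    have "x + w = y + ((x - y) + w)" by simp
    then show ?thesis unfolding coset_def using subspace_add[OF assms that(2,1)] by blast
  qed
  have "v - u \<in> W" using subspace_neg[OF assms d] by simp
  then show "coset W u = coset W v" using * d by (auto simp: coset_def[of W u] coset_def[of W v]) (auto simp: coset_def)
qed

lemma quotient_basis_le:
  assumes V: "subspace V" and W: "subspace W"
    and e: "quotient_basis scale V W k e" and e': "quotient_basis scale V W m e'"
  shows "k \<le> m"
proof -
  have "\<exists>c. (\<Sum>j<m. scale (c j) (e' j)) - e i \<in> W" if "i < k" for i
  proof -
    have "e i \<in> V" using e that by (simp add: quotient_basis_def)
    then have "\<exists>!c. (\<forall>j\<ge>m. c j = 0) \<and> coset W (\<Sum>j<m. scale (c j) (e' j)) = coset W (e i)"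
      using e' by (simp add: quotient_basis_def)
    then show ?thesis using coset_eq_iff[OF W] by blast
  qed
  then obtain c where c: "\<And>i. i < k \<Longrightarrow> (\<Sum>j<m. scale (c i j) (e' j)) - e i \<in> W" by metis
  define u where "u i = (\<Sum>j<m. scale (c i j) (e' j))" for i
  have u: "u i - e i \<in> W" if "i < k" for i using c that by (simp add: u_def)
  have zero: "\<forall>i<k. a i = 0" if "(\<Sum>i<k. scale (a i) (u i)) = 0" for a
  proof -
    have "(\<Sum>i<k. scale (a i) (u i - e i)) \<in> W"
      by (rule subspace_sum[OF W]) (use subspace_scale[OF W] u in auto)
    then have "- (\<Sum>i<k. scale (a i) (e i)) \<in> W"
      by (simp add: scale_right_diff_distrib sum_subtractf that)
    then have s: "(\<Sum>i<k. scale (a i) (e i)) \<in> W" using subspace_neg[OF W] by fastforce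
    define a' where "a' i = (if i < k then a i else 0)" for i
    have s': "(\<Sum>i<k. scale (a' i) (e i)) \<in> W" using s by (simp add: a'_def)
    define P where "P c \<longleftrightarrow> (\<forall>j\<ge>k. c j = 0) \<and> coset W (\<Sum>j<k. scale (c j) (e j)) = coset W 0" for c
    have ex: "\<exists>!c. P c"
      using e subspace_0[OF V] by (simp add: quotient_basis_def P_def)
    have 1: "P a'" using s' by (simp add: coset_eq_iff[OF W] P_def) (simp add: a'_def)
    have 2: "P (\<lambda>_. 0)" by (simp add: P_def)
    from ex 1 2 have "a' = (\<lambda>_. 0)" by blast
    then show ?thesis by (metis a'_def)
  qed
  have inj: "inj_on u {..<k}"
  proof (rule inj_onI, rule ccontr)
    fix i j assume ij: "i \<in> {..<k}" "j \<in> {..<k}" "u i = u j" "i \<noteq> j"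
    define a where "a l = (if l = i then 1 else if l = j then -1 else (0::'a))" for l
    have "(\<Sum>l<k. scale (a l) (u l)) = (\<Sum>l\<in>{i,j}. scale (a l) (u l))"
      by (rule sum.mono_neutral_right) (use ij in \<open>auto simp: a_def\<close>)
    also have "\<dots> = 0" using ij by (simp add: a_def)
    finally have "a i = 0" using zero ij by blast
    then show False by (simp add: a_def)
  qed
  have ind: "independent (u ` {..<k})"
  proof
    assume "dependent (u ` {..<k})"
    then obtain b where b: "\<exists>v\<in>u ` {..<k}. b v \<noteq> 0" "(\<Sum>v\<in>u ` {..<k}. scale (b v) v) = 0"
      by (auto simp: dependent_finite)
    from b(2) have "(\<Sum>i<k. scale (b (u i)) (u i)) = 0" by (simp add: sum.reindex[OF inj] o_def)
    from zero[OF this] b(1) show False by auto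
  qed
  have "u ` {..<k} \<subseteq> span (e' ` {..<m})"
    by (auto simp: u_def intro!: span_sum span_scale intro: span_base)
  then have "card (u ` {..<k}) \<le> card (e' ` {..<m})"
    using independent_span_bound[of "e' ` {..<m}", OF _ ind] by simp
  then show ?thesis using card_image_le[of "{..<m}" e'] by (simp add: card_image[OF inj])
qed

lemma quotient_dim_eqI:
  assumes "subspace V" "subspace W" "quotient_basis scale V W k e"
  shows "quotient_dim scale V W = k"
  unfolding quotient_dim_def
  by (rule the_equality) (use assms quotient_basis_le in \<open>blast intro: order.antisym\<close>)+

end

definition H_codim ::
  "('f::field \<Rightarrow> 'h::ab_group_add \<Rightarrow> 'h) \<Rightarrow> ('f \<Rightarrow> 'a::ring \<Rightarrow> 'a) \<Rightarrow> ('h \<Rightarrow> 'a \<Rightarrow> 'a) \<Rightarrow>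
   ('l \<Rightarrow> 'h) \<Rightarrow> nat \<Rightarrow> nat" where
  "H_codim sH sA act \<gamma> n =
     quotient_dim poly_scale (multilinear_H_polys sH \<gamma> n)
       (multilinear_H_polys sH \<gamma> n \<inter> H_identities sA act \<gamma>)"

end

theory Submission
  imports Defs "Jordan_Normal_Form.Determinant"
begin

text \<open>
  The exponent \<open>d\<close> is the largest dimension of a sum of blocks \<open>Bs i\<close>, \<open>i \<in> S\<close>, over those sets \<open>S\<close>
  for which some nonzero product of elements of blocks and of \<open>J\<close> involves exactly the blocks
  in \<open>S\<close> (such \<open>S\<close> are called \<open>admissible\<close>).

  For the upper bound, the function given by a multilinear \<open>H\<close>-polynomial is determined by its
  values at tuples of elements of a basis adapted to the sum of \<open>J\<close> and the blocks. Such a value is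
  a combination of products in which every entry of the tuple occurs once, moved by \<open>H\<close> inside its
  component. If it is nonzero, then the blocks that occur form an admissible set, and the number
  of entries from \<open>J\<close> is bounded because \<open>J\<close> is nilpotent (\<open>radical_nilpotent\<close>). There are at most
  \<open>d ^ n\<close> such tuples up to a polynomial factor (\<open>card_sparse_words\<close>), and the codimension is at
  most their number times the dimension of \<open>A\<close> (\<open>codim_bounds\<close>).

  For the lower bound, take an admissible \<open>S\<close> whose sum of blocks has dimension \<open>d\<close>. A block is
  irreducible under its multiplications and \<open>H\<close>, so by Jacobson density and Schur's lemma its
  coordinate functionals are realized by polynomial operators with constants
  (\<open>dual_operator\<close>). When these are inserted into the nonzero product and the result is
  antisymmetrized, a multilinear \<open>H\<close>-polynomial in \<open>d + c\<close> variables arises whose value is the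
  determinant of its first \<open>d\<close> arguments times a fixed nonzero element, for \<open>d\<close> arguments in the sum
  of the blocks and with certain constants as the last \<open>c\<close> arguments (\<open>seed_exists\<close>). Replacing each
  determinant argument \<open>x\<close> in turn by \<open>y * z * x\<close> and summing multiplies the value by the trace of the
  left multiplication by \<open>y * z\<close>. This bilinear form in \<open>y\<close> and \<open>z\<close> is nondegenerate on the sum of the
  blocks, since the blocks are semisimple and the
  characteristic is 0 (\<open>mult_trace_nondegenerate\<close>). The antisymmetrization of a product of \<open>d\<close> of
  its values is, up to a nonzero constant, the determinant of all the \<open>y\<close> times the determinant of
  all the \<open>z\<close> (\<open>det_fun_Gram\<close>). So every product of \<open>2 * k\<close> determinants in disjoint sets of \<open>d\<close> variables is
  realized, and \<open>c\<close> does not grow with \<open>k\<close> (\<open>realized_all_columns\<close>).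

  These products span the representation of the symmetric group that belongs to a \<open>d\<close> by \<open>2 * k\<close>
  rectangle. Its dimension is bounded from below directly: the products that belong to standard
  tableaux of this shape, encoded as ballot words, are linearly independent because they have
  distinct leading words (\<open>ballot_weights_independent\<close>), and a formula of Frobenius, proved by a
  recurrence, shows that the number of these tableaux is at least \<open>d ^ (2 * k * d)\<close> up to a
  polynomial factor (\<open>card_rectangular_ballot\<close>).
\<close>

section \<open>Determinants of square arrays\<close>

text \<open>Determinants are taken of functions of two indices, so that replacing a row is a function
  update.\<close>

definition det_fun :: "nat \<Rightarrow> (nat \<Rightarrow> nat \<Rightarrow> 'f::comm_ring_1) \<Rightarrow> 'f" where
  "det_fun n x = det (mat n n (\<lambda>(i, j). x i j))"

lemma det_fun_Leibniz:
  "det_fun n x = (\<Sum>p | p permutes {..<n}. of_int (sign p) * (\<Prod>i<n. x i (p i)))"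
proof -
  have "(\<Prod>i<n. mat n n (\<lambda>(i, j). x i j) $$ (i, p i)) = (\<Prod>i<n. x i (p i))" if "p permutes {..<n}" for p
    by (rule prod.cong) (use permutes_in_image[OF that] in auto)
  then show ?thesis
    unfolding det_fun_def by (subst det_def'[where n = n]) (auto simp: atLeast0LessThan)
qed

lemma det_fun_cong: "(\<And>i j. i < n \<Longrightarrow> j < n \<Longrightarrow> x i j = y i j) \<Longrightarrow> det_fun n x = det_fun n y"
  unfolding det_fun_def by (rule arg_cong[where f = det]) (rule eq_matI, auto)

lemma det_fun_permute_rows:
  assumes "p permutes {..<n}"
  shows "det_fun n (\<lambda>i. x (p i)) = of_int (sign p) * det_fun n x"
proof -
  have "det_fun n (\<lambda>i. x (p i)) = det (mat n n (\<lambda>(i, j). mat n n (\<lambda>(i, j). x i j) $$ (p i, j)))"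
    unfolding det_fun_def
    by (rule arg_cong[where f = det], rule eq_matI) (use permutes_in_image[OF assms] in auto)
  also have "\<dots> = of_int (sign p) * det_fun n x"
    unfolding det_fun_def by (rule det_permute_rows) (use assms in \<open>auto simp: atLeast0LessThan\<close>)
  finally show ?thesis .
qed

lemma det_fun_identical_rows:
  assumes "i < n" "j < n" "i \<noteq> j" "\<And>l. l < n \<Longrightarrow> x i l = x j l"
  shows "det_fun n x = 0"
  unfolding det_fun_def
  by (rule det_identical_rows[of _ n i j]) (use assms in \<open>auto intro!: eq_vecI\<close>)

lemma det_fun_transpose: "det_fun n (\<lambda>i j. x j i) = det_fun n x"
proof -
  have "mat n n (\<lambda>(i, j). x j i) = transpose_mat (mat n n (\<lambda>(i, j). x i j))"
    by (rule eq_matI) auto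
  then show ?thesis unfolding det_fun_def by (simp add: det_transpose[of _ n])
qed

lemma det_fun_mult: "det_fun n (\<lambda>i j. \<Sum>k<n. x i k * y k j) = det_fun n x * det_fun n y"
proof -
  have "mat n n (\<lambda>(i, j). \<Sum>k<n. x i k * y k j) = mat n n (\<lambda>(i, j). x i j) * mat n n (\<lambda>(i, j). y i j)"
    by (rule eq_matI) (auto simp: scalar_prod_def atLeast0LessThan)
  then show ?thesis unfolding det_fun_def by (simp add: det_mult[of _ n])
qed

lemma det_fun_nonzero:
  fixes x :: "nat \<Rightarrow> nat \<Rightarrow> 'f::field"
  assumes "\<And>v. (\<And>i. i < n \<Longrightarrow> (\<Sum>j<n. x i j * v j) = 0) \<Longrightarrow> \<forall>j<n. v j = 0"
  shows "det_fun n x \<noteq> 0"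
proof
  let ?A = "mat n n (\<lambda>(i, j). x i j)"
  assume "det_fun n x = 0"
  then obtain v where v: "v \<in> carrier_vec n" "v \<noteq> 0\<^sub>v n" "?A *\<^sub>v v = 0\<^sub>v n"
    using det_0_iff_vec_prod_zero_field[of ?A n] by (auto simp: det_fun_def)
  have "(\<Sum>j<n. x i j * v $ j) = 0" if "i < n" for i
  proof -
    have "(?A *\<^sub>v v) $ i = (\<Sum>j<n. x i j * v $ j)"
      using v(1) that by (auto simp: scalar_prod_def atLeast0LessThan intro!: sum.cong)
    then show ?thesis using v(3) that by simp
  qed
  then have "\<forall>j<n. v $ j = 0" by (rule assms)
  with v(1,2) show False by auto
qed

lemma det_fun_update_row:
  assumes i: "i < n"
  shows "det_fun n (x(i := y)) = (\<Sum>j<n. y j * cofactor (mat n n (\<lambda>(i, j). x i j)) i j)"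
proof -
  let ?A = "mat n n (\<lambda>(k, j). (x(i := y)) k j)"
  have "det_fun n (x(i := y)) = (\<Sum>j<n. ?A $$ (i, j) * cofactor ?A i j)"
    unfolding det_fun_def by (rule laplace_expansion_row[OF _ i]) simp
  also have "\<dots> = (\<Sum>j<n. y j * cofactor (mat n n (\<lambda>(i, j). x i j)) i j)"
  proof (rule sum.cong[OF refl])
    fix j assume "j \<in> {..<n}"
    have "mat_delete ?A i j = mat_delete (mat n n (\<lambda>(i, j). x i j)) i j"
      by (rule eq_matI) (auto simp: mat_delete_def)
    then show "?A $$ (i, j) * cofactor ?A i j = y j * cofactor (mat n n (\<lambda>(i, j). x i j)) i j"
      using i \<open>j \<in> {..<n}\<close> by (simp add: cofactor_def)
  qed
  finally show ?thesis .
qed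

text \<open>Expand every summand along the replaced row. The cofactors along this row are those of \<open>x\<close>,
  and their pairing with the columns of \<open>x\<close> is the determinant on the diagonal of \<open>L\<close> and 0 off it.\<close>

lemma det_fun_derivation:
  "(\<Sum>i<n. det_fun n (x(i := \<lambda>j. \<Sum>l<n. L j l * x i l))) = (\<Sum>j<n. L j j) * det_fun n x"
proof -
  let ?A = "mat n n (\<lambda>(i, j). x i j)"
  let ?c = "cofactor ?A"
  have adj: "(\<Sum>i<n. ?c i j * x i l) = (if j = l then det_fun n x else 0)" if "j < n" "l < n" for j l
  proof -
    have "(adj_mat ?A * ?A) $$ (j, l) = (\<Sum>i<n. ?c i j * x i l)"
      using that by (auto simp: adj_mat_def scalar_prod_def atLeast0LessThan intro!: sum.cong)
    moreover have "(adj_mat ?A * ?A) $$ (j, l) = (if j = l then det_fun n x else 0)"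
      using that by (subst adj_mat(3)[of ?A n]) (auto simp: det_fun_def)
    ultimately show ?thesis by simp
  qed
  have "(\<Sum>i<n. det_fun n (x(i := \<lambda>j. \<Sum>l<n. L j l * x i l)))
      = (\<Sum>i<n. \<Sum>j<n. \<Sum>l<n. L j l * (?c i j * x i l))"
    by (simp add: det_fun_update_row sum_distrib_left sum_distrib_right mult_ac)
  also have "\<dots> = (\<Sum>j<n. \<Sum>i<n. \<Sum>l<n. L j l * (?c i j * x i l))"
    by (rule sum.swap)
  also have "\<dots> = (\<Sum>j<n. \<Sum>l<n. \<Sum>i<n. L j l * (?c i j * x i l))"
    by (rule sum.cong[OF refl], rule sum.swap)
  also have "\<dots> = (\<Sum>j<n. \<Sum>l<n. L j l * (if j = l then det_fun n x else 0))"
    by (intro sum.cong refl) (simp add: sum_distrib_left[symmetric] adj)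
  also have "\<dots> = (\<Sum>j<n. L j j * det_fun n x)"
    by (intro sum.cong refl) (simp add: if_distrib[of "\<lambda>t. _ * t"] cong: if_cong)
  finally show ?thesis by (simp add: sum_distrib_right)
qed

text \<open>The sum is the Leibniz expansion of the determinant of the product of \<open>y\<close>, \<open>M\<close> and the transpose
  of \<open>z\<close>. It turns products of values of a bilinear form into a product of two determinants.\<close>

lemma det_fun_Gram:
  "(\<Sum>p | p permutes {..<n}. of_int (sign p) *
      (\<Prod>i<n. \<Sum>k<n. \<Sum>l<n. y i k * M k l * z (p i) l)) = det_fun n M * det_fun n y * det_fun n z"
proof -
  have "(\<Sum>p | p permutes {..<n}. of_int (sign p) *
      (\<Prod>i<n. \<Sum>k<n. \<Sum>l<n. y i k * M k l * z (p i) l))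
      = det_fun n (\<lambda>i j. \<Sum>l<n. (\<Sum>k<n. y i k * M k l) * z j l)"
  proof -
    have "(\<Sum>k<n. \<Sum>l<n. y i k * M k l * z j l) = (\<Sum>l<n. (\<Sum>k<n. y i k * M k l) * z j l)" for i j
      by (subst sum.swap) (simp add: sum_distrib_right)
    then show ?thesis by (simp add: det_fun_Leibniz)
  qed
  also have "\<dots> = det_fun n (\<lambda>i l. \<Sum>k<n. y i k * M k l) * det_fun n (\<lambda>l j. z j l)"
    by (rule det_fun_mult)
  also have "\<dots> = det_fun n M * det_fun n y * det_fun n z"
        unfolding det_fun_mult det_fun_transpose[of n z]
    by (simp only: det_fun_mult[of n y M] mult.commute[of "det_fun n y"])
  finally show ?thesis .
qed

lemma det_fun_lower_triangular:
  assumes "\<And>i j. i < j \<Longrightarrow> j < n \<Longrightarrow> x i j = 0"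
  shows "det_fun n x = (\<Prod>i<n. x i i)"
proof -
  have "det_fun n x = prod_list (diag_mat (mat n n (\<lambda>(i, j). x i j)))"
    unfolding det_fun_def by (rule det_lower_triangular[of n]) (use assms in auto)
  also have "diag_mat (mat n n (\<lambda>(i, j). x i j)) = map (\<lambda>i. x i i) [0..<n]"
    by (auto simp: diag_mat_def)
  also have "prod_list \<dots> = (\<Prod>i<n. x i i)"
    by (simp add: prod.list_conv_set_nth atLeast0LessThan)
  finally show ?thesis .
qed

section \<open>Ballot words and their number\<close>

definition falling_fact :: "nat \<Rightarrow> real \<Rightarrow> real" where
  "falling_fact j t = (\<Prod>k<j. t - real k)"

lemma falling_fact_shift: "t * falling_fact j (t - 1) = (t - real j) * falling_fact j t"
proof -
  have "t * falling_fact j (t - 1) = falling_fact (Suc j) t"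
    unfolding falling_fact_def prod.lessThan_Suc_shift by (simp add: algebra_simps)
  then show ?thesis by (simp add: falling_fact_def mult.commute)
qed

lemma falling_fact_of_nat: "falling_fact j (real n) = fact j * real (n choose j)"
  by (simp add: falling_fact_def binomial_gbinomial gbinomial_prod_rev atLeast0LessThan)

text \<open>This is the Vandermonde determinant of \<open>x\<close>: falling factorials span the same polynomials as
  powers, by a unitriangular change of basis. In this form, the effect of lowering one argument by 1
  can be read off from each term of the Leibniz expansion.\<close>

definition falling_vandermonde :: "nat \<Rightarrow> (nat \<Rightarrow> real) \<Rightarrow> real" where
  "falling_vandermonde D x = det_fun D (\<lambda>i j. falling_fact j (x i))"

lemma falling_vandermonde_cong: "(\<And>i. i < D \<Longrightarrow> x i = y i) \<Longrightarrow> falling_vandermonde D x = falling_vandermonde D y"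
  unfolding falling_vandermonde_def by (rule det_fun_cong) simp

lemma falling_vandermonde_eq_zero: "i < D \<Longrightarrow> j < D \<Longrightarrow> i \<noteq> j \<Longrightarrow> x i = x j \<Longrightarrow> falling_vandermonde D x = 0"
  unfolding falling_vandermonde_def by (rule det_fun_identical_rows[of i D j]) auto

text \<open>In the Leibniz term of a permutation \<open>p\<close>, lowering \<open>x i\<close> by 1 and multiplying by \<open>x i\<close> amounts to
  multiplication by \<open>x i - p i\<close>, and the sum of the numbers \<open>p i\<close> does not depend on \<open>p\<close>.\<close>

lemma falling_vandermonde_recurrence:
  "(\<Sum>i<D. x i * falling_vandermonde D (x(i := x i - 1))) = ((\<Sum>i<D. x i) - (\<Sum>j<D. real j)) * falling_vandermonde D x"
proof -
  have 1: "(\<Sum>i<D. x i * (\<Prod>k<D. falling_fact (p k) ((x(i := x i - 1)) k)))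
     = ((\<Sum>i<D. x i) - (\<Sum>j<D. real j)) * (\<Prod>k<D. falling_fact (p k) (x k))" if p: "p permutes {..<D}" for p
  proof -
    have "x i * (\<Prod>k<D. falling_fact (p k) ((x(i := x i - 1)) k)) = (x i - real (p i)) * (\<Prod>k<D. falling_fact (p k) (x k))"
      if "i < D" for i
    proof -
      have "(\<Prod>k<D. falling_fact (p k) ((x(i := x i - 1)) k)) = falling_fact (p i) (x i - 1) * (\<Prod>k\<in>{..<D} - {i}. falling_fact (p k) (x k))"
        using that by (subst prod.remove[of _ i]) (auto intro!: prod.cong)
      moreover have "(\<Prod>k<D. falling_fact (p k) (x k)) = falling_fact (p i) (x i) * (\<Prod>k\<in>{..<D} - {i}. falling_fact (p k) (x k))"
        using that by (subst prod.remove[of _ i]) auto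
      ultimately show ?thesis using falling_fact_shift[of "x i" "p i"] by (simp add: mult.assoc[symmetric])
    qed
    then have "(\<Sum>i<D. x i * (\<Prod>k<D. falling_fact (p k) ((x(i := x i - 1)) k)))
        = (\<Sum>i<D. (x i - real (p i)) * (\<Prod>k<D. falling_fact (p k) (x k)))" by simp
    also have "\<dots> = ((\<Sum>i<D. x i) - (\<Sum>i<D. real (p i))) * (\<Prod>k<D. falling_fact (p k) (x k))"
      by (simp add: sum_distrib_right[symmetric] sum_subtractf)
    also have "(\<Sum>i<D. real (p i)) = (\<Sum>j<D. real j)"
      using sum.permute[OF p, of real] by (simp add: o_def)
    finally show ?thesis .
  qed
  have "(\<Sum>i<D. x i * falling_vandermonde D (x(i := x i - 1)))
     = (\<Sum>i<D. \<Sum>p | p permutes {..<D}. of_int (sign p) * (x i * (\<Prod>k<D. falling_fact (p k) ((x(i := x i - 1)) k))))"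
    by (simp add: falling_vandermonde_def det_fun_Leibniz sum_distrib_left mult_ac)
  also have "\<dots> = (\<Sum>p | p permutes {..<D}. of_int (sign p) * (((\<Sum>i<D. x i) - (\<Sum>j<D. real j)) * (\<Prod>k<D. falling_fact (p k) (x k))))"
    by (subst sum.swap, rule sum.cong[OF refl]) (simp only: sum_distrib_left[symmetric] 1 mem_Collect_eq)
  also have "\<dots> = ((\<Sum>i<D. x i) - (\<Sum>j<D. real j)) * falling_vandermonde D x"
    by (simp add: falling_vandermonde_def det_fun_Leibniz sum_distrib_left mult_ac)
  finally show ?thesis .
qed

text \<open>By the Vandermonde convolution of binomial coefficients, the array is the product of a lower
  triangular array with ones on the diagonal and an upper triangular one with the factorials on the
  diagonal.\<close>

lemma falling_vandermonde_interval: "falling_vandermonde D (\<lambda>i. real (M + i)) = (\<Prod>j<D. fact j)"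
proof -
  let ?U = "\<lambda>k j. if k \<le> j then fact j * real (M choose (j - k)) else 0"
  have "falling_fact j (real (M + i)) = (\<Sum>k<D. real (i choose k) * ?U k j)" if "j < D" for i j
  proof -
    have "falling_fact j (real (M + i)) = fact j * real ((i + M) choose j)" by (simp only: falling_fact_of_nat add.commute)
    also have "\<dots> = (\<Sum>k\<le>j. real (i choose k) * ?U k j)"
      unfolding vandermonde[symmetric] by (simp add: sum_distrib_left mult_ac)
    also have "\<dots> = (\<Sum>k<D. real (i choose k) * ?U k j)"
      by (rule sum.mono_neutral_left) (use that in auto)
    finally show ?thesis .
  qed
  then have "falling_vandermonde D (\<lambda>i. real (M + i)) = det_fun D (\<lambda>i j. \<Sum>k<D. real (i choose k) * ?U k j)"
    unfolding falling_vandermonde_def by (intro det_fun_cong) auto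
  also have "\<dots> = det_fun D (\<lambda>i k. real (i choose k)) * det_fun D ?U" by (rule det_fun_mult)
  also have "det_fun D (\<lambda>i k. real (i choose k)) = 1"
    by (subst det_fun_lower_triangular) auto
  also have "det_fun D ?U = (\<Prod>j<D. fact j)"
    by (subst det_fun_transpose[symmetric], subst det_fun_lower_triangular) auto
  finally show ?thesis by simp
qed

text \<open>In every prefix, the letter \<open>i\<close> occurs at most as often as the letter \<open>i + 1\<close>. Such words encode
  the standard Young tableaux with \<open>c i\<close> entries in row \<open>i\<close>, where the rows are numbered from the
  bottom: the letter at a position is the row that contains the position.\<close>

definition ballot :: "nat \<Rightarrow> (nat \<Rightarrow> nat) \<Rightarrow> nat list set" where
  "ballot D c = {w. set w \<subseteq> {..<D} \<and> (\<forall>i. count_list w i = c i) \<and>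
     (\<forall>t\<le>length w. \<forall>i. Suc i < D \<longrightarrow> count_list (take t w) i \<le> count_list (take t w) (Suc i))}"

lemma length_eq_sum_count: "set w \<subseteq> {..<D} \<Longrightarrow> length w = (\<Sum>i<D. count_list w i)" for D :: nat
  by (rule sum_count_set[symmetric]) auto

lemma ballot_length: "w \<in> ballot D c \<Longrightarrow> length w = (\<Sum>i<D. c i)"
  using length_eq_sum_count[of w D] by (simp add: ballot_def)

lemma finite_ballot: "finite (ballot D c)"
proof (rule finite_subset)
  show "ballot D c \<subseteq> {w. set w \<subseteq> {..<D} \<and> length w = (\<Sum>i<D. c i)}"
    using ballot_length by (fastforce simp: ballot_def)
qed (rule finite_lists_length_eq, simp)

lemma ballot_snoc_iff:
  "w @ [i] \<in> ballot D c \<longleftrightarrow>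
     i < D \<and> 0 < c i \<and> w \<in> ballot D (c(i := c i - 1)) \<and> (\<forall>k. Suc k < D \<longrightarrow> c k \<le> c (Suc k))"
proof -
  have take: "(\<forall>t\<le>Suc (length w). P (take t (w @ [i]))) \<longleftrightarrow> (\<forall>t\<le>length w. P (take t w)) \<and> P (w @ [i])" for P
    by (auto simp: le_Suc_eq)
  have cnt: "(\<forall>k. count_list (w @ [i]) k = c k) \<longleftrightarrow> 0 < c i \<and> (\<forall>k. count_list w k = (c(i := c i - 1)) k)"
    by (auto simp: fun_eq_iff)
  have last: "(\<forall>k. Suc k < D \<longrightarrow> count_list (w @ [i]) k \<le> count_list (w @ [i]) (Suc k)) \<longleftrightarrow> (\<forall>k. Suc k < D \<longrightarrow> c k \<le> c (Suc k))"
    if "\<forall>k. count_list (w @ [i]) k = c k" using that by metis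
  show ?thesis
    unfolding ballot_def mem_Collect_eq
    using take[of "\<lambda>u. \<forall>k. Suc k < D \<longrightarrow> count_list u k \<le> count_list u (Suc k)"] cnt last
    by (auto simp del: count_list_append take_append)
qed

lemma ballot_nonmono: "\<not> (\<forall>k. Suc k < D \<longrightarrow> c k \<le> c (Suc k)) \<Longrightarrow> ballot D c = {}"
  by (auto simp: ballot_def) (metis le_refl take_all)

lemma card_ballot_rec:
  assumes mono: "\<forall>k. Suc k < D \<longrightarrow> c k \<le> c (Suc k)" and pos: "0 < (\<Sum>i<D. c i)"
  shows "card (ballot D c) = (\<Sum>i | i < D \<and> 0 < c i. card (ballot D (c(i := c i - 1))))"
proof -
  let ?I = "{i. i < D \<and> 0 < c i}"
  let ?W = "\<lambda>i. (\<lambda>w. w @ [i]) ` ballot D (c(i := c i - 1))"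
  have "ballot D c = (\<Union>i\<in>?I. ?W i)"
  proof (intro Set.set_eqI iffI)
    fix w assume w: "w \<in> ballot D c"
    then have "w \<noteq> []" using ballot_length[OF w] pos by auto
    then obtain u i where "w = u @ [i]" by (metis rev_exhaust)
    then show "w \<in> (\<Union>i\<in>?I. ?W i)" using w by (auto simp: ballot_snoc_iff)
  qed (auto simp: ballot_snoc_iff mono)
  moreover have "card (\<Union>i\<in>?I. ?W i) = (\<Sum>i\<in>?I. card (?W i))"
    by (rule card_UN_disjoint) (auto simp: finite_ballot)
  moreover have "card (?W i) = card (ballot D (c(i := c i - 1)))" for i
    by (rule card_image) (simp add: inj_on_def)
  ultimately show ?thesis by simp
qed

text \<open>Both sides satisfy the same recurrence. On the left, it comes from the deletion of the last
  letter; on the right, it is \<open>falling_vandermonde_recurrence\<close>. If the deletion of a letter \<open>i\<close> makes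
  the counts non-monotone, then there is no ballot word with the new counts, and the Vandermonde
  determinant vanishes because two of its arguments have become equal.\<close>

lemma card_ballot:
  assumes "\<forall>k. Suc k < D \<longrightarrow> c k \<le> c (Suc k)" "\<forall>i\<ge>D. c i = 0"
  shows "real (card (ballot D c)) * (\<Prod>i<D. fact (c i + i)) = fact (\<Sum>i<D. c i) * falling_vandermonde D (\<lambda>i. real (c i + i))"
  using assms
proof (induction "\<Sum>i<D. c i" arbitrary: c)
  case 0
  have c0: "c = (\<lambda>_. 0)" using 0 by (auto simp: fun_eq_iff) (metis lessThan_iff not_less)
  have "ballot D c = {[]}"
    using ballot_length[of _ D c] c0 by (auto simp: ballot_def)
  then show ?case using falling_vandermonde_interval[of D 0] by (simp add: c0)
next
  case (Suc n)
  let ?x = "\<lambda>i. real (c i + i)"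
  let ?c = "\<lambda>i. c(i := c i - 1)"
  have summand: "real (card (ballot D (?c i))) * (\<Prod>k<D. fact (c k + k)) = fact n * (?x i * falling_vandermonde D (?x(i := ?x i - 1)))"
    if i: "i < D" "0 < c i" for i
  proof -
    have x: "?x(i := ?x i - 1) = (\<lambda>k. real (?c i k + k))" using i by (auto simp: fun_eq_iff)
    have n: "n = (\<Sum>k<D. ?c i k)"
    proof -
      have "(\<Sum>k<D. c k) = c i + (\<Sum>k\<in>{..<D} - {i}. c k)" using i by (subst sum.remove[of _ i]) auto
      moreover have "(\<Sum>k<D. ?c i k) = (c i - 1) + (\<Sum>k\<in>{..<D} - {i}. c k)"
        using i by (subst sum.remove[of _ i]) auto
      ultimately show ?thesis using Suc(2) i by simp
    qed
    have fa: "(\<Prod>k<D. fact (c k + k) :: real) = ?x i * (\<Prod>k<D. fact (?c i k + k))"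
    proof -
      have "(\<Prod>k<D. fact (c k + k) :: real) = fact (c i + i) * (\<Prod>k\<in>{..<D} - {i}. fact (c k + k))"
        using i by (subst prod.remove[of _ i]) auto
      moreover have "(\<Prod>k<D. fact (?c i k + k) :: real) = fact (c i - 1 + i) * (\<Prod>k\<in>{..<D} - {i}. fact (c k + k))"
        using i by (subst prod.remove[of _ i]) auto
      moreover have "(fact (c i + i) :: real) = ?x i * fact (c i - 1 + i)"
        using i by (cases "c i") (auto simp: algebra_simps)
      ultimately show ?thesis by simp
    qed
    show ?thesis
    proof (cases "\<forall>k. Suc k < D \<longrightarrow> ?c i k \<le> ?c i (Suc k)")
      case True
      have "real (card (ballot D (?c i))) * (\<Prod>k<D. fact (?c i k + k)) = fact n * falling_vandermonde D (\<lambda>k. real (?c i k + k))"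
      proof -
        have "\<forall>k\<ge>D. ?c i k = 0" using Suc.prems(2) i by auto
        from Suc(1)[OF n True this] show ?thesis by (simp only: n[symmetric])
      qed
      then show ?thesis unfolding fa x by (simp add: mult_ac)
    next
      case False
      then obtain k where k: "Suc k < D" "\<not> ?c i k \<le> ?c i (Suc k)" by blast
      have "c k \<le> c (Suc k)" using Suc.prems(1) k(1) by blast
      with k i have "Suc k = i" "c k = c i" by (auto split: if_splits)
      then have "falling_vandermonde D (?x(i := ?x i - 1)) = 0"
        using k(1) by (intro falling_vandermonde_eq_zero[of k D i]) auto
      moreover have "ballot D (?c i) = {}" by (rule ballot_nonmono[OF False])
      ultimately show ?thesis by (simp only: card.empty of_nat_0 mult_zero_left mult_zero_right)
    qed
  qed
  \<comment> \<open>a letter that does not occur cannot be deleted; the corresponding summand of the recurrence is 0\<close>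
  have zero: "?x i * falling_vandermonde D (?x(i := ?x i - 1)) = 0" if i: "i < D" "c i = 0" for i
  proof (cases i)
    case 0 then show ?thesis using i by simp
  next
    case (Suc k)
    have "c k = 0" using Suc.prems(1) i Suc by (metis le_zero_eq)
    then have "falling_vandermonde D (?x(i := ?x i - 1)) = 0"
      using i Suc by (intro falling_vandermonde_eq_zero[of k D i]) auto
    then show ?thesis by simp
  qed
  have "real (card (ballot D c)) * (\<Prod>i<D. fact (c i + i))
     = (\<Sum>i | i < D \<and> 0 < c i. real (card (ballot D (?c i))) * (\<Prod>k<D. fact (c k + k)))"
    using card_ballot_rec[OF Suc.prems(1)] Suc(2) by (simp add: sum_distrib_right)
  also have "\<dots> = (\<Sum>i | i < D \<and> 0 < c i. fact n * (?x i * falling_vandermonde D (?x(i := ?x i - 1))))"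
    by (rule sum.cong) (use summand in auto)
  also have "\<dots> = (\<Sum>i<D. fact n * (?x i * falling_vandermonde D (?x(i := ?x i - 1))))"
    by (rule sum.mono_neutral_left) (use zero in auto)
  also have "\<dots> = fact n * (((\<Sum>i<D. ?x i) - (\<Sum>j<D. real j)) * falling_vandermonde D ?x)"
    by (simp only: sum_distrib_left[symmetric] falling_vandermonde_recurrence)
  also have "(\<Sum>i<D. ?x i) - (\<Sum>j<D. real j) = real (Suc n)"
    using Suc(2) by (simp add: sum.distrib flip: of_nat_sum)
  also have "fact n * (real (Suc n) * falling_vandermonde D ?x) = fact (Suc n) * falling_vandermonde D ?x"
    by (simp only: fact_Suc of_nat_mult mult_ac)
  finally show ?case unfolding Suc(2) .
qed

lemma fact_add_le: "(fact (M + i) :: real) \<le> fact M * real (M + i) ^ i"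
proof (induction i)
  case (Suc i)
  have "(fact (M + Suc i) :: real) = real (M + Suc i) * fact (M + i)" by (simp add: algebra_simps)
  also have "\<dots> \<le> real (M + Suc i) * (fact M * real (M + i) ^ i)"
    using Suc by (intro mult_left_mono) auto
  also have "\<dots> \<le> real (M + Suc i) * (fact M * real (M + Suc i) ^ i)"
    by (intro mult_left_mono power_mono) auto
  finally show ?case by (simp add: mult_ac)
qed simp

text \<open>From \<open>M\<close> to \<open>M + 1\<close>, the multinomial coefficient \<open>fact (D * M) / fact M ^ D\<close> is multiplied by
  the \<open>D\<close> numbers \<open>(D * M + k) / (M + 1)\<close>, all of which are at least \<open>D * M / (M + 1)\<close>.\<close>

lemma multinomial_lower:
  assumes "M \<ge> 1"
  shows "real D ^ (D * M) * fact M ^ D \<le> real D ^ D * fact (D * M) * real M ^ D"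
  using assms
proof (induction M rule: dec_induct)
  case base
  show ?case by (simp add: mult_le_cancel_left1 fact_ge_1)
next
  case (step M)
  have fa: "fact (D * M + k) * real (Suc M) ^ k \<ge> fact (D * M) * (real D * real M * real (Suc M)) ^ k" if "k \<le> D" for k
  proof (induction k)
    case (Suc k)
    have "fact (D * M) * (real D * real M * real (Suc M)) ^ Suc k
        = (real D * real M * real (Suc M)) * (fact (D * M) * (real D * real M * real (Suc M)) ^ k)" by simp
    also have "\<dots> \<le> (real (D * M + Suc k) * real (Suc M)) * (fact (D * M + k) * real (Suc M) ^ k)"
      by (intro mult_mono Suc mult_right_mono) auto
    also have "\<dots> = fact (D * M + Suc k) * real (Suc M) ^ Suc k" by (simp add: algebra_simps)
    finally show ?case .
  qed simp
  have "real M ^ D * (real D ^ (D * Suc M) * fact (Suc M) ^ D)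
      = (real D * real M * real (Suc M)) ^ D * (real D ^ (D * M) * fact M ^ D)"
    by (simp add: power_add power_mult_distrib mult_ac del: of_nat_Suc)
  also have "\<dots> \<le> (real D * real M * real (Suc M)) ^ D * (real D ^ D * fact (D * M) * real M ^ D)"
    by (intro mult_left_mono step.IH) auto
  also have "\<dots> = real D ^ D * real M ^ D * (fact (D * M) * (real D * real M * real (Suc M)) ^ D)"
    by (simp add: mult_ac)
  also have "\<dots> \<le> real D ^ D * real M ^ D * (fact (D * M + D) * real (Suc M) ^ D)"
    by (intro mult_left_mono fa) auto
  also have "\<dots> = real M ^ D * (real D ^ D * fact (D * Suc M) * real (Suc M) ^ D)"
    by (simp add: mult_ac add.commute)
  finally show ?case using step.hyps by simp
qed

text \<open>For equal counts, the Vandermonde determinant in \<open>card_ballot\<close> is a product of factorials and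
  hence at least 1. What remains differs from a multinomial coefficient by a factor that is
  polynomial in \<open>M\<close>.\<close>

lemma card_rectangular_ballot:
  assumes "M \<ge> 1"
  shows "real D ^ (D * M) \<le>
    real (card (ballot D (\<lambda>i. if i < D then M else 0))) * (real D ^ D * real (M + D) ^ (D + D * D))"
proof -
  let ?c = "\<lambda>i. if i < D then M else 0"
  let ?N = "real (card (ballot D ?c))"
  have s: "(\<Sum>i<D. ?c i) = D * M" by simp
  have "?N * (\<Prod>i<D. fact (?c i + i)) = fact (\<Sum>i<D. ?c i) * falling_vandermonde D (\<lambda>i. real (?c i + i))"
    by (rule card_ballot) auto
  also have "falling_vandermonde D (\<lambda>i. real (?c i + i)) = falling_vandermonde D (\<lambda>i. real (M + i))"
    by (rule falling_vandermonde_cong) simp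
  also have "fact (\<Sum>i<D. ?c i) * falling_vandermonde D (\<lambda>i. real (M + i)) \<ge> (fact (D * M) :: real)"
    unfolding s falling_vandermonde_interval by (simp add: prod_ge_1)
  finally have 1: "fact (D * M) \<le> ?N * (\<Prod>i<D. fact (?c i + i))" .
  have "(\<Prod>i<D. fact (?c i + i) :: real) \<le> (\<Prod>i<D. fact M * real (M + D) ^ D)"
  proof (rule prod_mono)
    fix i assume i: "i \<in> {..<D}"
    have "(fact (M + i) :: real) \<le> fact M * real (M + i) ^ i" by (rule fact_add_le)
    also have "\<dots> \<le> fact M * real (M + D) ^ i"
      using i by (intro mult_left_mono power_mono) auto
    also have "\<dots> \<le> fact M * real (M + D) ^ D"
      using i assms by (intro mult_left_mono power_increasing) auto
    finally show "0 \<le> (fact (?c i + i) :: real) \<and> fact (?c i + i) \<le> fact M * real (M + D) ^ D" using i by simp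
  qed
  also have "\<dots> = fact M ^ D * real (M + D) ^ (D * D)" by (simp add: power_mult_distrib power_mult)
  finally have 2: "fact (D * M) \<le> ?N * (fact M ^ D * real (M + D) ^ (D * D))"
    using 1 by (meson mult_left_mono of_nat_0_le_iff order_trans)
  have "real D ^ (D * M) * fact M ^ D \<le> real D ^ D * fact (D * M) * real M ^ D"
    by (rule multinomial_lower[OF assms])
  also have "\<dots> \<le> real D ^ D * (?N * (fact M ^ D * real (M + D) ^ (D * D))) * real (M + D) ^ D"
    by (intro mult_mono mult_left_mono 2 power_mono) auto
  also have "\<dots> = ?N * (real D ^ D * real (M + D) ^ (D + D * D)) * fact M ^ D"
    by (simp add: power_add mult_ac)
  finally show ?thesis by (rule mult_right_le_imp_le) simp
qed

section \<open>Columns of a ballot word\<close>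

lemma count_list_take_mono: "p \<le> p' \<Longrightarrow> count_list (take p w) i \<le> count_list (take p' w) i"
proof -
  assume "p \<le> p'"
  then have "take p' w = take p w @ take (p' - p) (drop p w)"
    by (metis le_add_diff_inverse take_add)
  then show ?thesis by simp
qed

lemma count_list_take_Suc: "p < length w \<Longrightarrow> count_list (take (Suc p) w) i = count_list (take p w) i + (if w ! p = i then 1 else 0)"
  by (simp add: take_Suc_conv_app_nth)

lemma nth_occurrence: "j < count_list w i \<Longrightarrow> \<exists>p<length w. w ! p = i \<and> count_list (take p w) i = j"
proof (induction w rule: rev_induct)
  case (snoc x w)
  show ?case
  proof (cases "j < count_list w i")
    case True
    then obtain p where "p < length w" "w ! p = i" "count_list (take p w) i = j" using snoc.IH by blast
    then show ?thesis by (intro exI[of _ p]) (auto simp: nth_append)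
  next
    case False
    then have "x = i" "j = count_list w i" using snoc.prems by (auto split: if_splits)
    then show ?thesis by (intro exI[of _ "length w"]) auto
  qed
qed simp

lemma occurrence_unique:
  assumes "p < length w" "p' < length w" "w ! p = i" "w ! p' = i" "count_list (take p w) i = count_list (take p' w) i"
  shows "p = p'"
proof -
  have False if "p < p'" "p' < length w" "w ! p = i" "count_list (take p w) i = count_list (take p' w) i" for p p'
    using count_list_take_Suc[of p w i] count_list_take_mono[of "Suc p" p' w i] that by simp
  then show ?thesis using assms by (metis linorder_neqE_nat)
qed

locale ballot_word =
  fixes D M :: nat and w :: "nat list"
  assumes w: "w \<in> ballot D (\<lambda>i. if i < D then M else 0)"
begin

lemma len: "length w = D * M"
  using ballot_length[OF w] by simp

lemma word: "set w \<subseteq> {..<D}" and cnt: "i < D \<Longrightarrow> count_list w i = M"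
  and bal: "t \<le> length w \<Longrightarrow> Suc i < D \<Longrightarrow> count_list (take t w) i \<le> count_list (take t w) (Suc i)"
  using w by (auto simp: ballot_def)

text \<open>In the tableau of the word, this is the entry in column \<open>j\<close> and row \<open>i\<close>.\<close>

definition pos :: "nat \<Rightarrow> nat \<Rightarrow> nat" where
  "pos j i = (SOME p. p < length w \<and> w ! p = i \<and> count_list (take p w) i = j)"

lemma pos: "j < M \<Longrightarrow> i < D \<Longrightarrow> pos j i < length w \<and> w ! pos j i = i \<and> count_list (take (pos j i) w) i = j"
  unfolding pos_def by (rule someI_ex) (use nth_occurrence[of j w i] cnt[of i] in auto)

lemma pos_eq: "j < M \<Longrightarrow> i < D \<Longrightarrow> p < length w \<Longrightarrow> w ! p = i \<Longrightarrow> count_list (take p w) i = j \<Longrightarrow> p = pos j i"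
  using occurrence_unique pos by metis

lemma pos_bij: "bij_betw (\<lambda>(j, i). pos j i) ({..<M} \<times> {..<D}) {..<D * M}"
proof -
  let ?f = "\<lambda>(j, i). pos j i"
  have inj: "inj_on ?f ({..<M} \<times> {..<D})"
  proof (rule inj_onI)
    fix x y assume "x \<in> {..<M} \<times> {..<D}" "y \<in> {..<M} \<times> {..<D}" and eq: "?f x = ?f y"
    then obtain j i j' i' where x: "x = (j, i)" "j < M" "i < D" and y: "y = (j', i')" "j' < M" "i' < D" by auto
    show "x = y" using pos[OF x(2,3)] pos[OF y(2,3)] eq x(1) y(1) by auto
  qed
  moreover have "?f ` ({..<M} \<times> {..<D}) = {..<D * M}"
  proof (rule card_subset_eq)
    show "?f ` ({..<M} \<times> {..<D}) \<subseteq> {..<D * M}" using pos len by auto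
    show "card (?f ` ({..<M} \<times> {..<D})) = card {..<D * M}"
      by (simp add: card_image[OF inj] card_cartesian_product)
  qed simp
  ultimately show ?thesis by (simp add: bij_betw_def)
qed

text \<open>When the letter \<open>i\<close> in column \<open>j\<close> is reached, the prefix contains \<open>j + 1\<close> letters \<open>i\<close>. By the
  ballot condition it contains as many letters \<open>i + 1\<close>, so the one in column \<open>j\<close> has been passed.\<close>

lemma pos_Suc: assumes "j < M" "Suc i < D" shows "pos j (Suc i) < pos j i"
proof -
  let ?p = "pos j i"
  have p: "?p < length w" "w ! ?p = i" "count_list (take ?p w) i = j" using pos[of j i] assms by auto
  have "Suc j = count_list (take (Suc ?p) w) i" using count_list_take_Suc[OF p(1), of i] p by simp
  also have "\<dots> \<le> count_list (take (Suc ?p) w) (Suc i)" by (rule bal) (use p assms in auto)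
  also have "\<dots> = count_list (take ?p w) (Suc i)" using count_list_take_Suc[OF p(1), of "Suc i"] p by simp
  finally have "j < count_list (take ?p w) (Suc i)" by simp
  from nth_occurrence[OF this]
  obtain p' where p': "p' < length (take ?p w)" "take ?p w ! p' = Suc i" "count_list (take p' (take ?p w)) (Suc i) = j"
    by (elim exE conjE)
  then have "p' < ?p" by simp
  have "take p' (take ?p w) = take p' w" using \<open>p' < ?p\<close> by (simp add: min_def)
  moreover have "w ! p' = Suc i" using p'(2) \<open>p' < ?p\<close> by simp
  moreover have "p' < length w" using \<open>p' < ?p\<close> p(1) by simp
  ultimately have "p' = pos j (Suc i)" using pos_eq[OF assms] p'(3) by simp
  then show ?thesis using \<open>p' < ?p\<close> by simp
qed

lemma pos_mono: "j < M \<Longrightarrow> i < i' \<Longrightarrow> i' < D \<Longrightarrow> pos j i' < pos j i"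
proof (induction i')
  case (Suc i')
  show ?case
  proof (cases "i = i'")
    case True
    then show ?thesis using pos_Suc Suc.prems by simp
  next
    case False
    then have "pos j i' < pos j i" using Suc by simp
    then show ?thesis using pos_Suc[of j i'] Suc.prems by simp
  qed
qed simp

text \<open>To each column of the tableau belongs the determinant of the variables whose numbers are in the
  column. This is the value of the product of these determinants when the variable number \<open>p\<close> is the
  standard basis vector number \<open>v ! p\<close>.\<close>

definition weight :: "nat list \<Rightarrow> 'f::comm_ring_1" where
  "weight v = (\<Prod>j<M. det_fun D (\<lambda>i l. if v ! pos j i = l then 1 else 0))"

lemma weight_self: "weight w = (1 :: 'f::comm_ring_1)"
proof -
  have "det_fun D (\<lambda>i l. if w ! pos j i = l then 1 else 0) = (1 :: 'f)" if "j < M" for j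
  proof -
    have "det_fun D (\<lambda>i l. if w ! pos j i = l then 1 else 0) = det_fun D (\<lambda>i l. if i = l then 1 else (0 :: 'f))"
    proof (rule det_fun_cong)
      fix i l assume "i < D"
      then have "w ! pos j i = i" using pos[OF that] by blast
      then show "(if w ! pos j i = l then 1 else 0) = (if i = l then 1 else (0 :: 'f))" by simp
    qed
    also have "\<dots> = 1" by (subst det_fun_lower_triangular) auto
    finally show ?thesis .
  qed
  then show ?thesis by (simp add: weight_def)
qed

text \<open>Let \<open>p\<close> be the first position at which the words differ, and \<open>j\<close> and \<open>i\<close> its column and row. The
  entries of column \<open>j\<close> in the rows \<open>i' > i\<close> are smaller than \<open>p\<close>, so \<open>v\<close> has the letters \<open>i'\<close> there.
  As the determinant of column \<open>j\<close> does not vanish, \<open>v\<close> has distinct letters along this column.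
  Therefore its letter at \<open>p\<close> is smaller than \<open>i\<close>.\<close>

lemma weight_leading:
  assumes v: "set v \<subseteq> {..<D}" "length v = D * M" and nz: "weight v \<noteq> (0 :: 'f::comm_ring_1)" and ne: "v \<noteq> w"
  shows "(v, w) \<in> lex less_than"
proof -
  have "\<exists>p<length w. v ! p \<noteq> w ! p" using ne v(2) len by (metis nth_equalityI)
  then obtain p0 where p0: "p0 < length w \<and> v ! p0 \<noteq> w ! p0" by blast
  define p where "p = (LEAST p. p < length w \<and> v ! p \<noteq> w ! p)"
  have p: "p < length w" "v ! p \<noteq> w ! p" unfolding p_def using LeastI[of "\<lambda>p. p < length w \<and> v ! p \<noteq> w ! p", OF p0] by auto
  have min: "v ! p' = w ! p'" if "p' < p" for p'
    using not_less_Least[of p' "\<lambda>p. p < length w \<and> v ! p \<noteq> w ! p"] that p(1) unfolding p_def by auto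
  obtain j i where ji: "j < M" "i < D" "p = pos j i"
  proof -
    have "p \<in> (\<lambda>(j, i). pos j i) ` ({..<M} \<times> {..<D})"
      using pos_bij p(1) len by (simp add: bij_betw_def)
    then show ?thesis using that by auto
  qed
  have wp: "w ! p = i" using pos ji by simp
  have col: "v ! pos j i1 \<noteq> v ! pos j i2" if "i1 < D" "i2 < D" "i1 \<noteq> i2" for i1 i2
  proof
    assume eq: "v ! pos j i1 = v ! pos j i2"
    have "det_fun D (\<lambda>i l. if v ! pos j i = l then 1 else (0 :: 'f)) = 0"
      by (rule det_fun_identical_rows[OF that]) (simp add: eq)
    then have "weight v = (0 :: 'f)" unfolding weight_def using ji(1) by (intro prod_zero) auto
    then show False using nz by simp
  qed
  have "v ! p < D" using v p(1) len by (metis lessThan_iff nth_mem subsetD)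
  have "v ! p < i"
  proof (rule ccontr)
    assume "\<not> v ! p < i"
    then have less: "i < v ! p" using p(2) wp by simp
    let ?i = "v ! p"
    have "pos j ?i < p" using pos_mono[OF ji(1) less \<open>v ! p < D\<close>] ji(3) by simp
    then have "v ! pos j ?i = ?i" using min pos[OF ji(1) \<open>v ! p < D\<close>] by simp
    then show False using col[OF ji(2) \<open>v ! p < D\<close>] less ji(3) by simp
  qed
  have tk: "take p v = take p w" using min p(1) v(2) len by (intro nth_equalityI) auto
  have "v = take p v @ v ! p # drop (Suc p) v" "w = take p w @ w ! p # drop (Suc p) w"
    using id_take_nth_drop p(1) v(2) len by metis+
  then have "v = take p w @ v ! p # drop (Suc p) v" "w = take p w @ w ! p # drop (Suc p) w" unfolding tk by blast+
  moreover have "(v ! p, w ! p) \<in> less_than" using \<open>v ! p < i\<close> wp by simp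
  moreover have "length v = length w" using v(2) len by simp
  ultimately show ?thesis unfolding lex_conv mem_Collect_eq case_prod_conv by metis
qed

end

lemma lex_maximal:
  assumes "finite X" "X \<noteq> {}"
  obtains x where "x \<in> X" "\<And>y. y \<in> X \<Longrightarrow> (x, y) \<notin> lex (less_than :: (nat \<times> nat) set)"
proof -
  let ?r = "lex (less_than :: (nat \<times> nat) set) \<inter> X \<times> X"
  have "acyclic ?r"
    by (rule acyclic_subset[OF wf_acyclic[OF wf_lex[OF wf_less_than]]]) blast
  then have "wf (?r\<inverse>)" using assms(1) by (intro finite_acyclic_wf_converse) auto
  obtain x0 where "x0 \<in> X" using assms(2) by blast
  then obtain x where "x \<in> X" "\<And>y. (y, x) \<in> ?r\<inverse> \<Longrightarrow> y \<notin> X" using wfE_min[OF \<open>wf (?r\<inverse>)\<close>] by metis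
  then show ?thesis using that by blast
qed

text \<open>By \<open>weight_leading\<close> the array of the weights is triangular with ones on the diagonal: evaluate
  at a lexicographically maximal word with a nonzero coefficient.\<close>

lemma ballot_weights_independent:
  fixes c :: "nat list \<Rightarrow> 'f::comm_ring_1"
  assumes "\<And>v. set v \<subseteq> {..<D} \<Longrightarrow> length v = D * M \<Longrightarrow>
      (\<Sum>w\<in>ballot D (\<lambda>i. if i < D then M else 0). c w * ballot_word.weight D M w v) = 0"
    and w: "w \<in> ballot D (\<lambda>i. if i < D then M else 0)"
  shows "c w = 0"
proof (rule ccontr)
  let ?B = "ballot D (\<lambda>i. if i < D then M else 0)"
  let ?X = "{w \<in> ?B. c w \<noteq> 0}"
  assume "c w \<noteq> 0"
  then have "?X \<noteq> {}" using w by blast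
  moreover have "finite ?X" using finite_ballot by simp
  ultimately obtain u where u: "u \<in> ?X" and max: "\<And>y. y \<in> ?X \<Longrightarrow> (u, y) \<notin> lex less_than"
    by (elim lex_maximal[rotated]) blast
  interpret u: ballot_word D M u by standard (use u in simp)
  have "(\<Sum>w\<in>?B. c w * ballot_word.weight D M w u) = (\<Sum>w\<in>{u}. c w * ballot_word.weight D M w u)"
  proof (rule sum.mono_neutral_right[OF finite_ballot])
    show "\<forall>y\<in>?B - {u}. c y * ballot_word.weight D M y u = 0"
    proof
      fix y assume y: "y \<in> ?B - {u}"
      interpret y: ballot_word D M y by standard (use y in simp)
      show "c y * y.weight u = 0"
      proof (rule ccontr)
        assume "c y * y.weight u \<noteq> 0"
        then have "c y \<noteq> 0" "y.weight u \<noteq> (0 :: 'f)" by auto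
        then have "(u, y) \<in> lex less_than" using y.weight_leading[OF u.word u.len] y by blast
        then show False using max y \<open>c y \<noteq> 0\<close> by blast
      qed
    qed
  qed (use u in auto)
  then have "c u * u.weight u = 0" using assms(1)[OF u.word u.len] by simp
  then show False using u by (simp add: u.weight_self)
qed

section \<open>Dimension of a quotient space\<close>

definition indep_mod :: "('f::field \<Rightarrow> 'v::ab_group_add \<Rightarrow> 'v) \<Rightarrow> 'v set \<Rightarrow> nat \<Rightarrow> (nat \<Rightarrow> 'v) \<Rightarrow> bool" where
  "indep_mod scale W k e \<longleftrightarrow> (\<forall>c. (\<Sum>i<k. scale (c i) (e i)) \<in> W \<longrightarrow> (\<forall>i<k. c i = 0))"

context vector_space begin

lemma indep_mod_zero_card:
  assumes "finite S" and ind: "indep_mod scale {0} k u" and sp: "\<And>i. i < k \<Longrightarrow> u i \<in> span S"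
  shows "k \<le> card S"
proof -
  have zero: "\<forall>i<k. a i = 0" if "(\<Sum>i<k. scale (a i) (u i)) = 0" for a
    using ind that by (auto simp: indep_mod_def)
  have inj: "inj_on u {..<k}"
  proof (rule inj_onI, rule ccontr)
    fix i j assume ij: "i \<in> {..<k}" "j \<in> {..<k}" "u i = u j" "i \<noteq> j"
    define a where "a l = (if l = i then 1 else if l = j then -1 else (0::'a))" for l
    have "(\<Sum>l<k. scale (a l) (u l)) = (\<Sum>l\<in>{i,j}. scale (a l) (u l))"
      by (rule sum.mono_neutral_right) (use ij in \<open>auto simp: a_def\<close>)
    also have "\<dots> = 0" using ij by (simp add: a_def)
    finally have "a i = 0" using zero ij by blast
    then show False by (simp add: a_def)
  qed
  have "independent (u ` {..<k})"
  proof
    assume "dependent (u ` {..<k})"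
    then obtain b where b: "\<exists>v\<in>u ` {..<k}. b v \<noteq> 0" "(\<Sum>v\<in>u ` {..<k}. scale (b v) v) = 0"
      by (auto simp: dependent_finite)
    from b(2) have "(\<Sum>i<k. scale (b (u i)) (u i)) = 0" by (simp add: sum.reindex[OF inj] o_def)
    from zero[OF this] b(1) show False by auto
  qed
  moreover have "u ` {..<k} \<subseteq> span S" using sp by auto
  ultimately have "card (u ` {..<k}) \<le> card S"
    using independent_span_bound[OF \<open>finite S\<close>] by blast
  then show ?thesis by (simp add: card_image[OF inj])
qed

text \<open>A family of maximal length among the families in \<open>V\<close> that are independent modulo \<open>W\<close> is a basis
  of the quotient.\<close>

lemma quotient_basis_exists:
  assumes V: "subspace V" and W: "subspace W"
    and bound: "\<And>k e. (\<And>i. i < k \<Longrightarrow> e i \<in> V) \<Longrightarrow> indep_mod scale W k e \<Longrightarrow> k \<le> M"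
  shows "\<exists>k e. quotient_basis scale V W k e \<and> (\<forall>i<k. e i \<in> V) \<and> indep_mod scale W k e \<and>
    (\<forall>k' e'. (\<forall>i<k'. e' i \<in> V) \<longrightarrow> indep_mod scale W k' e' \<longrightarrow> k' \<le> k)"
proof -
  define P where "P k \<longleftrightarrow> (\<exists>e. (\<forall>i<k. e i \<in> V) \<and> indep_mod scale W k e)" for k
  have P0: "P 0" by (auto simp: P_def indep_mod_def)
  have PM: "\<forall>k. P k \<longrightarrow> k \<le> M" using bound by (auto simp: P_def)
  define k where "k = Greatest P"
  have "P k" unfolding k_def using P0 PM by (metis GreatestI_nat)
  have max: "k' \<le> k" if "P k'" for k' unfolding k_def using that PM by (metis Greatest_le_nat)
  obtain e where e: "\<And>i. i < k \<Longrightarrow> e i \<in> V" and ind: "indep_mod scale W k e"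
    using \<open>P k\<close> by (auto simp: P_def)
  have ex: "\<exists>c. (\<forall>i\<ge>k. c i = 0) \<and> coset W (\<Sum>i<k. scale (c i) (e i)) = coset W v" if v: "v \<in> V" for v
  proof -
    let ?e = "e(k := v)"
    have "\<not> indep_mod scale W (Suc k) ?e"
    proof
      assume "indep_mod scale W (Suc k) ?e"
      moreover have "\<forall>i<Suc k. ?e i \<in> V" using e v by auto
      ultimately have "P (Suc k)" unfolding P_def by blast
      from max[OF this] show False by simp
    qed
    then obtain c j where c: "(\<Sum>i<Suc k. scale (c i) (?e i)) \<in> W" and j: "j < Suc k" "c j \<noteq> 0"
      by (auto simp: indep_mod_def)
    have sm: "(\<Sum>i<k. scale (c i) (e i)) + scale (c k) v \<in> W" using c by simp
    have ck: "c k \<noteq> 0"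
    proof
      assume "c k = 0"
      then have "(\<Sum>i<k. scale (c i) (e i)) \<in> W" using sm by simp
      then have "\<forall>i<k. c i = 0" using ind by (simp add: indep_mod_def)
      then show False using j \<open>c k = 0\<close> by (auto simp: less_Suc_eq)
    qed
    define d where "d i = (if i < k then - c i / c k else 0)" for i
    have "(\<Sum>i<k. scale (d i) (e i)) - v = scale (- 1 / c k) ((\<Sum>i<k. scale (c i) (e i)) + scale (c k) v)"
      using ck by (simp add: scale_right_distrib scale_sum_right d_def)
    also have "\<dots> \<in> W" by (rule subspace_scale[OF W sm])
    finally show ?thesis using coset_eq_iff[OF W] by (intro exI[of _ d]) (auto simp: d_def)
  qed
  have un: "c = d" if c: "\<forall>i\<ge>k. c i = 0" "coset W (\<Sum>i<k. scale (c i) (e i)) = X"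
    and d: "\<forall>i\<ge>k. d i = 0" "coset W (\<Sum>i<k. scale (d i) (e i)) = X" for c d X
  proof -
    have "(\<Sum>i<k. scale (c i) (e i)) - (\<Sum>i<k. scale (d i) (e i)) \<in> W"
      using c d coset_eq_iff[OF W] by metis
    then have "(\<Sum>i<k. scale (c i - d i) (e i)) \<in> W"
      by (simp add: scale_left_diff_distrib sum_subtractf)
    then have "\<forall>i<k. c i - d i = 0" using ind unfolding indep_mod_def by (elim allE[of _ "\<lambda>i. c i - d i"]) blast
    then show ?thesis using c d by (metis eq_iff_diff_eq_0 ext not_less)
  qed
  have "quotient_basis scale V W k e"
    unfolding quotient_basis_def
  proof (intro conjI ballI allI impI)
    fix X assume "X \<in> coset W ` V"
    then obtain v where "v \<in> V" "X = coset W v" by auto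
    then obtain c where "(\<forall>i\<ge>k. c i = 0) \<and> coset W (\<Sum>i<k. scale (c i) (e i)) = X"
      using ex by metis
    then show "\<exists>!c. (\<forall>i\<ge>k. c i = 0) \<and> coset W (\<Sum>i<k. scale (c i) (e i)) = X"
      using un by (intro ex_ex1I) blast+
  qed (use e in auto)
  moreover have "k' \<le> k" if "\<forall>i<k'. e' i \<in> V" "indep_mod scale W k' e'" for k' e'
    using max that by (auto simp: P_def)
  ultimately show ?thesis using e ind by blast
qed

text \<open>With these bounds, bases of the quotient need not be handled: a bound on the length of all
  independent families bounds the dimension from above, a single independent family bounds it from
  below.\<close>

lemma quotient_dim_bounds:
  assumes V: "subspace V" and W: "subspace W"
    and bound: "\<And>k e. (\<And>i. i < k \<Longrightarrow> e i \<in> V) \<Longrightarrow> indep_mod scale W k e \<Longrightarrow> k \<le> M"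
  shows quotient_dim_upper: "quotient_dim scale V W \<le> M"
    and quotient_dim_lower: "\<And>k e. (\<And>i. i < k \<Longrightarrow> e i \<in> V) \<Longrightarrow> indep_mod scale W k e \<Longrightarrow> k \<le> quotient_dim scale V W"
proof -
  obtain k e where k: "quotient_basis scale V W k e" "\<forall>i<k. e i \<in> V" "indep_mod scale W k e"
    "\<forall>k' e'. (\<forall>i<k'. e' i \<in> V) \<longrightarrow> indep_mod scale W k' e' \<longrightarrow> k' \<le> k"
    using quotient_basis_exists[of V W M, OF V W] bound by metis
  have q: "quotient_dim scale V W = k" by (rule quotient_dim_eqI[OF V W k(1)])
  show "quotient_dim scale V W \<le> M" unfolding q by (rule bound[of k e]) (use k in auto)
  show "\<And>k e. (\<And>i. i < k \<Longrightarrow> e i \<in> V) \<Longrightarrow> indep_mod scale W k e \<Longrightarrow> k \<le> quotient_dim scale V W"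
    unfolding q using k(4) by blast
qed

end

text \<open>On \<open>X\<close>, the functions are combinations of \<open>card X\<close> indicator functions.\<close>

lemma independent_functions_bound:
  fixes g :: "nat \<Rightarrow> 'x \<Rightarrow> 'f::field"
  assumes fin: "finite X" and ind: "\<And>c. (\<And>x. x \<in> X \<Longrightarrow> (\<Sum>i<k. c i * g i x) = 0) \<Longrightarrow> \<forall>i<k. c i = 0"
  shows "k \<le> card X"
proof -
  interpret vector_space "poly_scale :: 'f \<Rightarrow> ('x \<Rightarrow>\<^sub>0 'f) \<Rightarrow> _" by (rule vector_space_poly_scale)
  let ?s = "\<lambda>x. Poly_Mapping.single x 1 :: 'x \<Rightarrow>\<^sub>0 'f"
  define u where "u i = (\<Sum>x\<in>X. poly_scale (g i x) (?s x))" for i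
  have lk: "Poly_Mapping.lookup (u i) x = g i x" if "x \<in> X" for i x
    using that fin by (simp add: u_def lookup_sum lookup_poly_scale lookup_single when_def if_distrib[of "\<lambda>t. _ * t"] cong: if_cong)
  have "indep_mod poly_scale {0} k u"
    unfolding indep_mod_def
  proof (intro allI impI)
    fix c i assume 0: "(\<Sum>i<k. poly_scale (c i) (u i)) \<in> {0}" and i: "i < k"
    have "(\<Sum>i<k. c i * g i x) = 0" if "x \<in> X" for x
    proof -
      have "Poly_Mapping.lookup (\<Sum>i<k. poly_scale (c i) (u i)) x = (\<Sum>i<k. c i * g i x)"
        by (simp add: lookup_sum lookup_poly_scale lk that)
      then show ?thesis using 0 by simp
    qed
    then show "c i = 0" using ind i by blast
  qed
  then have "k \<le> card (?s ` X)"
    by (rule indep_mod_zero_card[rotated])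
       (use fin in \<open>auto simp: u_def intro!: span_sum span_scale intro: span_base\<close>)
  also have "\<dots> \<le> card X" by (rule card_image_le[OF fin])
  finally show ?thesis .
qed

section \<open>Functions given by multilinear \<open>H\<close>-polynomials\<close>

lemma nprod_append: "xs \<noteq> [] \<Longrightarrow> ys \<noteq> [] \<Longrightarrow> nprod (xs @ ys) = nprod xs * nprod ys"
  by (induction xs rule: nprod.induct; cases ys) (auto simp: mult.assoc)

lemma nprod_Cons: "ys \<noteq> [] \<Longrightarrow> nprod (x # ys) = x * nprod ys"
  by (cases ys) auto

context generalized_action begin

lemma act_hom: "module_hom sA sA (act h)"
  using act_linear by (simp add: Vector_Spaces.linear_def)

lemma act_plus: "act h (x + y) = act h x + act h y"
  using module_hom.add[OF act_hom] by simp
lemma act_smult: "act h (sA c x) = sA c (act h x)"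
  using module_hom.scale[OF act_hom] by simp
lemma act_0: "act h 0 = 0"
  using act_smult[of h 0 0] by simp

text \<open>The functions of \<open>a\<close> given by \<open>H\<close>-polynomials in which every monomial contains each variable
  numbered by an element of \<open>I\<close> exactly once and no other variable. Closure under \<open>H\<close>, substitution and renaming are
  inductions over these rules.\<close>

inductive multilin :: "nat set \<Rightarrow> ((nat \<Rightarrow> 'a) \<Rightarrow> 'a) \<Rightarrow> bool" where
  var: "multilin {i} (\<lambda>a. act h (a i))"
| mult: "multilin I F \<Longrightarrow> multilin K G \<Longrightarrow> I \<inter> K = {} \<Longrightarrow> multilin (I \<union> K) (\<lambda>a. F a * G a)"
| add: "multilin I F \<Longrightarrow> multilin I G \<Longrightarrow> multilin I (\<lambda>a. F a + G a)"
| scale: "multilin I F \<Longrightarrow> multilin I (\<lambda>a. sA c (F a))"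

lemma multilin_cong: "multilin I F \<Longrightarrow> (\<And>i. i \<in> I \<Longrightarrow> a i = b i) \<Longrightarrow> F a = F b"
proof (induction rule: multilin.induct)
  case (mult I F K G)
  then show ?case by (metis UnCI)
qed auto

lemma multilin_upd: "multilin I F \<Longrightarrow> i \<notin> I \<Longrightarrow> F (a(i := x)) = F a"
  by (erule multilin_cong) auto

lemma multilin_slot_add: "multilin I F \<Longrightarrow> i \<in> I \<Longrightarrow> F (a(i := x + y)) = F (a(i := x)) + F (a(i := y))"
proof (induction rule: multilin.induct)
  case (mult I F K G)
  show ?case
  proof (cases "i \<in> I")
    case True
    then have "i \<notin> K" using mult by auto
    then show ?thesis using True mult multilin_upd[OF mult(2)] by (simp add: distrib_right del: fun_upd_apply)
  next
    case False
    then show ?thesis using mult multilin_upd[OF mult(1)] by (simp add: distrib_left del: fun_upd_apply)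
  qed
qed (auto simp: act_plus A.scale_right_distrib)

lemma multilin_slot_scale: "multilin I F \<Longrightarrow> i \<in> I \<Longrightarrow> F (a(i := sA c x)) = sA c (F (a(i := x)))"
proof (induction rule: multilin.induct)
  case (mult I F K G)
  show ?case
  proof (cases "i \<in> I")
    case True
    then have "i \<notin> K" using mult by auto
    then show ?thesis using True mult multilin_upd[OF mult(2)] by (simp add: A.scale_mult_left del: fun_upd_apply)
  next
    case False
    then show ?thesis using mult multilin_upd[OF mult(1)] by (simp add: A.scale_mult_right del: fun_upd_apply)
  qed
next
  case (add I F G)
  then show ?case by (simp add: A.scale_right_distrib del: fun_upd_apply)
qed (auto simp: act_smult A.scale_left_commute)

lemma multilin_slot_sum: "multilin I F \<Longrightarrow> i \<in> I \<Longrightarrow>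
    F (a(i := \<Sum>x\<in>X. sA (c x) (f x))) = (\<Sum>x\<in>X. sA (c x) (F (a(i := f x))))"
proof (induction X rule: infinite_finite_induct)
  case (insert x X)
  then show ?case by (simp add: multilin_slot_add multilin_slot_scale del: fun_upd_apply)
qed (use multilin_slot_scale[of I F i a 0 0] in auto)

lemma multilin_zero: "multilin I F \<Longrightarrow> multilin I (\<lambda>a. 0)"
  using multilin.scale[of I F 0] by simp

lemma multilin_sum:
  assumes "multilin I F0" "\<And>x. x \<in> X \<Longrightarrow> multilin I (F x)"
  shows "multilin I (\<lambda>a. \<Sum>x\<in>X. F x a)"
  using assms(2)
  by (induction X rule: infinite_finite_induct) (auto intro: multilin_zero[OF assms(1)] multilin.add)

lemma multilin_sum_list:
  assumes "multilin I F0" "\<And>x. x \<in> set xs \<Longrightarrow> multilin I (F x)"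
  shows "multilin I (\<lambda>a. \<Sum>x\<leftarrow>xs. F x a)"
  using assms(2) by (induction xs) (auto intro: multilin_zero[OF assms(1)] multilin.add)

text \<open>This is where the identity for \<open>h (a * b)\<close> in a generalized action enters: it expresses the
  action on a product by products of the same variables, in one order or the other.\<close>

lemma multilin_act: "multilin I F \<Longrightarrow> multilin I (\<lambda>a. act h (F a))"
proof (induction arbitrary: h rule: multilin.induct)
  case (var i g)
  then show ?case using multilin.var[of i "h * g"] by (simp add: act_mult)
next
  case (mult I F K G)
  obtain qs where qs: "\<And>a b. act h (a * b) =
        (\<Sum>(h1, h2, h3, h4)\<leftarrow>qs. act h1 a * act h2 b + act h3 b * act h4 a)"
    using act_prod[of h] by blast
  have "multilin (I \<union> K) (\<lambda>a. \<Sum>q\<leftarrow>qs. case q of (h1, h2, h3, h4) \<Rightarrow>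
          act h1 (F a) * act h2 (G a) + act h3 (G a) * act h4 (F a))"
  proof (rule multilin_sum_list[OF multilin.mult[OF mult(1,2,3)]])
    fix q assume "q \<in> set qs"
    obtain h1 h2 h3 h4 where q: "q = (h1, h2, h3, h4)" by (cases q) auto
    have "multilin (I \<union> K) (\<lambda>a. act h1 (F a) * act h2 (G a))"
      by (intro multilin.mult mult.IH mult(3))
    moreover have "multilin (K \<union> I) (\<lambda>a. act h3 (G a) * act h4 (F a))"
      by (intro multilin.mult mult.IH) (use mult(3) in auto)
    ultimately show "multilin (I \<union> K) (\<lambda>a. case q of (h1, h2, h3, h4) \<Rightarrow>
          act h1 (F a) * act h2 (G a) + act h3 (G a) * act h4 (F a))"
      by (auto simp: q Un_commute intro: multilin.add)
  qed
  then show ?case by (simp add: qs)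
next
  case (add I F G)
  then show ?case using multilin.add by (simp add: act_plus)
next
  case (scale I F c)
  then show ?case using multilin.scale by (simp add: act_smult)
qed

lemma multilin_subst:
  assumes "multilin I F" "i \<in> I" "multilin K G" "K \<inter> (I - {i}) = {}"
  shows "multilin (I - {i} \<union> K) (\<lambda>a. F (a(i := G a)))"
  using assms
proof (induction rule: multilin.induct)
  case (var j h)
  then show ?case by (simp add: multilin_act)
next
  case (mult I1 F1 I2 F2)
  show ?case
  proof (cases "i \<in> I1")
    case True
    then have i: "i \<notin> I2" using mult by auto
    have "multilin ((I1 - {i} \<union> K) \<union> I2) (\<lambda>a. F1 (a(i := G a)) * F2 a)"
      using mult True i by (intro multilin.mult) (auto simp del: fun_upd_apply)
    moreover have "(I1 - {i} \<union> K) \<union> I2 = I1 \<union> I2 - {i} \<union> K" using i by auto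
    ultimately show ?thesis using multilin_upd[OF mult(2) i] by (simp del: fun_upd_apply)
  next
    case False
    then have i: "i \<in> I2" using mult by auto
    have "multilin (I1 \<union> (I2 - {i} \<union> K)) (\<lambda>a. F1 a * F2 (a(i := G a)))"
      using mult False i by (intro multilin.mult) (auto simp del: fun_upd_apply)
    moreover have "I1 \<union> (I2 - {i} \<union> K) = I1 \<union> I2 - {i} \<union> K" using False by auto
    ultimately show ?thesis using multilin_upd[OF mult(1) False] by (simp del: fun_upd_apply)
  qed
qed (auto intro: multilin.add multilin.scale simp del: fun_upd_apply)

lemma multilin_rename:
  "multilin I F \<Longrightarrow> inj_on r I \<Longrightarrow> multilin (r ` I) (\<lambda>a. F (\<lambda>i. a (r i)))"
proof (induction rule: multilin.induct)
  case (mult I F K G)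
  then have "multilin (r ` I \<union> r ` K) (\<lambda>a. F (\<lambda>i. a (r i)) * G (\<lambda>i. a (r i)))"
    by (intro multilin.mult) (auto simp: inj_on_def)
  then show ?case by (simp add: image_Un)
qed (auto intro: multilin.intros)

end

lemma lookup_mult_0:
  fixes p q :: "'g free_monoid \<Rightarrow>\<^sub>0 'f::field"
  assumes "Poly_Mapping.lookup p 0 = 0" 
  shows "Poly_Mapping.lookup (p * q) 0 = 0"
proof (rule ccontr)
  assume "Poly_Mapping.lookup (p * q) 0 \<noteq> 0"
  then have "0 \<in> Poly_Mapping.keys (p * q)" by (simp add: in_keys_iff)
  then obtain u v where "0 = u + v" "u \<in> Poly_Mapping.keys p" using keys_mult[of p q] by blast
  moreover then have "u = 0" by (cases u) (simp add: zero_free_monoid_def plus_free_monoid_def)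
  ultimately show False using assms by (simp add: in_keys_iff)
qed

lemma poly_mapping_sum_single:
  "(\<Sum>u\<in>Poly_Mapping.keys p. Poly_Mapping.single u (Poly_Mapping.lookup p u)) = p"
proof (rule poly_mapping_eqI)
  fix w
  show "Poly_Mapping.lookup (\<Sum>u\<in>Poly_Mapping.keys p. Poly_Mapping.single u (Poly_Mapping.lookup p u)) w = Poly_Mapping.lookup p w"
    by (simp add: lookup_sum lookup_single when_def in_keys_iff cong: if_cong)
qed

lemma poly_mapping_mult_sum:
  fixes p q :: "'g free_monoid \<Rightarrow>\<^sub>0 'f::field"
  shows "p * q = (\<Sum>u\<in>Poly_Mapping.keys p. \<Sum>v\<in>Poly_Mapping.keys q.
    Poly_Mapping.single (u + v) (Poly_Mapping.lookup p u * Poly_Mapping.lookup q v))"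
proof -
  have "p * q = (\<Sum>u\<in>Poly_Mapping.keys p. Poly_Mapping.single u (Poly_Mapping.lookup p u)) *
     (\<Sum>v\<in>Poly_Mapping.keys q. Poly_Mapping.single v (Poly_Mapping.lookup q v))"
    by (simp only: poly_mapping_sum_single)
  also have "\<dots> = (\<Sum>u\<in>Poly_Mapping.keys p. \<Sum>v\<in>Poly_Mapping.keys q.
    Poly_Mapping.single (u + v) (Poly_Mapping.lookup p u * Poly_Mapping.lookup q v))"
    unfolding sum_distrib_right by (simp add: sum_distrib_left mult_single)
  finally show ?thesis .
qed

context generalized_action begin

abbreviation ev :: "('l \<Rightarrow> 'h) \<Rightarrow> (nat \<Rightarrow> 'a) \<Rightarrow> ('l, 'f) H_poly \<Rightarrow> 'a" where
  "ev \<equiv> H_eval sA act"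

definition wordval :: "('l \<Rightarrow> 'h) \<Rightarrow> (nat \<Rightarrow> 'a) \<Rightarrow> (nat \<times> 'l) free_monoid \<Rightarrow> 'a" where
  "wordval \<gamma> a w = nprod (map (\<lambda>(i, \<beta>). act (\<gamma> \<beta>) (a i)) (letters w))"

lemma ev_alt: "finite K \<Longrightarrow> Poly_Mapping.keys p \<subseteq> K \<Longrightarrow>
    ev \<gamma> a p = (\<Sum>w\<in>K. sA (Poly_Mapping.lookup p w) (wordval \<gamma> a w))"
  using H_eval_alt[OF A.vector_space_axioms] by (simp add: wordval_def)

lemma ev_single: "ev \<gamma> a (Poly_Mapping.single w c) = sA c (wordval \<gamma> a w)"
  by (subst ev_alt[of "{w}"]) auto

lemma ev_add: "ev \<gamma> a (p + q) = ev \<gamma> a p + ev \<gamma> a q"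
proof -
  let ?K = "Poly_Mapping.keys p \<union> Poly_Mapping.keys q"
  have "Poly_Mapping.keys (p + q) \<subseteq> ?K" by (rule Poly_Mapping.keys_add)
  then show ?thesis
    by (simp add: ev_alt[of ?K] lookup_add A.scale_left_distrib sum.distrib)
qed

lemma ev_poly_scale: "ev \<gamma> a (poly_scale c p) = sA c (ev \<gamma> a p)"
proof -
  have "Poly_Mapping.keys (poly_scale c p) \<subseteq> Poly_Mapping.keys p"
    by (auto simp: in_keys_iff lookup_poly_scale)
  then show ?thesis
    by (simp add: ev_alt[of "Poly_Mapping.keys p"] lookup_poly_scale A.scale_sum_right)
qed

lemma ev_0: "ev \<gamma> a 0 = 0" by (simp add: H_eval_def)

lemma ev_sum: "ev \<gamma> a (\<Sum>x\<in>X. f x) = (\<Sum>x\<in>X. ev \<gamma> a (f x))"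
  by (induction X rule: infinite_finite_induct) (auto simp: ev_0 ev_add)

text \<open>Constant terms have to be excluded because the empty product is 0, as there need not be a unit.\<close>

lemma ev_mult:
  assumes "Poly_Mapping.lookup p 0 = 0" "Poly_Mapping.lookup q 0 = 0"
  shows "ev \<gamma> a (p * q) = ev \<gamma> a p * ev \<gamma> a q"
proof -
  have w: "wordval \<gamma> a (u + v) = wordval \<gamma> a u * wordval \<gamma> a v"
    if "u \<in> Poly_Mapping.keys p" "v \<in> Poly_Mapping.keys q" for u v
  proof -
    have "u \<noteq> 0" "v \<noteq> 0" using that assms by (auto simp: in_keys_iff)
    then have "letters u \<noteq> []" "letters v \<noteq> []"
      by (metis free_monoid.collapse zero_free_monoid_def)+
    then show ?thesis by (simp add: wordval_def plus_free_monoid_def nprod_append)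
  qed
  have "ev \<gamma> a (p * q) = (\<Sum>u\<in>Poly_Mapping.keys p. \<Sum>v\<in>Poly_Mapping.keys q.
      sA (Poly_Mapping.lookup p u) (wordval \<gamma> a u) * sA (Poly_Mapping.lookup q v) (wordval \<gamma> a v))"
    unfolding poly_mapping_mult_sum[of p q] ev_sum ev_single
    by (intro sum.cong refl) (simp add: w flip: A.scale_mult_left A.scale_mult_right)
  then show ?thesis
    by (simp add: ev_alt[of "Poly_Mapping.keys p" p] ev_alt[of "Poly_Mapping.keys q" q] sum_product)
qed

lemma lookup_H_var_0: "Poly_Mapping.lookup (H_var sH \<gamma> i h) 0 = 0"
  by (simp add: H_var_def lookup_sum lookup_poly_scale lookup_single zero_free_monoid_def)

lemma ev_prod_list:
  assumes "is_basis sH \<gamma>" "ihs \<noteq> []"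
  shows "Poly_Mapping.lookup (prod_list (map (\<lambda>(i, h). H_var sH \<gamma> i h) ihs)) 0 = 0"
    and "ev \<gamma> a (prod_list (map (\<lambda>(i, h). H_var sH \<gamma> i h) ihs)) = nprod (map (\<lambda>(i, h). act h (a i)) ihs)"
proof -
  have "Poly_Mapping.lookup (prod_list (map (\<lambda>(i, h). H_var sH \<gamma> i h) ihs)) 0 = 0 \<and>
     ev \<gamma> a (prod_list (map (\<lambda>(i, h). H_var sH \<gamma> i h) ihs)) = nprod (map (\<lambda>(i, h). act h (a i)) ihs)"
    using assms(2)
  proof (induction ihs)
    case (Cons ih ihs)
    obtain i h where ih: "ih = (i, h)" by force
    show ?case
    proof (cases "ihs = []")
      case True
      then show ?thesis by (simp add: ih lookup_H_var_0 H_eval_H_var[OF generalized_action_axioms assms(1)])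
    next
      case False
      then show ?thesis using Cons
        by (simp add: ih lookup_mult_0 lookup_H_var_0 ev_mult nprod_Cons H_eval_H_var[OF generalized_action_axioms assms(1)])
    qed
  qed simp
  then show "Poly_Mapping.lookup (prod_list (map (\<lambda>(i, h). H_var sH \<gamma> i h) ihs)) 0 = 0"
    "ev \<gamma> a (prod_list (map (\<lambda>(i, h). H_var sH \<gamma> i h) ihs)) = nprod (map (\<lambda>(i, h). act h (a i)) ihs)"
    by auto
qed

end

section \<open>Codimension as a dimension of functions\<close>

lemma sum_list_times_sum_list:
  fixes f :: "'x \<Rightarrow> 'a::ring"
  shows "(\<Sum>x\<leftarrow>xs. f x) * (\<Sum>y\<leftarrow>ys. g y) = (\<Sum>(x, y)\<leftarrow>List.product xs ys. f x * g y)"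
  by (induction xs) (simp_all add: distrib_right sum_list_const_mult o_def)

context generalized_action begin

definition mono_val :: "(nat \<times> 'h) list \<Rightarrow> (nat \<Rightarrow> 'a) \<Rightarrow> 'a" where
  "mono_val m a = nprod (map (\<lambda>(i, h). act h (a i)) m)"

lemma multilin_mono_val: "m \<noteq> [] \<Longrightarrow> distinct (map fst m) \<Longrightarrow> multilin (fst ` set m) (mono_val m)"
proof (induction m)
  case (Cons x m)
  obtain i h where x: "x = (i, h)" by force
  show ?case
  proof (cases "m = []")
    case True
    then show ?thesis using multilin.var[of i h] by (simp add: x mono_val_def[abs_def])
  next
    case False
    then have "multilin ({i} \<union> fst ` set m) (\<lambda>a. act h (a i) * mono_val m a)"
      using Cons by (intro multilin.mult multilin.var) (auto simp: x)
    moreover have "mono_val (x # m) = (\<lambda>a. act h (a i) * mono_val m a)"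
      using False by (auto simp: mono_val_def x nprod_Cons)
    ultimately show ?thesis by (simp add: x)
  qed
qed simp

definition monos_on :: "nat set \<Rightarrow> (nat \<times> 'h) list set" where
  "monos_on I = {m. m \<noteq> [] \<and> distinct (map fst m) \<and> fst ` set m = I}"

lemma multilin_expansion:
  "multilin I F \<Longrightarrow> \<exists>L. snd ` set L \<subseteq> monos_on I \<and> (\<forall>a. F a = (\<Sum>(c, m)\<leftarrow>L. sA c (mono_val m a)))"
proof (induction rule: multilin.induct)
  case (var i h)
  then show ?case by (intro exI[of _ "[(1, [(i, h)])]"]) (auto simp: monos_on_def mono_val_def)
next
  case (mult I F K G)
  from mult.IH obtain L M where L: "snd ` set L \<subseteq> monos_on I" "\<And>a. F a = (\<Sum>(c, m)\<leftarrow>L. sA c (mono_val m a))"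
    and M: "snd ` set M \<subseteq> monos_on K" "\<And>a. G a = (\<Sum>(c, m)\<leftarrow>M. sA c (mono_val m a))" by blast
  define P where "P = map (\<lambda>((c, m), (d, m')). (c * d, m @ m')) (List.product L M)"
  have app: "m @ m' \<in> monos_on (I \<union> K)" if "m \<in> monos_on I" "m' \<in> monos_on K" for m m'
    using that mult.hyps(3) by (auto simp: monos_on_def)
  have "snd ` set P \<subseteq> monos_on (I \<union> K)"
  proof
    fix u assume "u \<in> snd ` set P"
    then obtain c m d m' where "(c, m) \<in> set L" "(d, m') \<in> set M" "u = m @ m'"
      by (auto simp: P_def)
    moreover from this have "m \<in> monos_on I" "m' \<in> monos_on K" using L(1) M(1) by force+
    ultimately show "u \<in> monos_on (I \<union> K)" using app by blast
  qed
  moreover have "F a * G a = (\<Sum>(c, m)\<leftarrow>P. sA c (mono_val m a))" for a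
  proof -
    have "(\<Sum>(c, m)\<leftarrow>P. sA c (mono_val m a)) = (\<Sum>(x, y)\<leftarrow>List.product L M. (case x of (c, m) \<Rightarrow> sA c (mono_val m a)) * (case y of (c, m) \<Rightarrow> sA c (mono_val m a)))"
    proof -
      have "mono_val (m @ m') a = mono_val m a * mono_val m' a" if "(c, m) \<in> set L" "(d, m') \<in> set M" for c m d m'
      proof -
        have "m \<in> monos_on I" "m' \<in> monos_on K" using L(1) M(1) that by force+
        then have "m \<noteq> []" "m' \<noteq> []" by (simp_all add: monos_on_def)
        then show ?thesis by (simp add: mono_val_def nprod_append)
      qed
      then show ?thesis unfolding P_def map_map
        by (intro arg_cong[where f = sum_list] map_cong refl)
           (auto simp: A.scale_mult_left[symmetric] A.scale_mult_right[symmetric])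
    qed
    then show ?thesis by (simp add: L(2) M(2) sum_list_times_sum_list)
  qed
  ultimately show ?case by blast
next
  case (add I F G)
  then obtain L M where L: "snd ` set L \<subseteq> monos_on I" "\<And>a. F a = (\<Sum>(c, m)\<leftarrow>L. sA c (mono_val m a))"
    and M: "snd ` set M \<subseteq> monos_on I" "\<And>a. G a = (\<Sum>(c, m)\<leftarrow>M. sA c (mono_val m a))" by blast
  have "snd ` set (L @ M) \<subseteq> monos_on I" using L(1) M(1) by (simp add: image_Un)
  moreover have "F a + G a = (\<Sum>(c, m)\<leftarrow>L @ M. sA c (mono_val m a))" for a by (simp add: L(2) M(2))
  ultimately show ?case by blast
next
  case (scale I F d)
  then obtain L where L: "snd ` set L \<subseteq> monos_on I" "\<And>a. F a = (\<Sum>(c, m)\<leftarrow>L. sA c (mono_val m a))" by blast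
  have "sA d (\<Sum>(c, m)\<leftarrow>L. sA c (mono_val m a)) = (\<Sum>(c, m)\<leftarrow>map (\<lambda>(c, m). (d * c, m)) L. sA c (mono_val m a))" for a
    by (induction L) (auto simp: A.scale_right_distrib)
  moreover have "snd ` set (map (\<lambda>(c, m). (d * c, m)) L) = snd ` set L" by (force simp: image_image)
  ultimately show ?case using L by metis
qed

lemma mono_in_generators:
  assumes "m \<in> monos_on {..<n}"
  shows "prod_list (map (\<lambda>(i, h). H_var sH \<gamma> i h) m) \<in>
    {prod_list (map (\<lambda>k. H_var sH \<gamma> (\<sigma> k) (h k)) [0..<n]) | h \<sigma>. \<sigma> permutes {..<n}}"
proof -
  have m: "distinct (map fst m)" "set (map fst m) = {..<n}" using assms by (auto simp: monos_on_def)
  have len: "length m = n" using distinct_card[OF m(1)] m(2) by simp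
  define \<sigma> where "\<sigma> k = (if k < n then fst (m ! k) else k)" for k
  have "bij_betw ((!) (map fst m)) {..<n} {..<n}"
    using bij_betw_nth[OF m(1), of "{..<n}" "{..<n}"] m(2) len by simp
  then have "bij_betw \<sigma> {..<n} {..<n}"
    by (subst bij_betw_cong[where g = "(!) (map fst m)"]) (auto simp: \<sigma>_def len)
  then have "\<sigma> permutes {..<n}" by (rule bij_imp_permutes) (simp add: \<sigma>_def)
  moreover have "map (\<lambda>(i, h). H_var sH \<gamma> i h) m = map (\<lambda>k. H_var sH \<gamma> (\<sigma> k) (snd (m ! k))) [0..<n]"
    by (rule nth_equalityI) (auto simp: len \<sigma>_def split: prod.splits)
  ultimately show ?thesis by auto
qed

lemma generator_is_mono:
  assumes "\<sigma> permutes {..<n}" "n \<ge> 1"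
  shows "map (\<lambda>k. (\<sigma> k, h k)) [0..<n] \<in> monos_on {..<n}"
proof -
  have "inj_on \<sigma> {0..<n}" using permutes_inj_on[OF assms(1)] by blast
  moreover have "\<sigma> ` {0..<n} = {..<n}" using permutes_image[OF assms(1)] by (simp add: atLeast0LessThan)
  moreover have "map fst (map (\<lambda>k. (\<sigma> k, h k)) [0..<n]) = map \<sigma> [0..<n]" by simp
  moreover have "fst ` set (map (\<lambda>k. (\<sigma> k, h k)) [0..<n]) = \<sigma> ` {0..<n}" by (simp add: image_image)
  moreover have "distinct (map \<sigma> [0..<n])" using calculation(1) by (simp add: distinct_map)
  moreover have "map (\<lambda>k. (\<sigma> k, h k)) [0..<n] \<noteq> []" using assms(2) by simp
  ultimately show ?thesis unfolding monos_on_def by (simp only: mem_Collect_eq) simp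
qed

lemma multilin_mono_on: "m \<in> monos_on I \<Longrightarrow> multilin I (mono_val m)"
  using multilin_mono_val[of m] unfolding monos_on_def mem_Collect_eq by metis

text \<open>Together with the converse, this identifies multilinear \<open>H\<close>-polynomials modulo identities with
  the functions satisfying \<open>multilin {..<n}\<close>.\<close>

lemma multilinear_imp_multilin:
  assumes "is_basis sH \<gamma>" "n \<ge> 1" "p \<in> multilinear_H_polys sH \<gamma> n"
  shows "Poly_Mapping.lookup p 0 = 0 \<and> (\<exists>F. multilin {..<n} F \<and> (\<forall>a. ev \<gamma> a p = F a))"
proof -
  interpret PS: vector_space "poly_scale :: 'f \<Rightarrow> ((nat \<times> 'l) free_monoid \<Rightarrow>\<^sub>0 'f) \<Rightarrow> _" by (rule vector_space_poly_scale)
  have gen: "Poly_Mapping.lookup p 0 = 0 \<and> (\<exists>F. multilin {..<n} F \<and> (\<forall>a. ev \<gamma> a p = F a))"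
    if "p = prod_list (map (\<lambda>k. H_var sH \<gamma> (\<sigma> k) (h k)) [0..<n])" "\<sigma> permutes {..<n}" for p h \<sigma>
  proof -
    let ?m = "map (\<lambda>k. (\<sigma> k, h k)) [0..<n]"
    have m: "?m \<in> monos_on {..<n}" by (rule generator_is_mono[OF that(2) assms(2)])
    then have ne: "?m \<noteq> []" by (simp add: monos_on_def)
    have p: "p = prod_list (map (\<lambda>(i, h). H_var sH \<gamma> i h) ?m)" by (simp add: that o_def)
    have "multilin {..<n} (mono_val ?m)" by (rule multilin_mono_on[OF m])
    moreover have "ev \<gamma> a p = mono_val ?m a" for a
      using ev_prod_list(2)[OF assms(1) ne] p unfolding mono_val_def by metis
    moreover have "Poly_Mapping.lookup p 0 = 0" using ev_prod_list(1)[OF assms(1) ne] p by metis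
    ultimately show ?thesis by blast
  qed
  have "multilin {..<n} (mono_val (map (\<lambda>k. (k, 1)) [0..<n]))"
    using generator_is_mono[OF permutes_id assms(2), of "\<lambda>_. 1"] by (intro multilin_mono_on) simp
  then have zero: "multilin {..<n} (\<lambda>a. 0)" by (rule multilin_zero)
  from assms(3) show ?thesis
    unfolding multilinear_H_polys_def
  proof (induction rule: PS.span_induct_alt)
    case base
    then show ?case using zero by (auto simp: ev_0)
  next
    case (step c x y)
    then obtain h \<sigma> where "x = prod_list (map (\<lambda>k. H_var sH \<gamma> (\<sigma> k) (h k)) [0..<n])" "\<sigma> permutes {..<n}" by blast
    from gen[OF this] obtain F where F: "multilin {..<n} F" "\<And>a. ev \<gamma> a x = F a" "Poly_Mapping.lookup x 0 = 0" by blast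
    from step obtain G where G: "multilin {..<n} G" "\<And>a. ev \<gamma> a y = G a" "Poly_Mapping.lookup y 0 = 0" by blast
    have "multilin {..<n} (\<lambda>a. sA c (F a) + G a)" by (intro multilin.add multilin.scale F G)
    then show ?case using F G by (auto simp: ev_add ev_poly_scale lookup_add lookup_poly_scale)
  qed
qed

lemma multilin_imp_multilinear:
  assumes "is_basis sH \<gamma>" "multilin {..<n} F"
  shows "\<exists>p \<in> multilinear_H_polys sH \<gamma> n. \<forall>a. ev \<gamma> a p = F a"
proof -
  interpret PS: vector_space "poly_scale :: 'f \<Rightarrow> ((nat \<times> 'l) free_monoid \<Rightarrow>\<^sub>0 'f) \<Rightarrow> _" by (rule vector_space_poly_scale)
  let ?M = "\<lambda>m. prod_list (map (\<lambda>(i, h). H_var sH \<gamma> i h) m)"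
  obtain L where L: "snd ` set L \<subseteq> monos_on {..<n}" "\<And>a. F a = (\<Sum>(c, m)\<leftarrow>L. sA c (mono_val m a))"
    using multilin_expansion[OF assms(2)] by blast
  have "\<exists>p \<in> multilinear_H_polys sH \<gamma> n. \<forall>a. ev \<gamma> a p = (\<Sum>(c, m)\<leftarrow>L. sA c (mono_val m a))"
    using L(1)
  proof (induction L)
    case Nil
    then show ?case by (intro bexI[of _ 0]) (auto simp: ev_0 multilinear_H_polys_def PS.span_zero)
  next
    case (Cons x L)
    obtain c m where x: "x = (c, m)" by force
    have m: "m \<in> monos_on {..<n}" using Cons.prems x by auto
    then have ne: "m \<noteq> []" by (simp add: monos_on_def)
    obtain p where p: "p \<in> multilinear_H_polys sH \<gamma> n" "\<And>a. ev \<gamma> a p = (\<Sum>(c, m)\<leftarrow>L. sA c (mono_val m a))"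
      using Cons by auto
    have "?M m \<in> multilinear_H_polys sH \<gamma> n"
      unfolding multilinear_H_polys_def by (rule PS.span_base[OF mono_in_generators[OF m]])
    then have "poly_scale c (?M m) + p \<in> multilinear_H_polys sH \<gamma> n"
      using p(1) unfolding multilinear_H_polys_def by (intro PS.span_add PS.span_scale)
    moreover have "ev \<gamma> a (poly_scale c (?M m) + p) = (\<Sum>(c, m)\<leftarrow>x # L. sA c (mono_val m a))" for a
      using ev_prod_list(2)[OF assms(1) ne, of a] by (simp add: ev_add ev_poly_scale p x mono_val_def)
    ultimately show ?case by blast
  qed
  then show ?thesis using L(2) by simp
qed

definition tuple :: "'a list \<Rightarrow> nat \<Rightarrow> 'a" where
  "tuple ts i = (if i < length ts then ts ! i else 0)"

text \<open>By linearity in one variable after the other, every value is a combination of values at tuples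
  from \<open>E\<close>.\<close>

lemma multilin_vanishes:
  assumes F: "multilin {..<n} F" and E: "finite E" "A.independent E" "A.span E = UNIV"
    and van: "\<And>ts. length ts = n \<Longrightarrow> set ts \<subseteq> E \<Longrightarrow> F (tuple ts) = 0"
  shows "F a = 0"
proof -
  have "F a = 0" if "k \<le> n" "\<And>i. k \<le> i \<Longrightarrow> i < n \<Longrightarrow> a i \<in> E" for k a
    using that
  proof (induction k arbitrary: a)
    case 0
    let ?ts = "map a [0..<n]"
    have "F a = F (tuple ?ts)" by (rule multilin_cong[OF F]) (simp add: tuple_def)
    also have "\<dots> = 0" by (rule van) (use 0 in auto)
    finally show ?case .
  next
    case (Suc k)
    have "a k = (\<Sum>b\<in>E. sA (A.representation E (a k) b) b)"
      by (rule A.sum_representation_eq[symmetric]) (use E in auto)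
    then have "F a = F (a(k := \<Sum>b\<in>E. sA (A.representation E (a k) b) b))" by simp
    also have "\<dots> = (\<Sum>b\<in>E. sA (A.representation E (a k) b) (F (a(k := b))))"
      by (rule multilin_slot_sum[OF F]) (use Suc in auto)
    also have "\<dots> = 0"
    proof (rule sum.neutral, rule ballI)
      fix b assume "b \<in> E"
      have "F (a(k := b)) = 0"
        by (rule Suc.IH) (use Suc.prems \<open>b \<in> E\<close> in auto)
      then show "sA (A.representation E (a k) b) (F (a(k := b))) = 0" by simp
    qed
    finally show ?case .
  qed
  from this[of n a] show ?thesis by simp
qed

text \<open>Outside \<open>X\<close> all functions vanish at tuples from \<open>E\<close>. Hence a multilinear \<open>H\<close>-polynomial is
  determined, modulo identities, by the coordinates of its values at the elements of \<open>X\<close>.\<close>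

lemma codim_bounds:
  assumes \<gamma>: "is_basis sH \<gamma>" and n: "n \<ge> 1"
    and E: "finite E" "A.independent E" "A.span E = UNIV"
    and X: "finite X" "\<And>ts F. length ts = n \<Longrightarrow> set ts \<subseteq> E \<Longrightarrow> multilin {..<n} F \<Longrightarrow> F (tuple ts) \<noteq> 0 \<Longrightarrow> ts \<in> X"
  shows codim_upper: "H_codim sH sA act \<gamma> n \<le> card X * card E"
    and codim_lower: "\<And>(k::nat) F. (\<And>i. i < k \<Longrightarrow> multilin {..<n} (F i)) \<Longrightarrow>
      (\<And>c. (\<And>a. (\<Sum>i<k. sA (c i) (F i a)) = 0) \<Longrightarrow> \<forall>i<k. c i = 0) \<Longrightarrow> k \<le> H_codim sH sA act \<gamma> n"
proof -
  interpret PS: vector_space "poly_scale :: 'f \<Rightarrow> ((nat \<times> 'l) free_monoid \<Rightarrow>\<^sub>0 'f) \<Rightarrow> _" by (rule vector_space_poly_scale)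
  let ?V = "multilinear_H_polys sH \<gamma> n"
  let ?W = "?V \<inter> H_identities sA act \<gamma>"
  have V: "PS.subspace ?V" by (simp add: multilinear_H_polys_def)
  have Id: "p \<in> H_identities sA act \<gamma> \<longleftrightarrow> (\<forall>a. ev \<gamma> a p = 0)" if "p \<in> ?V" for p
    using multilinear_imp_multilin[OF \<gamma> n that] by (simp add: H_identities_def H_polynomials_def)
  have W: "PS.subspace ?W"
    using V by (auto intro!: PS.subspaceI simp: PS.subspace_0 PS.subspace_add PS.subspace_scale Id ev_add ev_poly_scale ev_0)
  have evs: "ev \<gamma> a (\<Sum>i<k. poly_scale (c i) (e i)) = (\<Sum>i<k. sA (c i) (ev \<gamma> a (e i)))" for a c e and k :: nat
    by (simp add: ev_sum ev_poly_scale)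
  have inV: "(\<Sum>i<k. poly_scale (c i) (e i)) \<in> ?V" if "\<And>i. i < k \<Longrightarrow> e i \<in> ?V" for c e and k :: nat
    by (intro PS.subspace_sum[OF V] PS.subspace_scale[OF V]) (use that in auto)
  have bound: "k \<le> card X * card E" if e: "\<And>i. i < k \<Longrightarrow> e i \<in> ?V" and ind: "indep_mod poly_scale ?W k e" for k :: nat and e
  proof -
    define g where "g i x = A.representation E (ev \<gamma> (tuple (fst x)) (e i)) (snd x)" for i x
    have "k \<le> card (X \<times> E)"
    proof (rule independent_functions_bound)
      show "finite (X \<times> E)" using X(1) E(1) by simp
    next
      fix c assume g0: "\<And>x. x \<in> X \<times> E \<Longrightarrow> (\<Sum>i<k. c i * g i x) = 0"
      let ?p = "\<Sum>i<k. poly_scale (c i) (e i)"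
      have p: "?p \<in> ?V" by (rule inV[OF e])
      obtain F where F: "multilin {..<n} F" "\<And>a. ev \<gamma> a ?p = F a"
        using multilinear_imp_multilin[OF \<gamma> n p] by blast
      have "F a = 0" for a
      proof (rule multilin_vanishes[OF F(1) E])
        fix ts assume ts: "length ts = n" "set ts \<subseteq> E"
        show "F (tuple ts) = 0"
        proof (cases "ts \<in> X")
          case True
          have "A.representation E (F (tuple ts)) b = 0" if "b \<in> E" for b
          proof -
            have "A.representation E (F (tuple ts)) b = (\<Sum>i<k. A.representation E (sA (c i) (ev \<gamma> (tuple ts) (e i))) b)"
              unfolding F(2)[symmetric] evs by (subst A.representation_sum) (use E in auto)
            also have "\<dots> = (\<Sum>i<k. c i * g i (ts, b))"
              by (simp add: g_def A.representation_scale E)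
            finally show ?thesis using g0[of "(ts, b)"] True that by simp
          qed
          moreover have "(\<Sum>b\<in>E. sA (A.representation E (F (tuple ts)) b) b) = F (tuple ts)"
            by (rule A.sum_representation_eq) (use E in auto)
          ultimately show ?thesis by simp
        next
          case False
          then show ?thesis using X(2)[OF ts F(1)] by blast
        qed
      qed
      then have "?p \<in> ?W" using p Id F(2) by simp
      then show "\<forall>i<k. c i = 0" using ind by (simp add: indep_mod_def)
    qed
    then show ?thesis by (simp add: card_cartesian_product)
  qed
  show "H_codim sH sA act \<gamma> n \<le> card X * card E"
    unfolding H_codim_def by (rule PS.quotient_dim_upper[OF V W bound])
  fix k :: nat and F
  assume F: "\<And>i. i < k \<Longrightarrow> multilin {..<n} (F i)"
    and ind: "\<And>c. (\<And>a. (\<Sum>i<k. sA (c i) (F i a)) = 0) \<Longrightarrow> \<forall>i<k. c i = 0"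
  have "\<forall>i. \<exists>p. i < k \<longrightarrow> p \<in> ?V \<and> (\<forall>a. ev \<gamma> a p = F i a)"
    using multilin_imp_multilinear[OF \<gamma> F] by blast
  then obtain e where e: "\<And>i. i < k \<Longrightarrow> e i \<in> ?V" "\<And>i a. i < k \<Longrightarrow> ev \<gamma> a (e i) = F i a" by metis
  have im: "indep_mod poly_scale ?W k e"
    unfolding indep_mod_def
  proof (intro allI impI)
    fix c i assume "(\<Sum>i<k. poly_scale (c i) (e i)) \<in> ?W" "i < k"
    moreover have "(\<Sum>i<k. poly_scale (c i) (e i)) \<in> ?V" by (rule inV[OF e(1)])
    ultimately have "ev \<gamma> a (\<Sum>i<k. poly_scale (c i) (e i)) = 0" for a using Id by blast
    then have "(\<Sum>i<k. sA (c i) (F i a)) = 0" for a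
      unfolding evs using e(2) by simp
    then show "c i = 0" using ind \<open>i < k\<close> by blast
  qed
  show "k \<le> H_codim sH sA act \<gamma> n"
    unfolding H_codim_def
  proof (rule PS.quotient_dim_lower[OF V W])
    show "k' \<le> card X * card E" if "\<And>i. i < k' \<Longrightarrow> e' i \<in> ?V" "indep_mod poly_scale ?W k' e'" for k' e'
      by (rule bound[OF that])
    show "\<And>i. i < k \<Longrightarrow> e i \<in> ?V" by (rule e(1))
  qed (rule im)
qed

end

section \<open>The radical of a finite-dimensional algebra\<close>

locale fd_algebra = algebra_over scale + finite_dimensional_vector_space scale Basis
  for scale :: "'f::field \<Rightarrow> 'a::ring \<Rightarrow> 'a" and Basis
begin

lemma maximal_subideal:
  assumes K: "left_ideal_of scale UNIV K" and "K \<noteq> {0}"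
  obtains K' where "left_ideal_of scale UNIV K'" "K' \<subset> K"
    "\<And>U. left_ideal_of scale UNIV U \<Longrightarrow> K' \<subseteq> U \<Longrightarrow> U \<subseteq> K \<Longrightarrow> U = K' \<or> U = K"
proof -
  define P where "P U \<longleftrightarrow> left_ideal_of scale UNIV U \<and> U \<subset> K" for U
  have sub: "subspace U" if "left_ideal_of scale UNIV U" for U
    using that by (simp add: left_ideal_of_def)
  have "P {0}" using assms subspace_0[OF sub[OF K]] by (auto simp: P_def left_ideal_of_def)
  moreover have "\<forall>U. P U \<longrightarrow> dim U \<le> dim K"
    by (auto simp: P_def intro: dim_subset)
  ultimately obtain K' where K': "P K'" "\<And>U. P U \<Longrightarrow> dim U \<le> dim K'"
    using ex_has_greatest_nat[of P "{0}" dim "Suc (dim K)"] by (metis le_imp_less_Suc)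
  show ?thesis
  proof (rule that)
    fix U assume U: "left_ideal_of scale UNIV U" "K' \<subseteq> U" "U \<subseteq> K"
    show "U = K' \<or> U = K"
    proof (rule ccontr)
      assume "\<not> (U = K' \<or> U = K)"
      then have "dim U \<le> dim K'" using K'(2) U by (auto simp: P_def)
      then have "K' = U"
        using subspace_dim_equal[of K' U] sub U K'(1) by (auto simp: P_def)
      with \<open>\<not> (U = K' \<or> U = K)\<close> show False by simp
    qed
  qed (use K' in \<open>auto simp: P_def\<close>)
qed

text \<open>Take a maximal proper subideal \<open>K'\<close> of \<open>K\<close>. If some \<open>v\<close> in \<open>K\<close> is not sent into \<open>K'\<close> by the
  whole algebra, then every element of \<open>K\<close> is congruent modulo \<open>K'\<close> to a multiple of \<open>v\<close>, because
  \<open>K / K'\<close> is simple. So the elements that send \<open>v\<close> into \<open>K'\<close> form a maximal modular left ideal, which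
  contains the radical.\<close>

lemma radical_lowers:
  assumes K: "left_ideal_of scale UNIV K" and ne: "K \<noteq> {0}"
  obtains K' where "left_ideal_of scale UNIV K'" "K' \<subset> K"
    "\<And>a v. a \<in> jacobson_radical scale UNIV \<Longrightarrow> v \<in> K \<Longrightarrow> a * v \<in> K'"
proof -
  obtain K' where K': "left_ideal_of scale UNIV K'" "K' \<subset> K"
    and max: "\<And>U. left_ideal_of scale UNIV U \<Longrightarrow> K' \<subseteq> U \<Longrightarrow> U \<subseteq> K \<Longrightarrow> U = K' \<or> U = K"
    using maximal_subideal[OF assms] by blast
  have s: "subspace K'" "subspace K" and m: "\<And>a x. x \<in> K' \<Longrightarrow> a * x \<in> K'" "\<And>a x. x \<in> K \<Longrightarrow> a * x \<in> K"
    using K K' by (auto simp: left_ideal_of_def)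
  note cl = subspace_add[OF s(1)] subspace_scale[OF s(1)] subspace_0[OF s(1)] subspace_diff[OF s(1)]
  have "a * v \<in> K'" if a: "a \<in> jacobson_radical scale UNIV" and v: "v \<in> K" for a v
  proof (rule ccontr)
    assume av: "a * v \<notin> K'"
    have sum_ideal: "left_ideal_of scale UNIV {i * v + k | i k. i \<in> I \<and> k \<in> K'}" (is "left_ideal_of _ _ ?U")
      and sum_sub: "K' \<subseteq> {i * v + k | i k. i \<in> I \<and> k \<in> K'}" "{i * v + k | i k. i \<in> I \<and> k \<in> K'} \<subseteq> K"
      if I: "left_ideal_of scale UNIV I" for I
    proof -
      have sI: "subspace I" and mI: "\<And>a x. x \<in> I \<Longrightarrow> a * x \<in> I" using I by (auto simp: left_ideal_of_def)
      show "left_ideal_of scale UNIV ?U"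
        unfolding left_ideal_of_def
      proof (intro conjI ballI)
        show "subspace ?U"
        proof (rule subspaceI)
          show "0 \<in> ?U" using subspace_0[OF sI] cl(3) by (auto intro!: exI[of _ 0])
        next
          fix x y assume "x \<in> ?U" "y \<in> ?U"
          then obtain i k i' k' where "x = i * v + k" "y = i' * v + k'" "i \<in> I" "i' \<in> I" "k \<in> K'" "k' \<in> K'" by auto
          then show "x + y \<in> ?U"
            using subspace_add[OF sI] cl(1)
            by (intro CollectI exI[of _ "i + i'"] exI[of _ "k + k'"]) (auto simp: algebra_simps)
        next
          fix c x assume "x \<in> ?U"
          then obtain i k where "x = i * v + k" "i \<in> I" "k \<in> K'" by auto
          then show "scale c x \<in> ?U"
            using subspace_scale[OF sI] cl(2)
            by (intro CollectI exI[of _ "scale c i"] exI[of _ "scale c k"]) (auto simp: scale_right_distrib scale_mult_left)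
        qed
      next
        fix b x assume "x \<in> ?U"
        then obtain i k where "x = i * v + k" "i \<in> I" "k \<in> K'" by auto
        then show "b * x \<in> ?U" using mI m(1)
          by (intro CollectI exI[of _ "b * i"] exI[of _ "b * k"]) (auto simp: algebra_simps)
      qed auto
      show "K' \<subseteq> ?U"
      proof
        fix k assume "k \<in> K'"
        moreover have "k = 0 * v + k" by simp
        ultimately show "k \<in> ?U" using subspace_0[OF sI] by blast
      qed
      show "?U \<subseteq> K" using m(2)[OF v] K'(2) subspace_add[OF s(2)] by blast
    qed
    have U: "left_ideal_of scale UNIV (UNIV :: 'a set)" by (simp add: left_ideal_of_def)
    have "{i * v + k | i k. i \<in> UNIV \<and> k \<in> K'} = K"
    proof -
      have "a * v = a * v + 0" by simp
      then have "a * v \<in> {i * v + k | i k. i \<in> UNIV \<and> k \<in> K'}" using cl(3) by blast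
      then show ?thesis using max[OF sum_ideal[OF U] sum_sub[OF U]] av by blast
    qed
    then obtain e k where e: "v = e * v + k" "k \<in> K'" using v by blast
    define I where "I = {b. b * v \<in> K'}"
    have I: "left_ideal_of scale UNIV I"
      unfolding left_ideal_of_def I_def
      by (auto intro!: subspaceI simp: cl distrib_right mult.assoc m(1) simp flip: scale_mult_left)
    have "modular_left_ideal_of scale UNIV I"
      unfolding modular_left_ideal_of_def
    proof (intro conjI I bexI[of _ e] ballI)
      fix b
      have "(b - b * e) * v = b * (v - e * v)" by (simp add: algebra_simps)
      also have "v - e * v = k" using e(1) by (metis add_diff_cancel_left')
      finally show "b - b * e \<in> I" using m(1)[OF e(2)] by (simp add: I_def)
    qed auto
    moreover have "maximal_left_ideal_of scale UNIV I"
      unfolding maximal_left_ideal_of_def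
    proof (intro conjI I allI impI)
      show "I \<noteq> UNIV" using av by (auto simp: I_def)
    next
      fix I2 assume I2: "left_ideal_of scale UNIV I2 \<and> I \<subseteq> I2"
      show "I2 = I \<or> I2 = UNIV"
      proof (cases "I2 = I")
        case False
        then obtain b where b: "b \<in> I2" "b * v \<notin> K'" using I2 by (auto simp: I_def)
        let ?U = "{i * v + k | i k. i \<in> I2 \<and> k \<in> K'}"
        have "b * v = b * v + 0" by simp
        then have "b * v \<in> ?U" using cl(3) b(1) by blast
        then have U: "?U = K" using max[OF sum_ideal sum_sub, of I2] I2 b(2) by blast
        have "x \<in> I2" for x
        proof -
          have "x * v \<in> ?U" using m(2)[OF v] U by blast
          then obtain i k where ik: "x * v = i * v + k" "i \<in> I2" "k \<in> K'" by blast
          then have "(x - i) * v \<in> K'" by (simp add: left_diff_distrib)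
          then have "x - i \<in> I2" using I2 by (auto simp: I_def)
          then have "(x - i) + i \<in> I2" using ik(2) I2 subspace_add unfolding left_ideal_of_def by blast
          then show ?thesis by simp
        qed
        then show ?thesis by auto
      qed simp
    qed
    ultimately have "a \<in> I" using a by (auto simp: jacobson_radical_def)
    then show False using av by (simp add: I_def)
  qed
  then show ?thesis using that K' by blast
qed

text \<open>A factor from the radical lowers the left ideal by one step of a finite chain, and other factors
  do not leave it.\<close>

lemma radical_nilpotent_on:
  assumes "left_ideal_of scale UNIV K"
  shows "\<exists>p. \<forall>xs v. v \<in> K \<longrightarrow> p \<le> length (filter (\<lambda>x. x \<in> jacobson_radical scale UNIV) xs) \<longrightarrow> foldr (*) xs v = 0"
  using assms
proof (induction "dim K" arbitrary: K rule: less_induct)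
  case less
  let ?J = "jacobson_radical scale UNIV"
  have stay: "foldr (*) zs v \<in> K" if "v \<in> K" for zs v
    using that less.prems by (induction zs) (auto simp: left_ideal_of_def)
  show ?case
  proof (cases "K = {0}")
    case True
    then show ?thesis using stay by blast
  next
    case False
    obtain K' where K': "left_ideal_of scale UNIV K'" "K' \<subset> K"
      and low: "\<And>a v. a \<in> ?J \<Longrightarrow> v \<in> K \<Longrightarrow> a * v \<in> K'"
      using radical_lowers[OF less.prems False] by blast
    have "subspace K'" "subspace K" using K'(1) less.prems by (auto simp: left_ideal_of_def)
    then have "dim K' < dim K" using K'(2) by (intro dim_psubset) (simp add: span_eq_iff[THEN iffD2])
    then obtain p where p: "\<And>xs v. v \<in> K' \<Longrightarrow> p \<le> length (filter (\<lambda>x. x \<in> ?J) xs) \<Longrightarrow> foldr (*) xs v = 0"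
      using less.hyps K'(1) by blast
    have "foldr (*) xs v = 0" if v: "v \<in> K" and len: "Suc p \<le> length (filter (\<lambda>x. x \<in> ?J) xs)" for xs v
    proof -
      have "\<exists>x\<in>set xs. x \<in> ?J"
      proof (rule ccontr)
        assume "\<not> (\<exists>x\<in>set xs. x \<in> ?J)"
        then have "filter (\<lambda>x. x \<in> ?J) xs = []" by (simp add: filter_empty_conv)
        then show False using len by simp
      qed
      then obtain ys j zs where xs: "xs = ys @ j # zs" "j \<in> ?J" "\<forall>z\<in>set zs. z \<notin> ?J"
        using split_list_last_prop[of xs "\<lambda>x. x \<in> ?J"] by blast
      then have "filter (\<lambda>x. x \<in> ?J) zs = []" by (simp add: filter_empty_conv)
      then have "p \<le> length (filter (\<lambda>x. x \<in> ?J) ys)" using len xs by simp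
      then show ?thesis using p[OF low[OF xs(2) stay[OF v]]] xs(1) by simp
    qed
    then show ?thesis by blast
  qed
qed

lemma nprod_foldr: "xs \<noteq> [] \<Longrightarrow> nprod xs = foldr (*) (butlast xs) (last xs)"
  by (induction xs rule: nprod.induct) auto

text \<open>This is stronger than nilpotency of the radical, as factors from outside may stand between those
  from the radical. It bounds the number of entries from the radical in a nonzero product.\<close>

lemma radical_nilpotent:
  "\<exists>p. \<forall>xs. p < length (filter (\<lambda>x. x \<in> jacobson_radical scale UNIV) xs) \<longrightarrow> nprod xs = 0"
proof -
  let ?J = "jacobson_radical scale UNIV"
  have "left_ideal_of scale UNIV (UNIV :: 'a set)" by (simp add: left_ideal_of_def)
  then obtain p where p: "\<And>xs v. p \<le> length (filter (\<lambda>x. x \<in> ?J) xs) \<Longrightarrow> foldr (*) xs v = 0"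
    using radical_nilpotent_on by blast
  have "nprod xs = 0" if "p < length (filter (\<lambda>x. x \<in> ?J) xs)" for xs
  proof -
    have ne: "xs \<noteq> []" using that by auto
    then have "length (filter (\<lambda>x. x \<in> ?J) xs) \<le> Suc (length (filter (\<lambda>x. x \<in> ?J) (butlast xs)))"
      by (subst append_butlast_last_id[OF ne, symmetric], subst filter_append) simp
    then show ?thesis using that p by (simp add: nprod_foldr[OF ne])
  qed
  then show ?thesis by blast
qed

text \<open>The power with exponent \<open>k + 1\<close>: there need not be a unit.\<close>

definition npow :: "'a \<Rightarrow> nat \<Rightarrow> 'a" where
  "npow x k = ((*) x ^^ k) x"

lemma npow_0 [simp]: "npow x 0 = x" and npow_Suc: "npow x (Suc k) = x * npow x k"
  by (simp_all add: npow_def)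

lemma npow_mult: "npow x j * npow x k = npow x (Suc (j + k))"
  by (induction j) (simp_all add: npow_Suc mult.assoc)

text \<open>Let \<open>I\<close> be a maximal modular left ideal, with right unit \<open>e\<close> modulo \<open>I\<close>, that does not contain
  \<open>N\<close>. Then \<open>N + I = S\<close>, and \<open>e = x + y\<close> with \<open>x\<close> in \<open>N\<close> and \<open>y\<close> in \<open>I\<close>. All powers of \<open>x\<close> are congruent
  to \<open>e\<close> modulo \<open>I\<close>; as \<open>x\<close> is nilpotent, \<open>e\<close> is in \<open>I\<close>, so \<open>I = S\<close>, a contradiction.\<close>

lemma nil_left_ideal_subset_radical:
  assumes N: "left_ideal_of scale S N" and nil: "\<And>x. x \<in> N \<Longrightarrow> \<exists>k. npow x k = 0"
    and S: "subalgebra scale S"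
  shows "N \<subseteq> jacobson_radical scale S"
proof
  fix x0 assume x0: "x0 \<in> N"
  have sS: "subspace S" "\<And>x y. x \<in> S \<Longrightarrow> y \<in> S \<Longrightarrow> x * y \<in> S" using S by (auto simp: subalgebra_def)
  have sN: "subspace N" "N \<subseteq> S" "\<And>a x. a \<in> S \<Longrightarrow> x \<in> N \<Longrightarrow> a * x \<in> N" using N by (auto simp: left_ideal_of_def)
  have "x0 \<in> I" if mI: "modular_left_ideal_of scale S I" and xI: "maximal_left_ideal_of scale S I" for I
  proof (rule ccontr)
    assume "x0 \<notin> I"
    have sI: "subspace I" "I \<subseteq> S" "\<And>a x. a \<in> S \<Longrightarrow> x \<in> I \<Longrightarrow> a * x \<in> I" and ne: "I \<noteq> S"
      and max: "\<And>K. left_ideal_of scale S K \<Longrightarrow> I \<subseteq> K \<Longrightarrow> K = I \<or> K = S"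
      using xI unfolding maximal_left_ideal_of_def left_ideal_of_def by blast+
    obtain e where e: "e \<in> S" "\<And>a. a \<in> S \<Longrightarrow> a - a * e \<in> I"
      using mI unfolding modular_left_ideal_of_def by blast
    let ?K = "{x + y | x y. x \<in> N \<and> y \<in> I}"
    have "left_ideal_of scale S ?K"
      unfolding left_ideal_of_def
    proof (intro conjI ballI)
      show "subspace ?K" by (rule subspace_sums[OF sN(1) sI(1)])
      show "?K \<subseteq> S" using sN(2) sI(2) subspace_add[OF sS(1)] by blast
      fix a x assume "a \<in> S" "x \<in> ?K"
      then obtain y z where "x = y + z" "y \<in> N" "z \<in> I" by blast
      moreover from this have "a * x = a * y + a * z" by (simp add: distrib_left)
      ultimately show "a * x \<in> ?K" using sN(3) sI(3) \<open>a \<in> S\<close> by blast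
    qed
    moreover have "I \<subseteq> ?K"
    proof
      fix y assume "y \<in> I"
      moreover have "y = 0 + y" by simp
      ultimately show "y \<in> ?K" using subspace_0[OF sN(1)] by blast
    qed
    moreover have "x0 \<in> ?K"
    proof -
      have "x0 = x0 + 0" by simp
      then show ?thesis using x0 subspace_0[OF sI(1)] by blast
    qed
    ultimately have "?K = S" using max \<open>x0 \<notin> I\<close> by blast
    then obtain x y where xy: "e = x + y" "x \<in> N" "y \<in> I" using e(1) by blast
    have xS: "x \<in> S" using xy sN by auto
    have step: "npow x k \<in> S \<and> npow x k - e \<in> I" for k
    proof (induction k)
      case 0
      have "x - e = - y" using xy(1) by simp
      then show ?case using subspace_neg[OF sI(1) xy(3)] xS by simp
    next
      case (Suc k)
      have "x * npow x k - e = x * (npow x k - e) - (x - x * e) + (x - e)" by (simp add: algebra_simps)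
      moreover have "x * (npow x k - e) \<in> I" using Suc sI(3) xS by blast
      moreover have "x - e \<in> I" using xy(1) subspace_neg[OF sI(1) xy(3)] by simp
      ultimately have "x * npow x k - e \<in> I"
        using e(2)[OF xS] subspace_add[OF sI(1)] subspace_diff[OF sI(1)] by metis
      then show ?case using Suc sS(2) xS by (auto simp: npow_Suc)
    qed
    obtain k where "npow x k = 0" using nil xy(2) by blast
    then have "e \<in> I" using step[of k] subspace_neg[OF sI(1)] by fastforce
    have "a \<in> I" if "a \<in> S" for a
    proof -
      have "(a - a * e) + a * e \<in> I" by (intro subspace_add[OF sI(1)] e(2) sI(3) that \<open>e \<in> I\<close>)
      then show ?thesis by simp
    qed
    then show False using ne sI(2) by auto
  qed
  then show "x0 \<in> jacobson_radical scale S" using x0 sN(2) by (auto simp: jacobson_radical_def)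
qed

text \<open>The spans of all sufficiently high powers of \<open>x\<close> become stationary. On the stationary span,
  multiplication by some power \<open>X\<close> of \<open>x\<close> is surjective, so \<open>X = X * e\<close> and \<open>e = X * q\<close> for some \<open>e\<close>
  and \<open>q\<close> in it. As powers of \<open>x\<close> commute, \<open>e * e = e * X * q = X * q = e\<close>.\<close>

lemma idempotent_exists:
  assumes N: "subspace N" "\<And>x y. x \<in> N \<Longrightarrow> y \<in> N \<Longrightarrow> x * y \<in> N" and x: "x \<in> N"
    and nn: "\<And>k. npow x k \<noteq> 0"
  obtains e where "e \<in> N" "e * e = e" "e \<noteq> 0"
proof -
  define P where "P k = span (npow x ` {k..})" for k
  have base: "npow x j \<in> P k" if "k \<le> j" for j k unfolding P_def using that by (auto intro: span_base)
  have sP: "subspace (P k)" for k by (simp add: P_def)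
  have Psub: "P k \<subseteq> U" if "subspace U" "\<And>j. k \<le> j \<Longrightarrow> npow x j \<in> U" for k U
    unfolding P_def using that by (intro span_minimal) auto
  have mono: "P k \<subseteq> P j" if "j \<le> k" for j k using that by (intro Psub sP base) auto
  have sub_mult: "subspace {v. a * v \<in> U}" if "subspace U" for a U
    using that by (auto intro!: subspaceI simp: subspace_add subspace_scale subspace_0 distrib_left simp flip: scale_mult_right)
  have mult: "npow x j * v \<in> P (Suc (j + k))" if "v \<in> P k" for j k v
  proof -
    have "P k \<subseteq> {v. npow x j * v \<in> P (Suc (j + k))}"
      by (intro Psub sub_mult sP) (auto simp: npow_mult intro: base)
    then show ?thesis using that by auto
  qed
  have "\<exists>k. npow x k \<in> P (Suc k)"
  proof (rule ccontr)
    assume "\<nexists>k. npow x k \<in> P (Suc k)"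
    then have "P (Suc k) \<subset> P k" for k using mono[of k "Suc k"] base[of k k] by auto
    then have less: "dim (P (Suc k)) < dim (P k)" for k
      using sP by (intro dim_psubset) (simp add: span_eq_iff[THEN iffD2])
    have "dim (P k) + k \<le> dim (P 0)" for k
    proof (induction k)
      case (Suc k) then show ?case using less[of k] by simp
    qed simp
    from this[of "Suc (dim (P 0))"] show False by simp
  qed
  then obtain k where k: "npow x k \<in> P (Suc k)" ..
  have k': "npow x j \<in> P (Suc j)" if "k \<le> j" for j
  proof (cases "j = k")
    case False
    then have "j = Suc ((j - Suc k) + k)" using that by simp
    then obtain i where j: "j = Suc (i + k)" by blast
    show ?thesis using mult[OF k, of i] by (simp add: j npow_mult)
  qed (use k in simp)
  have Pk: "P k \<subseteq> P (k + m)" for m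
  proof (induction m)
    case (Suc m)
    have "P (k + m) \<subseteq> P (Suc (k + m))"
    proof (rule Psub[OF sP])
      fix j assume "k + m \<le> j"
      then show "npow x j \<in> P (Suc (k + m))" using k'[of j] mono[of "Suc (k + m)" "Suc j"] by auto
    qed
    then show ?case using Suc by auto
  qed simp
  have div: "\<exists>q\<in>P k. v = npow x k * q" if "v \<in> P k" for v
  proof -
    have s: "subspace ((*) (npow x k) ` P k)"
    proof (rule subspaceI)
      show "0 \<in> (*) (npow x k) ` P k" using subspace_0[OF sP] by (force intro!: image_eqI[of _ _ 0])
    next
      fix u v assume "u \<in> (*) (npow x k) ` P k" "v \<in> (*) (npow x k) ` P k"
      then show "u + v \<in> (*) (npow x k) ` P k"
        using subspace_add[OF sP] by (auto simp flip: distrib_left)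
    next
      fix c u assume "u \<in> (*) (npow x k) ` P k"
      then show "scale c u \<in> (*) (npow x k) ` P k"
        using subspace_scale[OF sP] by (auto simp: scale_mult_right)
    qed
    have "P (k + Suc k) \<subseteq> (*) (npow x k) ` P k"
    proof (rule Psub[OF s])
      fix j assume j: "k + Suc k \<le> j"
      then have "npow x j = npow x k * npow x (j - Suc k)" by (simp add: npow_mult)
      then show "npow x j \<in> (*) (npow x k) ` P k" using j by (auto intro!: imageI base)
    qed
    then show ?thesis using that Pk[of "Suc k"] by auto
  qed
  obtain e where e: "e \<in> P k" "npow x k = npow x k * e" using div[OF base[of k k]] by auto
  obtain q where q: "e = npow x k * q" using div[OF e(1)] by auto
  have "P k \<subseteq> {v. v * npow x k = npow x k * v}"
    by (rule Psub) (auto intro!: subspaceI simp: npow_mult add.commute distrib_left distrib_right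
        simp flip: scale_mult_left scale_mult_right)
  then have comm: "e * npow x k = npow x k * e" using e(1) by auto
  have "e * e = e * npow x k * q" by (subst (2) q) (simp add: mult.assoc)
  also have "\<dots> = e" using comm e(2) q by simp
  finally have "e * e = e" .
  moreover have "e \<noteq> 0" using e(2) nn[of k] by auto
  moreover have "e \<in> N"
  proof -
    have "npow x j \<in> N" for j by (induction j) (auto simp: x npow_Suc N(2))
    then have "P k \<subseteq> N" by (intro Psub N(1))
    then show ?thesis using e(1) by auto
  qed
  ultimately show ?thesis using that by blast
qed

end

section \<open>Polynomial functions with constants and density\<close>

text \<open>Take a nonzero \<open>u0\<close> and a polynomial \<open>p\<close> of least degree among those with \<open>p \<noteq> 0\<close> and
  \<open>p(\<theta>) u0 = 0\<close>. If \<open>c\<close> is a root of \<open>p = (X - c) r\<close>, then \<open>r(\<theta>) u0\<close> is an eigenvector. In the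
  proof, \<open>app p\<close> stands for \<open>p(\<theta>) u0\<close>.\<close>

lemma (in vector_space) eigenvector_exists:
  fixes \<theta> :: "'b \<Rightarrow> 'b" and alg :: "'a itself"
  assumes ac: "\<And>p :: 'a poly. degree p > 0 \<Longrightarrow> \<exists>z. poly p z = 0"
    and S: "subspace S" "S \<noteq> {0}" "S \<subseteq> span T" "finite T"
    and maps: "\<And>u. u \<in> S \<Longrightarrow> \<theta> u \<in> S"
    and add: "\<And>u v. u \<in> S \<Longrightarrow> v \<in> S \<Longrightarrow> \<theta> (u + v) = \<theta> u + \<theta> v"
    and sc: "\<And>c u. u \<in> S \<Longrightarrow> \<theta> (scale c u) = scale c (\<theta> u)"
  obtains c u where "u \<in> S" "u \<noteq> 0" "\<theta> u = scale c u"
proof -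
  obtain u0 where u0: "u0 \<in> S" "u0 \<noteq> 0" using S subspace_0 by blast
  have th0: "\<theta> 0 = 0" using sc[OF u0(1), of 0] by simp
  \<comment> \<open>Horner evaluation of \<open>p\<close> at \<open>\<theta>\<close>, applied to \<open>u0\<close>\<close>
  define app where "app p = fold_coeffs (\<lambda>a v. scale a u0 + \<theta> v) p 0" for p :: "'a poly"
  have app0: "app 0 = 0" by (simp add: app_def)
  have appC: "app (pCons a p) = scale a u0 + \<theta> (app p)" for a p
    by (cases "p = 0 \<and> a = 0") (auto simp: app_def th0 fold_coeffs_pCons_not_0_0_eq)
  have inS: "app p \<in> S" for p
  proof (induction p)
    case (pCons a p)
    then show ?case
      unfolding appC by (intro subspace_add[OF S(1)] subspace_scale[OF S(1)] u0(1) maps)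
  qed (simp add: app0 subspace_0[OF S(1)])
  have app_add: "app (p + r) = app p + app r" for p r
    by (induction p r rule: poly_induct2)
       (auto simp: app0 appC add inS scale_left_distrib)
  have app_smult: "app (Polynomial.smult c p) = scale c (app p)" for c p
    by (induction p) (auto simp: app0 appC sc inS scale_right_distrib)
  have "\<exists>p. p \<noteq> 0 \<and> app p = 0"
  proof (rule ccontr)
    assume no: "\<nexists>p. p \<noteq> 0 \<and> app p = 0"
    let ?k = "Suc (card T)"
    have "indep_mod scale {0} ?k (\<lambda>i. app (monom 1 i))"
      unfolding indep_mod_def
    proof (intro allI impI)
      fix c i assume "(\<Sum>i<?k. scale (c i) (app (monom 1 i))) \<in> {0}" and i: "i < ?k"
      moreover have "app (\<Sum>i<m. monom (c i) i) = (\<Sum>i<m. scale (c i) (app (monom 1 i)))" for m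
        by (induction m) (simp_all add: app0 app_add Polynomial.smult_monom flip: app_smult)
      ultimately have "app (\<Sum>i<?k. monom (c i) i) = 0" by (simp del: sum.lessThan_Suc)
      then have "(\<Sum>i<?k. monom (c i) i) = 0" using no by blast
      then have "coeff (\<Sum>i<?k. monom (c i) i) i = 0" by simp
      then show "c i = 0" using i by (simp add: coeff_sum when_def if_distrib cong: if_cong del: sum.lessThan_Suc)
    qed
    then have "?k \<le> card T"
      by (rule indep_mod_zero_card[OF S(4)]) (use inS S(3) in auto)
    then show False by simp
  qed
  then obtain p where p: "p \<noteq> 0 \<and> app p = 0" and min: "\<And>r. r \<noteq> 0 \<and> app r = 0 \<Longrightarrow> degree p \<le> degree r"
    using ex_has_least_nat[of "\<lambda>p. p \<noteq> 0 \<and> app p = 0" _ degree] by blast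
  have "degree p > 0"
  proof (rule ccontr)
    assume "\<not> degree p > 0"
    then obtain a where a: "p = [:a:]" using degree_eq_zeroE by auto
    then have "scale a u0 = 0" using p by (auto simp: appC app0 th0)
    then show False using u0(2) p a by auto
  qed
  then obtain c where "poly p c = 0" using ac by blast
  then obtain r where r: "p = [:- c, 1:] * r" by (auto simp: poly_eq_0_iff_dvd dvd_def)
  have rne: "r \<noteq> 0" using p r by auto
  have "degree p = Suc (degree r)" using rne unfolding r by (subst degree_mult_eq) auto
  then have "app r \<noteq> 0" using min[of r] rne by auto
  moreover have "\<theta> (app r) = scale c (app r)"
  proof -
    have "[:- c, 1:] * r = Polynomial.smult (- c) r + pCons 0 r" by simp
    then have "app p = scale (- c) (app r) + \<theta> (app r)" unfolding r by (simp only: app_add app_smult appC) simp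
    then show ?thesis using p by (simp add: add_eq_0_iff)
  qed
  ultimately show ?thesis using that inS by blast
qed

context generalized_action begin

text \<open>The function \<open>G\<close> of the variables in \<open>I\<close> comes from a multilinear function by fixing the values
  of further variables. These can be chosen outside any given finite set \<open>Z\<close>; hence such functions
  can be multiplied.\<close>

definition const_mono :: "nat set \<Rightarrow> ((nat \<Rightarrow> 'a) \<Rightarrow> 'a) \<Rightarrow> bool" where
  "const_mono I G \<longleftrightarrow> (\<forall>a b. (\<forall>i\<in>I. a i = b i) \<longrightarrow> G a = G b) \<and> (\<forall>Z. finite Z \<longrightarrow>
     (\<exists>K \<kappa> F. finite K \<and> K \<inter> (I \<union> Z) = {} \<and> multilin (I \<union> K) F \<and> (\<forall>a. (\<forall>k\<in>K. a k = \<kappa> k) \<longrightarrow> F a = G a)))"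

lemma const_mono_const: "const_mono {} (\<lambda>_. b)"
  unfolding const_mono_def
proof (intro conjI allI impI)
  fix Z :: "nat set" assume "finite Z"
  then obtain z where z: "z \<notin> Z" using ex_new_if_finite[of Z] infinite_UNIV_nat by blast
  show "\<exists>K \<kappa> F. finite K \<and> K \<inter> ({} \<union> Z) = {} \<and> multilin ({} \<union> K) F \<and> (\<forall>a. (\<forall>k\<in>K. a k = \<kappa> k) \<longrightarrow> F a = b)"
    by (rule exI[of _ "{z}"], rule exI[of _ "\<lambda>_. b"], rule exI[of _ "\<lambda>a. act 1 (a z)"])
       (use z multilin.var[of z 1] in \<open>auto simp: act_one\<close>)
qed simp

lemma const_mono_var: "const_mono {i} (\<lambda>a. act h (a i))"
  unfolding const_mono_def
proof (intro conjI allI impI)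
  fix Z :: "nat set"
  show "\<exists>K \<kappa> F. finite K \<and> K \<inter> ({i} \<union> Z) = {} \<and> multilin ({i} \<union> K) F \<and> (\<forall>a. (\<forall>k\<in>K. a k = \<kappa> k) \<longrightarrow> F a = act h (a i))"
    by (rule exI[of _ "{}"], rule exI, rule exI[of _ "\<lambda>a. act h (a i)"]) (use multilin.var[of i h] in auto)
qed simp

lemma const_mono_mult:
  assumes F: "const_mono I F" and G: "const_mono K G" and d: "I \<inter> K = {}" and fin: "finite I" "finite K"
  shows "const_mono (I \<union> K) (\<lambda>a. F a * G a)"
  unfolding const_mono_def
proof (intro conjI allI impI)
  fix a b :: "nat \<Rightarrow> 'a" assume "\<forall>i\<in>I \<union> K. a i = b i"
  then show "F a * G a = F b * G b" using F G unfolding const_mono_def by (metis UnCI)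
next
  fix Z :: "nat set" assume Z: "finite Z"
  have "finite (Z \<union> K)" using Z fin by simp
  then obtain K1 \<kappa>1 F1 where 1: "finite K1" "K1 \<inter> (I \<union> (Z \<union> K)) = {}" "multilin (I \<union> K1) F1"
    "\<And>a. (\<forall>k\<in>K1. a k = \<kappa>1 k) \<Longrightarrow> F1 a = F a"
    using F unfolding const_mono_def by metis
  have "finite (Z \<union> I \<union> K1)" using Z fin 1 by simp
  then obtain K2 \<kappa>2 F2 where 2: "finite K2" "K2 \<inter> (K \<union> (Z \<union> I \<union> K1)) = {}" "multilin (K \<union> K2) F2"
    "\<And>a. (\<forall>k\<in>K2. a k = \<kappa>2 k) \<Longrightarrow> F2 a = G a"
    using G unfolding const_mono_def by metis
  have "multilin ((I \<union> K1) \<union> (K \<union> K2)) (\<lambda>a. F1 a * F2 a)"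
    using 1 2 d by (intro multilin.mult) auto
  moreover have "(I \<union> K1) \<union> (K \<union> K2) = (I \<union> K) \<union> (K1 \<union> K2)" by auto
  moreover have "F1 a * F2 a = F a * G a" if "\<forall>k\<in>K1 \<union> K2. a k = (if k \<in> K1 then \<kappa>1 k else \<kappa>2 k)" for a
  proof -
    have "k \<notin> K1" if "k \<in> K2" for k using that 2(2) by auto
    then have "\<forall>k\<in>K1. a k = \<kappa>1 k" "\<forall>k\<in>K2. a k = \<kappa>2 k" using that by auto
    then show ?thesis using 1(4) 2(4) by simp
  qed
  moreover have "finite (K1 \<union> K2)" "(K1 \<union> K2) \<inter> ((I \<union> K) \<union> Z) = {}" using 1 2 by auto
  ultimately show "\<exists>Ka \<kappa> Fa. finite Ka \<and> Ka \<inter> (I \<union> K \<union> Z) = {} \<and> multilin (I \<union> K \<union> Ka) Fa \<and>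
      (\<forall>a. (\<forall>k\<in>Ka. a k = \<kappa> k) \<longrightarrow> Fa a = F a * G a)"
    by (intro exI[of _ "K1 \<union> K2"] exI[of _ "\<lambda>k. if k \<in> K1 then \<kappa>1 k else \<kappa>2 k"] exI[of _ "\<lambda>a. F1 a * F2 a"]) auto
qed

lemma const_mono_map:
  assumes "const_mono I F" and "\<And>I F. multilin I F \<Longrightarrow> multilin I (\<lambda>a. \<phi> (F a))"
  shows "const_mono I (\<lambda>a. \<phi> (F a))"
  unfolding const_mono_def
proof (intro conjI allI impI)
  fix a b :: "nat \<Rightarrow> 'a" assume "\<forall>i\<in>I. a i = b i"
  then show "\<phi> (F a) = \<phi> (F b)" using assms(1) unfolding const_mono_def by metis
next
  fix Z :: "nat set" assume Z: "finite Z"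
  then obtain K1 \<kappa>1 F1 where 1: "finite K1" "K1 \<inter> (I \<union> Z) = {}" "multilin (I \<union> K1) F1"
    "\<And>a. (\<forall>k\<in>K1. a k = \<kappa>1 k) \<Longrightarrow> F1 a = F a"
    using assms(1) unfolding const_mono_def by metis
  then show "\<exists>K \<kappa> Fa. finite K \<and> K \<inter> (I \<union> Z) = {} \<and> multilin (I \<union> K) Fa \<and>
      (\<forall>a. (\<forall>k\<in>K. a k = \<kappa> k) \<longrightarrow> Fa a = \<phi> (F a))"
    using assms(2)[OF 1(3)] by (intro exI[of _ K1] exI[of _ \<kappa>1] exI[of _ "\<lambda>a. \<phi> (F1 a)"]) auto
qed

text \<open>In a sum of functions with the property \<open>const_mono\<close>, the summands may use different numbers of
  constants and different values for them. So the sum need not arise from a single multilinear function by fixing variables.\<close>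

inductive const_poly :: "nat set \<Rightarrow> ((nat \<Rightarrow> 'a) \<Rightarrow> 'a) \<Rightarrow> bool" where
  base: "finite I \<Longrightarrow> const_mono I F \<Longrightarrow> const_poly I F"
| zero: "finite I \<Longrightarrow> const_poly I (\<lambda>_. 0)"
| add: "const_poly I F \<Longrightarrow> const_poly I G \<Longrightarrow> const_poly I (\<lambda>a. F a + G a)"

lemma const_poly_finite: "const_poly I F \<Longrightarrow> finite I"
  by (induction rule: const_poly.induct) auto

lemma const_poly_map:
  assumes "const_poly I F" and "\<And>I F. multilin I F \<Longrightarrow> multilin I (\<lambda>a. \<phi> (F a))" "\<And>x y. \<phi> (x + y) = \<phi> x + \<phi> y" "\<phi> 0 = 0"
  shows "const_poly I (\<lambda>a. \<phi> (F a))"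
  using assms(1)
proof (induction rule: const_poly.induct)
  case (base I F)
  then show ?case by (intro const_poly.base const_mono_map[OF _ assms(2)])
next
  case (zero I)
  then show ?case unfolding assms(4) by (rule const_poly.zero)
next
  case (add I F G)
  then show ?case unfolding assms(3) by (intro const_poly.add)
qed

lemma const_poly_act: "const_poly I F \<Longrightarrow> const_poly I (\<lambda>a. act h (F a))"
  by (erule const_poly_map) (auto intro: multilin_act simp: act_plus act_0)

lemma const_poly_scale: "const_poly I F \<Longrightarrow> const_poly I (\<lambda>a. sA c (F a))"
  by (erule const_poly_map) (auto intro: multilin.scale simp: A.scale_right_distrib)

lemma const_poly_mult:
  assumes "const_poly I F" "const_poly K G" "I \<inter> K = {}"
  shows "const_poly (I \<union> K) (\<lambda>a. F a * G a)"
  using assms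
proof (induction rule: const_poly.induct)
  case (base I F)
  from base(3,4) show ?case
  proof (induction rule: const_poly.induct)
    case (base K G)
    with \<open>finite I\<close> \<open>const_mono I F\<close> show ?case by (auto intro: const_poly.base const_mono_mult)
  next
    case (zero K)
    with \<open>finite I\<close> show ?case by (simp add: const_poly.zero)
  next
    case (add K G G')
    then show ?case unfolding distrib_left by (intro const_poly.add) auto
  qed
next
  case (zero I)
  then show ?case using const_poly_finite by (simp add: const_poly.zero)
next
  case (add I F G)
  then show ?case unfolding distrib_right by (intro const_poly.add) auto
qed

lemma const_poly_var: "const_poly {i} (\<lambda>a. a i)"
  using const_poly.base[OF _ const_mono_var[of i 1]] by (simp add: act_one)

lemma const_poly_const: "const_poly {} (\<lambda>a. b)"
  by (intro const_poly.base const_mono_const) simp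

text \<open>An additive functional that does not vanish on a sum does not vanish on some summand. This is how
  a single assignment of the constants is found.\<close>

lemma const_poly_extract:
  assumes "const_poly I F" "\<Phi> F \<noteq> (0 :: 'a)" "\<Phi> (\<lambda>_. 0) = 0" "\<And>F G. \<Phi> (\<lambda>a. F a + G a) = \<Phi> F + \<Phi> G"
  obtains G where "const_mono I G" "\<Phi> G \<noteq> 0"
proof -
  have "\<exists>G. const_mono I G \<and> \<Phi> G \<noteq> 0"
    using assms(1,2)
  proof (induction rule: const_poly.induct)
    case (add I F G)
    then have "\<Phi> F \<noteq> 0 \<or> \<Phi> G \<noteq> 0" using assms(4) by auto
    then show ?case using add by blast
  qed (use assms(3) in auto)
  then show ?thesis using that by blast
qed

text \<open>Operators composed of multiplications by elements of \<open>S\<close> and the action of \<open>H\<close>. The innermost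
  factor is a left multiplication, so that elements annihilated by \<open>S\<close> from the left are sent to 0.\<close>

inductive block_op :: "'a set \<Rightarrow> ('a \<Rightarrow> 'a) \<Rightarrow> bool" for S where
  left: "b \<in> S \<Longrightarrow> block_op S (\<lambda>x. b * x)"
| lmult: "block_op S f \<Longrightarrow> b \<in> S \<Longrightarrow> block_op S (\<lambda>x. b * f x)"
| rmult: "block_op S f \<Longrightarrow> b \<in> S \<Longrightarrow> block_op S (\<lambda>x. f x * b)"
| act: "block_op S f \<Longrightarrow> block_op S (\<lambda>x. act h (f x))"
| add: "block_op S f \<Longrightarrow> block_op S g \<Longrightarrow> block_op S (\<lambda>x. f x + g x)"
| scale: "block_op S f \<Longrightarrow> block_op S (\<lambda>x. sA c (f x))"

lemma block_op_add: "block_op S f \<Longrightarrow> f (x + y) = f x + f y"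
  by (induction rule: block_op.induct) (auto simp: distrib_left distrib_right act_plus A.scale_right_distrib)

lemma block_op_scale: "block_op S f \<Longrightarrow> f (sA c x) = sA c (f x)"
  by (induction rule: block_op.induct)
     (auto simp: act_smult A.scale_right_distrib A.scale_left_commute A.scale_mult_left simp flip: A.scale_mult_right)

lemma block_op_diff: "block_op S f \<Longrightarrow> f (x - sA c y) = f x - sA c (f y)"
  using block_op_add[of S f "x - sA c y" "sA c y"] block_op_scale[of S f c y] by simp

lemma block_op_kill: "block_op S f \<Longrightarrow> (\<And>b. b \<in> S \<Longrightarrow> b * x = 0) \<Longrightarrow> f x = 0"
  by (induction rule: block_op.induct) (auto simp: act_0)

lemma block_op_in: "block_op S f \<Longrightarrow> subalgebra sA S \<Longrightarrow> H_invariant act S \<Longrightarrow> x \<in> S \<Longrightarrow> f x \<in> S"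
  by (induction rule: block_op.induct)
     (auto simp: subalgebra_def H_invariant_def A.subspace_add A.subspace_scale)

lemma block_op_const_poly: "block_op S f \<Longrightarrow> const_poly {l} (\<lambda>a. f (a l))"
proof (induction rule: block_op.induct)
  case (left b)
  then show ?case using const_poly_mult[OF const_poly_const[of b] const_poly_var[of l]] by simp
next
  case (lmult f b)
  then show ?case using const_poly_mult[OF const_poly_const[of b] lmult.IH] by simp
next
  case (rmult f b)
  then show ?case using const_poly_mult[OF rmult.IH const_poly_const[of b]] by simp
qed (auto intro: const_poly_act const_poly_scale const_poly.add)

text \<open>If \<open>S\<close> is \<open>H\<close>-simple, this image is 0 or \<open>S\<close>. The property \<open>P\<close> is meant to be the vanishing on
  a given set.\<close>

lemma block_op_image_ideal:
  assumes S: "subalgebra sA S" "H_invariant act S" and v: "v \<in> S" and ne: "block_op S f0" "P f0"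
    and P: "\<And>f b. P f \<Longrightarrow> P (\<lambda>x. b * f x)" "\<And>f b. P f \<Longrightarrow> P (\<lambda>x. f x * b)" "\<And>f h. P f \<Longrightarrow> P (\<lambda>x. act h (f x))"
      "\<And>f g. P f \<Longrightarrow> P g \<Longrightarrow> P (\<lambda>x. f x + g x)" "\<And>f c. P f \<Longrightarrow> P (\<lambda>x. sA c (f x))"
  shows "ideal_of sA S {f v | f. block_op S f \<and> P f} \<and> H_invariant act {f v | f. block_op S f \<and> P f}" (is "ideal_of _ _ ?U \<and> _")
proof
  show "ideal_of sA S ?U"
    unfolding ideal_of_def
  proof (intro conjI ballI)
    show "A.subspace ?U"
    proof (rule A.subspaceI)
      have "block_op S (\<lambda>x. sA 0 (f0 x)) \<and> P (\<lambda>x. sA 0 (f0 x))"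
        by (intro conjI P(5) block_op.scale ne)
      then show "0 \<in> ?U" by (intro CollectI exI[of _ "\<lambda>x. sA 0 (f0 x)"]) simp
    next
      fix x y assume "x \<in> ?U" "y \<in> ?U"
      then obtain f g where "x = f v" "y = g v" "block_op S f" "P f" "block_op S g" "P g" by blast
      then show "x + y \<in> ?U" using P(4) by (intro CollectI exI[of _ "\<lambda>x. f x + g x"]) (auto intro: block_op.add)
    next
      fix c x assume "x \<in> ?U"
      then obtain f where "x = f v" "block_op S f" "P f" by blast
      then show "sA c x \<in> ?U" using P(5) by (intro CollectI exI[of _ "\<lambda>x. sA c (f x)"]) (auto intro: block_op.scale)
    qed
    show "?U \<subseteq> S" using block_op_in[OF _ S v] by blast
    fix b x assume b: "b \<in> S" and "x \<in> ?U"
    then obtain f where f: "x = f v" "block_op S f" "P f" by blast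
    show "b * x \<in> ?U" using f b P(1) by (intro CollectI exI[of _ "\<lambda>x. b * f x"]) (auto intro: block_op.lmult)
    show "x * b \<in> ?U" using f b P(2) by (intro CollectI exI[of _ "\<lambda>x. f x * b"]) (auto intro: block_op.rmult)
  qed
  show "H_invariant act ?U"
    unfolding H_invariant_def
  proof (intro allI ballI)
    fix h x assume "x \<in> ?U"
    then obtain f where f: "x = f v" "block_op S f" "P f" by blast
    show "act h x \<in> ?U" using f P(3) by (intro CollectI exI[of _ "\<lambda>x. act h (f x)"]) (auto intro: block_op.act)
  qed
qed

text \<open>Jacobson's argument, by induction on \<open>T\<close>. Let \<open>t\<close> be a further element, and suppose that the
  operators vanishing on \<open>T\<close> and at \<open>t\<close> vanish at \<open>v\<close>. Then \<open>f t \<mapsto> f v\<close>, for \<open>f\<close> vanishing on \<open>T\<close>, is a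
  well-defined map of \<open>S\<close> into itself. It commutes with multiplications and with \<open>H\<close>, so its
  eigenspaces are \<open>H\<close>-invariant ideals and it is a scalar \<open>c\<close>. Hence all \<open>f\<close> vanishing on \<open>T\<close> vanish at
  \<open>v - c t\<close>, which the induction hypothesis excludes.\<close>

lemma density:
  assumes simple: "H_simple sA act S"
    and ac: "\<And>p :: 'f poly. degree p > 0 \<Longrightarrow> \<exists>z. poly p z = 0"
    and fd: "finite Bas" "S \<subseteq> A.span Bas"
    and ann: "\<And>v. v \<in> S \<Longrightarrow> (\<And>b. b \<in> S \<Longrightarrow> b * v = 0) \<Longrightarrow> v = 0"
    and T: "finite T" "T \<subseteq> S" "A.independent T" and v: "v \<in> S" "v \<notin> A.span T"
  shows "\<exists>f. block_op S f \<and> (\<forall>t\<in>T. f t = 0) \<and> f v \<noteq> 0"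
  using T v
proof (induction T arbitrary: v rule: finite_induct)
  case empty
  then have "v \<noteq> 0" by auto
  then obtain b where "b \<in> S" "b * v \<noteq> 0" using ann empty.prems by blast
  then show ?case by (intro exI[of _ "\<lambda>x. b * x"]) (auto intro: block_op.left)
next
  case (insert t T)
  have S: "subalgebra sA S" "H_invariant act S" "S \<noteq> {0}" "A.subspace S"
    and simp: "\<And>I. ideal_of sA S I \<Longrightarrow> H_invariant act I \<Longrightarrow> I = {0} \<or> I = S"
    using simple by (auto simp: H_simple_def subalgebra_def)
  have t: "t \<in> S" "t \<notin> A.span T" and indT: "A.independent T" "T \<subseteq> S"
    using insert by (auto simp: A.independent_insert split: if_splits intro: A.independent_mono)
  define P where "P f \<longleftrightarrow> (\<forall>t\<in>T. f t = 0)" for f :: "'a \<Rightarrow> 'a"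
  have P: "\<And>f b. P f \<Longrightarrow> P (\<lambda>x. b * f x)" "\<And>f b. P f \<Longrightarrow> P (\<lambda>x. f x * b)" "\<And>f h. P f \<Longrightarrow> P (\<lambda>x. act h (f x))"
      "\<And>f g. P f \<Longrightarrow> P g \<Longrightarrow> P (\<lambda>x. f x + g x)" "\<And>f c. P f \<Longrightarrow> P (\<lambda>x. sA c (f x))"
    by (auto simp: P_def act_0)
  obtain f1 where f1: "block_op S f1" "P f1" "f1 t \<noteq> 0" using insert.IH[OF indT(2,1) t] by (auto simp: P_def)
  show ?case
  proof (rule ccontr)
    assume no: "\<nexists>f. block_op S f \<and> (\<forall>t\<in>insert t T. f t = 0) \<and> f v \<noteq> 0"
    let ?U = "{f t | f. block_op S f \<and> P f}"
    have U: "ideal_of sA S ?U \<and> H_invariant act ?U"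
      by (rule block_op_image_ideal[where P = P, OF S(1,2) t(1) f1(1,2) P])
    have "f1 t \<in> ?U" using f1 by blast
    then have "?U \<noteq> {0}" using f1(3) by (metis singletonD)
    then have US: "?U = S" using simp[OF conjunct1[OF U] conjunct2[OF U]] by blast
    then have ex: "\<exists>f. block_op S f \<and> P f \<and> f t = u" if "u \<in> S" for u
    proof -
      have "u \<in> ?U" using that by (simp only: US)
      then show ?thesis by auto
    qed
    have wd: "f v = g v" if "block_op S f" "P f" "block_op S g" "P g" "f t = g t" for f g
    proof -
      have "block_op S (\<lambda>x. f x + sA (-1) (g x))"
        by (intro block_op.add block_op.scale that)
      moreover have "\<forall>s\<in>insert t T. f s + sA (-1) (g s) = 0"
        using that(2,4,5) by (simp add: P_def)
      ultimately have "f v + sA (-1) (g v) = 0" using no by blast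
      then show ?thesis by (simp add: add_eq_0_iff2)
    qed
    define sel where "sel u = (SOME f. block_op S f \<and> P f \<and> f t = u)" for u
    have sel: "block_op S (sel u)" "P (sel u)" "sel u t = u" if "u \<in> S" for u
      using someI_ex[OF ex[OF that]] by (auto simp: sel_def)
    define \<theta> where "\<theta> u = sel u v" for u
    have th: "\<theta> (f t) = f v" if "block_op S f" "P f" for f
    proof -
      have ft: "f t \<in> S" using block_op_in[OF that(1) S(1,2) t(1)] .
      show ?thesis unfolding \<theta>_def by (rule wd[OF sel(1,2)[OF ft] that sel(3)[OF ft]])
    qed
    have maps: "\<theta> u \<in> S" if "u \<in> S" for u
      unfolding \<theta>_def using block_op_in[OF sel(1)[OF that] S(1,2) insert.prems(3)] .
    have th_add: "\<theta> (u + w) = \<theta> u + \<theta> w" if u: "u \<in> S" and w: "w \<in> S" for u w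
      using th[OF block_op.add[OF sel(1)[OF u] sel(1)[OF w]] P(4)[OF sel(2)[OF u] sel(2)[OF w]]]
      by (simp add: sel(3) u w \<theta>_def)
    have th_sc: "\<theta> (sA c u) = sA c (\<theta> u)" if u: "u \<in> S" for c u
      using th[OF block_op.scale[OF sel(1)[OF u]] P(5)[OF sel(2)[OF u]], of c]
      by (simp add: sel(3) u \<theta>_def)
    have th_l: "\<theta> (b * u) = b * \<theta> u" if u: "u \<in> S" and b: "b \<in> S" for b u
      using th[OF block_op.lmult[OF sel(1)[OF u] b] P(1)[OF sel(2)[OF u], of b]]
      by (simp add: sel(3) u \<theta>_def)
    have th_r: "\<theta> (u * b) = \<theta> u * b" if u: "u \<in> S" and b: "b \<in> S" for b u
      using th[OF block_op.rmult[OF sel(1)[OF u] b] P(2)[OF sel(2)[OF u], of b]]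
      by (simp add: sel(3) u \<theta>_def)
    have th_h: "\<theta> (act h u) = act h (\<theta> u)" if u: "u \<in> S" for h u
      using th[OF block_op.act[OF sel(1)[OF u]] P(3)[OF sel(2)[OF u]], of h]
      by (simp add: sel(3) u \<theta>_def)
    obtain c u where u: "u \<in> S" "u \<noteq> 0" "\<theta> u = sA c u"
    proof (rule A.eigenvector_exists[OF ac S(4,3) fd(2,1), of \<theta>])
    qed (use maps th_add th_sc in auto)
    let ?E = "{u \<in> S. \<theta> u = sA c u}"
    have "ideal_of sA S ?E"
      unfolding ideal_of_def
    proof (intro conjI ballI)
      show "A.subspace ?E"
      proof (rule A.subspaceI)
        have "\<theta> 0 = 0" using th_sc[OF u(1), of 0] by simp
        then show "0 \<in> ?E" using A.subspace_0[OF S(4)] by simp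
      qed (use S(4) in \<open>auto simp: th_add th_sc A.subspace_add A.subspace_scale A.scale_right_distrib A.scale_left_commute\<close>)
      fix b x assume b: "b \<in> S" and "x \<in> ?E"
      then have x: "x \<in> S" "\<theta> x = sA c x" by auto
      have "b * x \<in> S" "x * b \<in> S" using S(1) b x by (auto simp: subalgebra_def)
      moreover have "\<theta> (b * x) = sA c (b * x)" using th_l[OF x(1) b] x(2) by (simp add: A.scale_mult_right)
      moreover have "\<theta> (x * b) = sA c (x * b)" using th_r[OF x(1) b] x(2) by (simp add: A.scale_mult_left)
      ultimately show "b * x \<in> ?E" "x * b \<in> ?E" by blast+
    qed auto
    moreover have "H_invariant act ?E"
      using S(2) by (auto simp: H_invariant_def th_h act_smult)
    ultimately have "?E = S" using simp u by blast
    then have all: "\<theta> u = sA c u" if "u \<in> S" for u using that by blast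
    let ?w = "v - sA c t"
    have "?w \<in> S" using insert.prems(3) t(1) S(4) by (intro A.subspace_diff A.subspace_scale)
    moreover have "?w \<notin> A.span T"
    proof
      assume "?w \<in> A.span T"
      then have "v \<in> A.span (insert t T)" by (auto simp: A.span_insert)
      then show False using insert.prems(4) by simp
    qed
    ultimately obtain f where f: "block_op S f" "P f" "f ?w \<noteq> 0"
      using insert.IH[OF indT(2,1)] by (auto simp: P_def)
    have "f ?w = f v - sA c (f t)" by (rule block_op_diff[OF f(1)])
    also have "f v = sA c (f t)" using th[OF f(1,2)] all[OF block_op_in[OF f(1) S(1,2) t(1)]] by simp
    finally show False using f(3) by simp
  qed
qed

lemma dual_operator:
  assumes simple: "H_simple sA act S"
    and ac: "\<And>p :: 'f poly. degree p > 0 \<Longrightarrow> \<exists>z. poly p z = 0"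
    and ann: "\<And>v. v \<in> S \<Longrightarrow> (\<And>b. b \<in> S \<Longrightarrow> b * v = 0) \<Longrightarrow> v = 0"
    and E: "finite E" "A.independent E" "A.span E = S" and e: "e \<in> E" and u: "u \<in> S"
  shows "\<exists>f. block_op S f \<and> (\<forall>t\<in>E - {e}. f t = 0) \<and> f e = u"
proof -
  have S: "subalgebra sA S" "H_invariant act S"
    and simp: "\<And>I. ideal_of sA S I \<Longrightarrow> H_invariant act I \<Longrightarrow> I = {0} \<or> I = S"
    using simple by (auto simp: H_simple_def)
  have ES: "E \<subseteq> S" using E(3) A.span_superset by blast
  have eS: "e \<in> S" using e ES by auto
  define P where "P f \<longleftrightarrow> (\<forall>t\<in>E - {e}. f t = 0)" for f :: "'a \<Rightarrow> 'a"
  have P: "\<And>f b. P f \<Longrightarrow> P (\<lambda>x. b * f x)" "\<And>f b. P f \<Longrightarrow> P (\<lambda>x. f x * b)" "\<And>f h. P f \<Longrightarrow> P (\<lambda>x. act h (f x))"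
      "\<And>f g. P f \<Longrightarrow> P g \<Longrightarrow> P (\<lambda>x. f x + g x)" "\<And>f c. P f \<Longrightarrow> P (\<lambda>x. sA c (f x))"
    by (auto simp: P_def act_0)
  have "e \<notin> A.span (E - {e})" using E(2) e by (auto simp: A.dependent_def)
  then have "\<exists>f. block_op S f \<and> (\<forall>t\<in>E - {e}. f t = 0) \<and> f e \<noteq> 0"
  proof (intro density[OF simple ac E(1) _ ann])
    show "S \<subseteq> A.span E" using E(3) by simp
    show "A.independent (E - {e})" using E(2) by (rule A.independent_mono) blast
  qed (use E ES eS in auto)
  then obtain f where f: "block_op S f" "P f" "f e \<noteq> 0" by (auto simp: P_def)
  let ?U = "{f e | f. block_op S f \<and> P f}"
  have U: "ideal_of sA S ?U \<and> H_invariant act ?U"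
    by (rule block_op_image_ideal[where P = P, OF S eS f(1,2) P])
  have "f e \<in> ?U" using f by blast
  then have "?U \<noteq> {0}" using f(3) by (metis singletonD)
  then have US: "?U = S" using simp[OF conjunct1[OF U] conjunct2[OF U]] by blast
  have "u \<in> ?U" using u by (simp only: US)
  then obtain g where "block_op S g" "P g" "g e = u" by auto
  then show ?thesis by (auto simp: P_def)
qed

end

section \<open>The radical splitting and the trace form of a block\<close>

locale wedderburn_action = generalized_action sH sA act + fd: fd_algebra sA Basis
  for sH :: "'f::field_char_0 \<Rightarrow> 'h::ring_1 \<Rightarrow> 'h" and sA :: "'f \<Rightarrow> 'a::ring \<Rightarrow> 'a" and act Basis +
  fixes J B :: "'a set" and Bs :: "nat \<Rightarrow> 'a set" and q :: nat
  assumes ac: "\<And>p :: 'f poly. degree p > 0 \<Longrightarrow> \<exists>z. poly p z = 0"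
    and J_def: "J = jacobson_radical sA UNIV"
    and J_inv: "H_invariant act J"
    and A_sum: "UNIV = {b + j | b j. b \<in> B \<and> j \<in> J}"
    and A_direct: "B \<inter> J = {0}"
    and B_sum: "internal_direct_sum {1..q} Bs B"
    and Bs_ideal: "\<And>i. i \<in> {1..q} \<Longrightarrow> ideal_of sA B (Bs i)"
    and Bs_simple: "\<And>i. i \<in> {1..q} \<Longrightarrow> H_simple sA act (Bs i)"
    and Bs_semisimple: "\<And>i. i \<in> {1..q} \<Longrightarrow> semisimple_algebra sA (Bs i)"
begin

lemma Bs_subalgebra: "i \<in> {1..q} \<Longrightarrow> subalgebra sA (Bs i)"
  and Bs_inv: "i \<in> {1..q} \<Longrightarrow> H_invariant act (Bs i)"
  and Bs_nonzero: "i \<in> {1..q} \<Longrightarrow> Bs i \<noteq> {0}"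
  and Bs_only_ideals: "i \<in> {1..q} \<Longrightarrow> ideal_of sA (Bs i) I \<Longrightarrow> H_invariant act I \<Longrightarrow> I = {0} \<or> I = Bs i"
  using Bs_simple unfolding H_simple_def by blast+

lemma Bs_subspace: "i \<in> {1..q} \<Longrightarrow> A.subspace (Bs i)"
  and Bs_mult: "i \<in> {1..q} \<Longrightarrow> x \<in> Bs i \<Longrightarrow> y \<in> Bs i \<Longrightarrow> x * y \<in> Bs i"
  using Bs_subalgebra unfolding subalgebra_def by blast+

lemma Bs_sub_B: "i \<in> {1..q} \<Longrightarrow> Bs i \<subseteq> B"
  using Bs_ideal unfolding ideal_of_def by blast

lemma B_decomp: "b \<in> B \<Longrightarrow> \<exists>f. b = (\<Sum>i\<in>{1..q}. f i) \<and> (\<forall>i\<in>{1..q}. f i \<in> Bs i)"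
  and B_combination: "\<forall>i\<in>{1..q}. f i \<in> Bs i \<Longrightarrow> (\<Sum>i\<in>{1..q}. f i) \<in> B"
proof -
  have eq: "B = {\<Sum>i\<in>{1..q}. f i | f. \<forall>i\<in>{1..q}. f i \<in> Bs i}"
    using B_sum unfolding internal_direct_sum_def by (rule conjunct1)
  show "b \<in> B \<Longrightarrow> \<exists>f. b = (\<Sum>i\<in>{1..q}. f i) \<and> (\<forall>i\<in>{1..q}. f i \<in> Bs i)"
    by (subst (asm) eq) (simp only: mem_Collect_eq)
  show "\<forall>i\<in>{1..q}. f i \<in> Bs i \<Longrightarrow> (\<Sum>i\<in>{1..q}. f i) \<in> B"
    by (subst eq, rule CollectI) blast
qed

lemma Bs_direct:
  assumes "\<And>i. i \<in> {1..q} \<Longrightarrow> f i \<in> Bs i" "(\<Sum>i\<in>{1..q}. f i) = 0" "i \<in> {1..q}"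
  shows "f i = 0"
  using conjunct2[OF B_sum[unfolded internal_direct_sum_def]] assms by blast

lemma Bs_disjoint:
  assumes "i \<in> {1..q}" "j \<in> {1..q}" "i \<noteq> j" "x \<in> Bs i" "x \<in> Bs j"
  shows "x = 0"
proof -
  define f where "f k = (if k = i then x else if k = j then - x else 0)" for k
  have "(\<Sum>k\<in>{1..q}. f k) = (\<Sum>k\<in>{i, j}. f k)"
    by (rule sum.mono_neutral_right) (use assms in \<open>auto simp: f_def\<close>)
  also have "\<dots> = 0" using assms by (simp add: f_def)
  finally have "(\<Sum>k\<in>{1..q}. f k) = 0" .
  moreover have "f k \<in> Bs k" if "k \<in> {1..q}" for k
    using assms that A.subspace_neg[OF Bs_subspace] A.subspace_0[OF Bs_subspace] by (simp add: f_def)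
  ultimately have "f i = 0" using Bs_direct assms(1) by blast
  then show ?thesis by (simp add: f_def)
qed

lemma Bs_orthogonal:
  assumes "i \<in> {1..q}" "j \<in> {1..q}" "i \<noteq> j" "x \<in> Bs i" "y \<in> Bs j"
  shows "x * y = 0"
proof -
  have "x \<in> B" "y \<in> B" using Bs_sub_B assms by blast+
  then have "x * y \<in> Bs i" "x * y \<in> Bs j" using Bs_ideal assms unfolding ideal_of_def by blast+
  then show ?thesis using Bs_disjoint assms by blast
qed

lemma nil_left_ideal_of_Bs:
  assumes i: "i \<in> {1..q}" and N: "left_ideal_of sA (Bs i) N" "\<And>x. x \<in> N \<Longrightarrow> \<exists>k. fd.npow x k = 0"
  shows "N \<subseteq> {0}"
  using fd.nil_left_ideal_subset_radical[OF N Bs_subalgebra[OF i]] Bs_semisimple[OF i]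
  by (simp add: semisimple_algebra_def)

lemma subspace_zeros:
  assumes V: "A.subspace V" and "\<And>b. P b 0" "\<And>b x y. P b x \<Longrightarrow> P b y \<Longrightarrow> P b (x + y)" "\<And>b c x. P b x \<Longrightarrow> P b (sA c x)"
  shows "A.subspace {v \<in> V. \<forall>b\<in>X. P b v}"
proof (rule A.subspaceI)
  show "0 \<in> {v \<in> V. \<forall>b\<in>X. P b v}" using A.subspace_0[OF V] assms(2) by simp
  show "x + y \<in> {v \<in> V. \<forall>b\<in>X. P b v}" if "x \<in> {v \<in> V. \<forall>b\<in>X. P b v}" "y \<in> {v \<in> V. \<forall>b\<in>X. P b v}" for x y
    using that A.subspace_add[OF V] assms(3) by simp
  show "sA c x \<in> {v \<in> V. \<forall>b\<in>X. P b v}" if "x \<in> {v \<in> V. \<forall>b\<in>X. P b v}" for c x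
    using that A.subspace_scale[OF V] assms(4) by simp
qed

text \<open>The elements annihilated by \<open>Bs i\<close> from the left form a left ideal of square 0, which is contained
  in the radical of \<open>Bs i\<close>.\<close>

lemma Bs_annihilator:
  assumes i: "i \<in> {1..q}" and v: "v \<in> Bs i" "\<And>b. b \<in> Bs i \<Longrightarrow> b * v = 0"
  shows "v = 0"
proof -
  let ?N = "{v \<in> Bs i. \<forall>b\<in>Bs i. b * v = 0}"
  have "left_ideal_of sA (Bs i) ?N"
    unfolding left_ideal_of_def
  proof (intro conjI ballI)
    show "A.subspace ?N"
      by (rule subspace_zeros[OF Bs_subspace[OF i]]) (simp_all add: distrib_left flip: A.scale_mult_right)
    fix a x assume "a \<in> Bs i" "x \<in> ?N"
    then show "a * x \<in> ?N" using A.subspace_0[OF Bs_subspace[OF i]] by auto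
  qed auto
  moreover have "\<exists>k. fd.npow x k = 0" if "x \<in> ?N" for x
    using that by (intro exI[of _ "Suc 0"]) (auto simp: fd.npow_Suc)
  ultimately have "?N \<subseteq> {0}" by (rule nil_left_ideal_of_Bs[OF i])
  then show ?thesis using v by blast
qed

text \<open>The span of the products is an \<open>H\<close>-invariant ideal, and it is nonzero by \<open>Bs_annihilator\<close>. So an
  element of a block can be factored inside the block without recourse to a unit element.\<close>

lemma Bs_products_span:
  assumes i: "i \<in> {1..q}"
  shows "A.span {u * v | u v. u \<in> Bs i \<and> v \<in> Bs i} = Bs i"
proof -
  let ?G = "{u * v | u v. u \<in> Bs i \<and> v \<in> Bs i}"
  have sub: "A.span ?G \<subseteq> Bs i"
    by (rule A.span_minimal) (use Bs_mult[OF i] Bs_subspace[OF i] in auto)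
  have lin: "A.span ?G \<subseteq> {x. \<phi> x \<in> A.span ?G}"
    if "\<And>x. x \<in> ?G \<Longrightarrow> \<phi> x \<in> A.span ?G" "\<And>x y. \<phi> (x + y) = \<phi> x + \<phi> y" "\<And>c x. \<phi> (sA c x) = sA c (\<phi> x)" for \<phi>
  proof (rule A.span_minimal)
    have "\<phi> 0 = 0" using that(3)[of 0 0] by simp
    then show "A.subspace {x. \<phi> x \<in> A.span ?G}"
      by (intro A.subspaceI) (auto simp: that A.span_zero intro: A.span_add A.span_scale)
  qed (use that(1) in auto)
  have ideal: "ideal_of sA (Bs i) (A.span ?G)"
    unfolding ideal_of_def using sub by (auto intro!: A.span_base)
  have "A.span ?G \<subseteq> {x. act h x \<in> A.span ?G}" for h
  proof (rule lin)
    fix x assume "x \<in> ?G"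
    then obtain u v where uv: "x = u * v" "u \<in> Bs i" "v \<in> Bs i" by blast
    obtain qs where qs: "\<And>a b. act h (a * b) =
        (\<Sum>(h1, h2, h3, h4)\<leftarrow>qs. act h1 a * act h2 b + act h3 b * act h4 a)"
      using act_prod[of h] by blast
    have in': "act g u \<in> Bs i" "act g v \<in> Bs i" for g
      using Bs_inv[OF i] uv by (auto simp: H_invariant_def)
    have "(\<Sum>(h1, h2, h3, h4)\<leftarrow>qs. act h1 u * act h2 v + act h3 v * act h4 u) \<in> A.span ?G"
    proof (induction qs)
      case (Cons a qs)
      obtain h1 h2 h3 h4 where a: "a = (h1, h2, h3, h4)" by (cases a) auto
      have "act h1 u * act h2 v \<in> ?G" "act h3 v * act h4 u \<in> ?G" using in' by blast+
      then have "act h1 u * act h2 v + act h3 v * act h4 u \<in> A.span ?G"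
        by (intro A.span_add A.span_base)
      from A.span_add[OF this Cons] show ?case by (simp only: a list.map sum_list.Cons prod.case)
    qed (simp add: A.span_zero)
    then show "act h x \<in> A.span ?G" using qs uv by simp
  qed (auto simp: act_plus act_smult)
  then have "H_invariant act (A.span ?G)" unfolding H_invariant_def by blast
  moreover have "A.span ?G \<noteq> {0}"
  proof
    assume "A.span ?G = {0}"
    then have 0: "u * v = 0" if "u \<in> Bs i" "v \<in> Bs i" for u v
      using that A.span_base[of "u * v" ?G] by blast
    then have "v = 0" if "v \<in> Bs i" for v using Bs_annihilator[OF i that] that by blast
    then show False using Bs_nonzero[OF i] A.subspace_0[OF Bs_subspace[OF i]] by blast
  qed
  ultimately show ?thesis using Bs_only_ideals[OF i ideal] by blast
qed

text \<open>Index 0 stands for the radical.\<close>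

definition component :: "nat \<Rightarrow> 'a set" where "component i = (if i = 0 then J else Bs i)"

lemma component_Bs: "i \<in> {1..q} \<Longrightarrow> component i = Bs i" by (auto simp: component_def)

lemma J_subspace: "A.subspace J"
proof -
  let ?M = "{I. modular_left_ideal_of sA UNIV I \<and> maximal_left_ideal_of sA UNIV I}"
  have "A.subspace (\<Inter> ?M)"
    by (rule A.subspace_Inter) (auto simp: modular_left_ideal_of_def left_ideal_of_def)
  then show ?thesis by (simp add: J_def jacobson_radical_def)
qed

lemma component_subspace: "i \<le> q \<Longrightarrow> A.subspace (component i)"
  by (cases "i = 0") (auto simp: component_def J_subspace Bs_subspace)

lemma component_inv: "i \<le> q \<Longrightarrow> x \<in> component i \<Longrightarrow> act h x \<in> component i"
  using J_inv Bs_inv by (cases "i = 0") (auto simp: component_def H_invariant_def)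

lemma sum_atMost_split: "(\<Sum>i\<le>q. g i) = g 0 + (\<Sum>i\<in>{1..q}. g i)" for g :: "nat \<Rightarrow> 'a"
proof -
  have "{..q} = insert 0 {1..q}" by auto
  then show ?thesis by (simp only: sum.insert finite_atLeastAtMost) simp
qed

lemma component_direct:
  assumes f: "\<And>i. i \<le> q \<Longrightarrow> f i \<in> component i" and s: "(\<Sum>i\<le>q. f i) = 0" and i: "i \<le> q"
  shows "f i = 0"
proof -
  have 1: "f 0 + (\<Sum>i\<in>{1..q}. f i) = 0" using s by (simp only: sum_atMost_split)
  have fB: "f i \<in> Bs i" if "i \<in> {1..q}" for i using f[of i] that by (simp add: component_Bs)
  then have sB: "(\<Sum>i\<in>{1..q}. f i) \<in> B" using B_combination by blast
  have eq: "(\<Sum>i\<in>{1..q}. f i) = - f 0" using 1 by (simp add: eq_neg_iff_add_eq_0 add.commute)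
  have "- f 0 \<in> B" using sB by (simp only: eq)
  moreover have "- f 0 \<in> J" using f[of 0] A.subspace_neg[OF J_subspace] by (simp add: component_def)
  ultimately have "- f 0 \<in> B \<inter> J" by (rule IntI)
  then have f0: "f 0 = 0" unfolding A_direct by simp
  then have "(\<Sum>i\<in>{1..q}. f i) = 0" using eq by simp
  then have "f i = 0" if "i \<in> {1..q}" using Bs_direct[OF fB] that by blast
  then show ?thesis using i f0 by (cases "i = 0") auto
qed

lemma component_decomp: obtains f where "\<And>i. i \<le> q \<Longrightarrow> f i \<in> component i" "x = (\<Sum>i\<le>q. f i)"
proof -
  have "x \<in> {b + j | b j. b \<in> B \<and> j \<in> J}" by (subst A_sum[symmetric]) simp
  then obtain b j where bj: "x = b + j" "b \<in> B" "j \<in> J" by blast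
  then obtain g where g: "b = (\<Sum>i\<in>{1..q}. g i)" "\<forall>i\<in>{1..q}. g i \<in> Bs i"
    using B_decomp by blast
  define f where "f i = (if i = 0 then j else g i)" for i
  have "x = (\<Sum>i\<le>q. f i)" unfolding sum_atMost_split using bj g by (simp add: f_def add.commute)
  moreover have "f i \<in> component i" if "i \<le> q" for i using that g bj by (auto simp: f_def component_def)
  ultimately show ?thesis using that by blast
qed

definition comp_basis :: "nat \<Rightarrow> 'a set" where
  "comp_basis i = (SOME E. finite E \<and> A.independent E \<and> A.span E = component i)"

lemma comp_basis:
  assumes "i \<le> q"
  shows comp_basis_finite: "finite (comp_basis i)" and comp_basis_independent: "A.independent (comp_basis i)" and comp_basis_span: "A.span (comp_basis i) = component i"
proof -
  obtain E where E: "E \<subseteq> component i" "A.independent E" "component i \<subseteq> A.span E"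
    by (rule A.basis_exists[of "component i"])
  then have "A.span E = component i" using A.span_minimal[OF E(1) component_subspace[OF assms]] by auto
  then have "finite E \<and> A.independent E \<and> A.span E = component i" using E fd.finiteI_independent by blast
  then have "finite (comp_basis i) \<and> A.independent (comp_basis i) \<and> A.span (comp_basis i) = component i"
    unfolding comp_basis_def by (rule someI)
  then show "finite (comp_basis i)" "A.independent (comp_basis i)" "A.span (comp_basis i) = component i" by auto
qed

lemma comp_basis_sub: "i \<le> q \<Longrightarrow> comp_basis i \<subseteq> component i"
  using comp_basis_span A.span_superset by blast

lemma component_disjoint:
  assumes "i \<le> q" "j \<le> q" "i \<noteq> j" "x \<in> component i" "x \<in> component j"
  shows "x = 0"
proof -
  define f where "f k = (if k = i then x else if k = j then - x else 0)" for k
  have "(\<Sum>k\<le>q. f k) = (\<Sum>k\<in>{i, j}. f k)"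
    by (rule sum.mono_neutral_right) (use assms in \<open>auto simp: f_def\<close>)
  also have "\<dots> = 0" using assms by (simp add: f_def)
  finally have "(\<Sum>k\<le>q. f k) = 0" .
  moreover have "f k \<in> component k" if "k \<le> q" for k
    using assms that A.subspace_neg[OF component_subspace] A.subspace_0[OF component_subspace] by (simp add: f_def)
  ultimately have "f i = 0" using component_direct assms(1) by blast
  then show ?thesis by (simp add: f_def)
qed

lemma comp_basis_disjoint: assumes "i \<le> q" "j \<le> q" "i \<noteq> j" shows "comp_basis i \<inter> comp_basis j = {}"
proof (rule ccontr)
  assume "comp_basis i \<inter> comp_basis j \<noteq> {}"
  then obtain x where "x \<in> comp_basis i" "x \<in> comp_basis j" by blast
  moreover from this have "x = 0" using component_disjoint[OF assms, of x] comp_basis_sub assms by blast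
  ultimately show False using comp_basis_independent[OF assms(1)] A.dependent_zero by blast
qed

definition adapted_basis :: "'a set" where "adapted_basis = (\<Union>i\<le>q. comp_basis i)"

lemma adapted_basis_finite: "finite adapted_basis" by (simp add: adapted_basis_def comp_basis_finite)

lemma adapted_basis_sum: "(\<Sum>v\<in>adapted_basis. g v) = (\<Sum>i\<le>q. \<Sum>v\<in>comp_basis i. g v)"
  unfolding adapted_basis_def by (rule sum.UNION_disjoint) (auto simp: comp_basis_finite comp_basis_disjoint)

lemma adapted_basis_independent: "A.independent adapted_basis"
proof
  assume "A.dependent adapted_basis"
  then obtain c where c: "\<exists>v\<in>adapted_basis. c v \<noteq> 0" "(\<Sum>v\<in>adapted_basis. sA (c v) v) = 0"
    using A.dependent_finite[OF adapted_basis_finite] by blast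
  then obtain i v where v: "i \<le> q" "v \<in> comp_basis i" "c v \<noteq> 0" by (auto simp: adapted_basis_def)
  have "(\<Sum>v\<in>comp_basis i. sA (c v) v) = 0"
  proof (rule component_direct[OF _ _ v(1)])
    show "(\<Sum>i\<le>q. \<Sum>v\<in>comp_basis i. sA (c v) v) = 0" using c(2) by (simp add: adapted_basis_sum)
    show "(\<Sum>v\<in>comp_basis i. sA (c v) v) \<in> component i" if "i \<le> q" for i
      using component_subspace[OF that] comp_basis_sub[OF that] by (intro A.subspace_sum A.subspace_scale) auto
  qed
  then show False using comp_basis_independent[OF v(1)] A.dependent_finite[OF comp_basis_finite[OF v(1)]] v by blast
qed

lemma adapted_basis_span: "A.span adapted_basis = UNIV"
proof -
  have "x \<in> A.span adapted_basis" for x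
  proof -
    obtain f where f: "\<And>i. i \<le> q \<Longrightarrow> f i \<in> component i" "x = (\<Sum>i\<le>q. f i)" by (rule component_decomp[of x]) blast
    have "f i \<in> A.span adapted_basis" if "i \<le> q" for i
      using f(1)[OF that] comp_basis_span[OF that] A.span_mono[of "comp_basis i" adapted_basis] that by (auto simp: adapted_basis_def)
    then show ?thesis unfolding f(2) by (intro A.span_sum) auto
  qed
  then show ?thesis by auto
qed

end

text \<open>The sequence \<open>e\<close> enumerates a basis of the sum of the blocks in \<open>S\<close>, and \<open>D\<close> is its dimension.\<close>

locale block = wedderburn_action sH sA act Basis J B Bs q
  for sH :: "'f::field_char_0 \<Rightarrow> 'h::ring_1 \<Rightarrow> 'h" and sA :: "'f \<Rightarrow> 'a::ring \<Rightarrow> 'a" and act Basis J B Bs q +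
  fixes S :: "nat set" and D :: nat and e :: "nat \<Rightarrow> 'a"
  assumes S: "S \<subseteq> {1..q}" and e: "bij_betw e {..<D} (\<Union>i\<in>S. comp_basis i)"
begin

lemma S_le: "i \<in> S \<Longrightarrow> i \<le> q" and S_in: "i \<in> S \<Longrightarrow> i \<in> {1..q}" and S_finite: "finite S"
  using S by (auto intro: finite_subset)

definition block_space :: "'a set" where "block_space = A.span (e ` {..<D})"

lemma e_image: "e ` {..<D} = (\<Union>i\<in>S. comp_basis i)" using e by (simp add: bij_betw_def)

lemma e_in_adapted_basis: "j < D \<Longrightarrow> e j \<in> adapted_basis"
  using e_image S_le by (force simp: adapted_basis_def)

lemma e_inj: "i < D \<Longrightarrow> j < D \<Longrightarrow> e i = e j \<longleftrightarrow> i = j"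
  using e by (auto simp: bij_betw_def inj_on_def)

lemma e_in_block_space: "j < D \<Longrightarrow> e j \<in> block_space" unfolding block_space_def by (auto intro: A.span_base)

lemma block_space_subspace: "A.subspace block_space" by (simp add: block_space_def)

definition coordinate :: "nat \<Rightarrow> 'a \<Rightarrow> 'f" where "coordinate j v = A.representation adapted_basis v (e j)"

lemma coordinate_add: "coordinate j (u + v) = coordinate j u + coordinate j v"
  and coordinate_scale: "coordinate j (sA c v) = c * coordinate j v"
  unfolding coordinate_def using adapted_basis_independent adapted_basis_span by (auto simp: A.representation_add A.representation_scale)

lemma coordinate_zero: "coordinate j 0 = 0" using coordinate_scale[of j 0 0] by simp

lemma coordinate_sum: "coordinate j (\<Sum>x\<in>X. f x) = (\<Sum>x\<in>X. coordinate j (f x))"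
  by (induction X rule: infinite_finite_induct) (auto simp: coordinate_add coordinate_zero)

lemma coordinate_e: "i < D \<Longrightarrow> j < D \<Longrightarrow> coordinate j (e i) = (if i = j then 1 else 0)"
  unfolding coordinate_def using A.representation_basis[OF adapted_basis_independent e_in_adapted_basis, of i] e_inj by auto

lemma block_space_expand: "v \<in> block_space \<Longrightarrow> v = (\<Sum>j<D. sA (coordinate j v) (e j))"
proof -
  have "block_space \<subseteq> {v. v = (\<Sum>j<D. sA (coordinate j v) (e j))}"
    unfolding block_space_def
  proof (rule A.span_minimal)
    show "A.subspace {v. v = (\<Sum>j<D. sA (coordinate j v) (e j))}"
    proof (rule A.subspaceI)
      fix c x assume "x \<in> {v. v = (\<Sum>j<D. sA (coordinate j v) (e j))}"
      then have "sA c x = sA c (\<Sum>j<D. sA (coordinate j x) (e j))" by simp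
      also have "\<dots> = (\<Sum>j<D. sA (coordinate j (sA c x)) (e j))" by (simp add: A.scale_sum_right coordinate_scale)
      finally show "sA c x \<in> {v. v = (\<Sum>j<D. sA (coordinate j v) (e j))}" by simp
    next
      fix x y assume "x \<in> {v. v = (\<Sum>j<D. sA (coordinate j v) (e j))}" "y \<in> {v. v = (\<Sum>j<D. sA (coordinate j v) (e j))}"
      then have "x + y = (\<Sum>j<D. sA (coordinate j x) (e j)) + (\<Sum>j<D. sA (coordinate j y) (e j))" by simp
      also have "\<dots> = (\<Sum>j<D. sA (coordinate j (x + y)) (e j))" by (simp add: coordinate_add A.scale_left_distrib sum.distrib)
      finally show "x + y \<in> {v. v = (\<Sum>j<D. sA (coordinate j v) (e j))}" by simp
    qed (simp add: coordinate_zero)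
    show "e ` {..<D} \<subseteq> {v. v = (\<Sum>j<D. sA (coordinate j v) (e j))}"
    proof clarsimp
      fix i assume "i < D"
      have "(\<Sum>j<D. sA (coordinate j (e i)) (e j)) = (\<Sum>j<D. if i = j then e j else 0)"
        using \<open>i < D\<close> by (intro sum.cong) (auto simp: coordinate_e)
      then show "e i = (\<Sum>j<D. sA (coordinate j (e i)) (e j))" using \<open>i < D\<close> by simp
    qed
  qed
  then show "v \<in> block_space \<Longrightarrow> v = (\<Sum>j<D. sA (coordinate j v) (e j))" by blast
qed

lemma block_space_combination: "(\<Sum>j<D. sA (c j) (e j)) \<in> block_space"
  by (intro A.subspace_sum[OF block_space_subspace] A.subspace_scale[OF block_space_subspace] e_in_block_space) auto

lemma coordinate_combination: "i < D \<Longrightarrow> coordinate i (\<Sum>j<D. sA (c j) (e j)) = c i"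
  by (simp add: coordinate_sum coordinate_scale coordinate_e if_distrib cong: if_cong)

lemma block_space_eq_zero: "v \<in> block_space \<Longrightarrow> (\<And>j. j < D \<Longrightarrow> coordinate j v = 0) \<Longrightarrow> v = 0"
  using block_space_expand[of v] by simp

lemma Bs_sub_block_space: "i \<in> S \<Longrightarrow> Bs i \<subseteq> block_space"
  unfolding block_space_def e_image using comp_basis_span[OF S_le, of i] component_Bs[OF S_in, of i] A.span_mono[of "comp_basis i" "\<Union>i\<in>S. comp_basis i"]
  by blast

lemma block_space_decomp: assumes "v \<in> block_space" obtains f where "\<And>i. i \<in> S \<Longrightarrow> f i \<in> Bs i" "v = (\<Sum>i\<in>S. f i)"
proof -
  let ?Q = "{v. \<exists>f. (\<forall>i\<in>S. f i \<in> Bs i) \<and> v = (\<Sum>i\<in>S. f i)}"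
  have "block_space \<subseteq> ?Q"
    unfolding block_space_def
  proof (rule A.span_minimal)
    show "A.subspace ?Q"
    proof (rule A.subspaceI)
      show "0 \<in> ?Q" using A.subspace_0[OF Bs_subspace[OF S_in]] by (intro CollectI exI[of _ "\<lambda>_. 0"]) auto
    next
      fix x y assume "x \<in> ?Q" "y \<in> ?Q"
      then obtain f g where "\<forall>i\<in>S. f i \<in> Bs i" "x = (\<Sum>i\<in>S. f i)" "\<forall>i\<in>S. g i \<in> Bs i" "y = (\<Sum>i\<in>S. g i)" by blast
      then show "x + y \<in> ?Q"
        using A.subspace_add[OF Bs_subspace[OF S_in]]
        by (intro CollectI exI[of _ "\<lambda>i. f i + g i"]) (auto simp: sum.distrib)
    next
      fix c x assume "x \<in> ?Q"
      then obtain f where "\<forall>i\<in>S. f i \<in> Bs i" "x = (\<Sum>i\<in>S. f i)" by blast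
      then show "sA c x \<in> ?Q"
        using A.subspace_scale[OF Bs_subspace[OF S_in]]
        by (intro CollectI exI[of _ "\<lambda>i. sA c (f i)"]) (auto simp: A.scale_sum_right)
    qed
    show "e ` {..<D} \<subseteq> ?Q"
    proof
      fix x assume "x \<in> e ` {..<D}"
      then obtain i where i: "i \<in> S" "x \<in> comp_basis i" unfolding e_image by blast
      then have "x \<in> Bs i" using comp_basis_sub[OF S_le] component_Bs[OF S_in] by blast
      then show "x \<in> ?Q"
        using A.subspace_0[OF Bs_subspace[OF S_in]] i S_finite
        by (intro CollectI exI[of _ "\<lambda>j. if j = i then x else 0"]) auto
    qed
  qed
  then show ?thesis using assms that by blast
qed

lemma Bs_mult_sum:
  assumes "i \<in> S" "b \<in> Bs i" "\<And>j. j \<in> S \<Longrightarrow> f j \<in> Bs j"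
  shows "b * (\<Sum>j\<in>S. f j) = b * f i"
proof -
  have "b * (\<Sum>j\<in>S. f j) = (\<Sum>j\<in>S. b * f j)" by (simp add: sum_distrib_left)
  also have "\<dots> = (\<Sum>j\<in>{i}. b * f j)"
  proof (rule sum.mono_neutral_right)
    show "\<forall>j\<in>S - {i}. b * f j = 0"
    proof
      fix j assume "j \<in> S - {i}"
      then show "b * f j = 0" using assms by (intro Bs_orthogonal[of i j] S_in) auto
    qed
  qed (use assms S_finite in auto)
  finally show ?thesis by simp
qed

lemma block_space_mult: assumes "x \<in> block_space" "y \<in> block_space" shows "x * y \<in> block_space"
proof -
  obtain f g where f: "\<And>i. i \<in> S \<Longrightarrow> f i \<in> Bs i" "x = (\<Sum>i\<in>S. f i)"
    and g: "\<And>i. i \<in> S \<Longrightarrow> g i \<in> Bs i" "y = (\<Sum>i\<in>S. g i)"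
    using block_space_decomp[OF assms(1)] block_space_decomp[OF assms(2)] by metis
  have "x * y = (\<Sum>i\<in>S. f i * y)" by (simp add: f(2) sum_distrib_right)
  also have "\<dots> = (\<Sum>i\<in>S. f i * g i)" unfolding g(2) by (rule sum.cong) (auto simp: Bs_mult_sum f g)
  also have "\<dots> \<in> block_space"
    using f g Bs_mult[OF S_in] Bs_sub_block_space by (intro A.subspace_sum[OF block_space_subspace]) blast
  finally show ?thesis .
qed

definition mult_trace :: "'a \<Rightarrow> 'f" where "mult_trace y = (\<Sum>j<D. coordinate j (y * e j))"

lemma mult_trace_add: "mult_trace (x + y) = mult_trace x + mult_trace y"
  by (simp add: mult_trace_def distrib_right coordinate_add sum.distrib)
lemma mult_trace_scale: "mult_trace (sA c x) = c * mult_trace x"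
  by (simp add: mult_trace_def coordinate_scale sum_distrib_left flip: A.scale_mult_left)
lemma mult_trace_zero: "mult_trace 0 = 0" using mult_trace_scale[of 0 0] by simp
lemma mult_trace_sum: "mult_trace (\<Sum>x\<in>X. f x) = (\<Sum>x\<in>X. mult_trace (f x))"
  by (induction X rule: infinite_finite_induct) (auto simp: mult_trace_add mult_trace_zero)

definition block_det :: "(nat \<Rightarrow> 'a) \<Rightarrow> 'f" where "block_det x = det_fun D (\<lambda>i j. coordinate j (x i))"

text \<open>In this way a trace is produced from a polynomial: multiply one determinant argument after the
  other by \<open>w\<close> and add up.\<close>

lemma block_det_trace:
  assumes x: "\<And>i. i < D \<Longrightarrow> x i \<in> block_space"
  shows "(\<Sum>i<D. block_det (x(i := w * x i))) = mult_trace w * block_det x"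
proof -
  let ?L = "\<lambda>j l. coordinate j (w * e l)"
  have "coordinate j (w * x i) = (\<Sum>l<D. ?L j l * coordinate l (x i))" if "i < D" for i j
  proof -
    have "w * x i = (\<Sum>l<D. sA (coordinate l (x i)) (w * e l))"
      by (subst block_space_expand[OF x[OF that]]) (simp add: sum_distrib_left A.scale_mult_right)
    then show ?thesis by (simp add: coordinate_sum coordinate_scale mult.commute)
  qed
  then have "block_det (x(i := w * x i)) = det_fun D ((\<lambda>i j. coordinate j (x i))(i := \<lambda>j. \<Sum>l<D. ?L j l * coordinate l (x i)))" if "i < D" for i
    unfolding block_det_def using that by (intro det_fun_cong) auto
  then have "(\<Sum>i<D. block_det (x(i := w * x i))) = (\<Sum>i<D. det_fun D ((\<lambda>i j. coordinate j (x i))(i := \<lambda>j. \<Sum>l<D. ?L j l * coordinate l (x i))))"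
    by (intro sum.cong) auto
  also have "\<dots> = (\<Sum>j<D. ?L j j) * det_fun D (\<lambda>i j. coordinate j (x i))" by (rule det_fun_derivation)
  finally show ?thesis by (simp add: mult_trace_def block_det_def)
qed

lemma block_det_nonzero:
  assumes x: "\<And>i. i < D \<Longrightarrow> x i \<in> block_space" and ind: "\<And>c. (\<Sum>i<D. sA (c i) (x i)) = 0 \<Longrightarrow> \<forall>i<D. c i = 0"
  shows "block_det x \<noteq> 0"
proof -
  have "det_fun D (\<lambda>i j. coordinate i (x j)) \<noteq> 0"
  proof (rule det_fun_nonzero)
    fix v assume v: "\<And>i. i < D \<Longrightarrow> (\<Sum>j<D. coordinate i (x j) * v j) = 0"
    have "(\<Sum>j<D. sA (v j) (x j)) = 0"
    proof (rule block_space_eq_zero)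
      show "(\<Sum>j<D. sA (v j) (x j)) \<in> block_space"
        by (intro A.subspace_sum[OF block_space_subspace] A.subspace_scale[OF block_space_subspace]) (use x in auto)
      fix i assume "i < D"
      then show "coordinate i (\<Sum>j<D. sA (v j) (x j)) = 0" using v[of i] by (simp add: coordinate_sum coordinate_scale mult.commute)
    qed
    then show "\<forall>j<D. v j = 0" by (rule ind)
  qed
  then show ?thesis using det_fun_transpose[of D "\<lambda>i j. coordinate j (x i)"] by (simp add: block_det_def)
qed

text \<open>The trace of an idempotent is the dimension of its image, which is nonzero in characteristic 0.
  To see this, apply \<open>block_det_trace\<close> to a basis adapted to the image and the kernel of the left
  multiplication by \<open>f\<close>: each basis element of the image contributes the determinant, each one of
  the kernel contributes 0.\<close>

lemma mult_trace_idempotent: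
  assumes f: "f \<in> block_space" "f * f = f" "f \<noteq> 0"
  shows "mult_trace f \<noteq> 0"
proof -
  let ?V1 = "{v \<in> block_space. f * v = v}" and ?V0 = "{v \<in> block_space. f * v = 0}"
  obtain B1 where B1: "B1 \<subseteq> ?V1" "A.independent B1" "?V1 \<subseteq> A.span B1" by (rule A.basis_exists[of ?V1])
  obtain B0 where B0: "B0 \<subseteq> ?V0" "A.independent B0" "?V0 \<subseteq> A.span B0" by (rule A.basis_exists[of ?V0])
  have fin: "finite B1" "finite B0" using B1 B0 fd.finiteI_independent by auto
  have disj: "B1 \<inter> B0 = {}"
  proof -
    have "x = 0" if "x \<in> B1" "x \<in> B0" for x
    proof -
      have "f * x = x" "f * x = 0" using that B1(1) B0(1) by blast+
      then show ?thesis by simp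
    qed
    then show ?thesis using B1(2) A.dependent_zero by blast
  qed
  have ind: "\<forall>v\<in>B1 \<union> B0. c v = 0" if "(\<Sum>v\<in>B1 \<union> B0. sA (c v) v) = 0" for c
  proof -
    have s: "(\<Sum>v\<in>B1. sA (c v) v) + (\<Sum>v\<in>B0. sA (c v) v) = 0"
      using that by (simp add: sum.union_disjoint[OF fin disj])
    have "f * ((\<Sum>v\<in>B1. sA (c v) v) + (\<Sum>v\<in>B0. sA (c v) v)) = (\<Sum>v\<in>B1. sA (c v) (f * v)) + (\<Sum>v\<in>B0. sA (c v) (f * v))"
      by (simp add: distrib_left sum_distrib_left A.scale_mult_right)
    also have "(\<Sum>v\<in>B1. sA (c v) (f * v)) = (\<Sum>v\<in>B1. sA (c v) v)" using B1(1) by (intro sum.cong) auto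
    also have "(\<Sum>v\<in>B0. sA (c v) (f * v)) = 0" using B0(1) by (intro sum.neutral) auto
    finally have "(\<Sum>v\<in>B1. sA (c v) v) = 0" unfolding s by simp
    moreover from this s have "(\<Sum>v\<in>B0. sA (c v) v) = 0" by simp
    ultimately show ?thesis
      using B1(2) B0(2) A.dependent_finite[OF fin(1)] A.dependent_finite[OF fin(2)] by blast
  qed
  then have indep: "A.independent (B1 \<union> B0)" using A.dependent_finite[of "B1 \<union> B0"] fin by blast
  have "block_space \<subseteq> A.span (B1 \<union> B0)"
  proof
    fix v assume v: "v \<in> block_space"
    have "f * v \<in> ?V1" using block_space_mult[OF f(1) v] f(2) by (simp flip: mult.assoc)
    moreover have "v - f * v \<in> ?V0"
      using A.subspace_diff[OF block_space_subspace v block_space_mult[OF f(1) v]] f(2) by (simp add: right_diff_distrib flip: mult.assoc)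
    ultimately have "f * v \<in> A.span (B1 \<union> B0)" "v - f * v \<in> A.span (B1 \<union> B0)"
      using B1(3) B0(3) A.span_mono[of B1 "B1 \<union> B0"] A.span_mono[of B0 "B1 \<union> B0"] by blast+
    then have "f * v + (v - f * v) \<in> A.span (B1 \<union> B0)" by (rule A.span_add)
    then show "v \<in> A.span (B1 \<union> B0)" by simp
  qed
  moreover have "B1 \<union> B0 \<subseteq> block_space" using B1(1) B0(1) by auto
  ultimately have "card (B1 \<union> B0) = A.dim block_space" using indep by (metis A.basis_card_eq_dim)
  also have "A.dim block_space = card (e ` {..<D})"
    unfolding block_space_def by (rule A.dim_span_eq_card_independent, rule A.independent_mono[OF adapted_basis_independent]) (use e_in_adapted_basis in auto)
  also have "\<dots> = card {..<D}" by (rule card_image) (use e in \<open>simp add: bij_betw_def\<close>)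
  also have "\<dots> = D" by simp
  finally have "card (B1 \<union> B0) = D" .
  then obtain x where x: "bij_betw x {..<D} (B1 \<union> B0)"
    using ex_bij_betw_nat_finite[of "B1 \<union> B0"] fin by (auto simp: atLeast0LessThan)
  have xin: "x i \<in> B1 \<union> B0" if "i < D" for i using x that by (auto simp: bij_betw_def)
  then have xBS: "x i \<in> block_space" if "i < D" for i using that B1(1) B0(1) by blast
  have nz: "block_det x \<noteq> 0"
  proof (rule block_det_nonzero[OF xBS])
    fix c assume c: "(\<Sum>i<D. sA (c i) (x i)) = 0"
    define d where "d v = c (inv_into {..<D} x v)" for v
    have dx: "d (x i) = c i" if "i < D" for i
      using x that by (simp add: d_def bij_betw_def inv_into_f_f)
    have "(\<Sum>v\<in>B1 \<union> B0. sA (d v) v) = (\<Sum>i<D. sA (d (x i)) (x i))"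
      by (rule sum.reindex_bij_betw[OF x, symmetric])
    also have "\<dots> = 0" using c dx by simp
    finally have "\<forall>v\<in>B1 \<union> B0. d v = 0" by (rule ind)
    then show "\<forall>i<D. c i = 0" using xin dx by metis
  qed auto
  have upd: "block_det (x(i := f * x i)) = (if x i \<in> B1 then 1 else 0) * block_det x" if "i < D" for i
  proof (cases "x i \<in> B1")
    case True
    then have "f * x i = x i" using B1(1) by auto
    then show ?thesis using True by simp
  next
    case False
    then have "x i \<in> B0" using xin that by blast
    then have "f * x i = 0" using B0(1) by auto
    have "block_det (x(i := f * x i)) = det_fun D ((\<lambda>i j. coordinate j (x i))(i := \<lambda>j. 0))"
      unfolding block_det_def using \<open>f * x i = 0\<close> by (intro det_fun_cong) (auto simp: coordinate_zero)
    also have "\<dots> = 0" unfolding det_fun_update_row[OF that] by simp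
    finally show ?thesis using False by simp
  qed
  have "mult_trace f * block_det x = (\<Sum>i<D. block_det (x(i := f * x i)))"
    by (rule block_det_trace[symmetric]) (rule xBS)
  also have "\<dots> = (\<Sum>i<D. (if x i \<in> B1 then 1 else 0) * block_det x)"
    by (rule sum.cong) (use upd in auto)
  also have "\<dots> = (\<Sum>i<D. if x i \<in> B1 then 1 else 0) * block_det x" by (simp add: sum_distrib_right)
  also have "(\<Sum>i<D. if x i \<in> B1 then 1 else 0 :: 'f) = (\<Sum>v\<in>B1 \<union> B0. if v \<in> B1 then 1 else 0)"
    by (rule sum.reindex_bij_betw[OF x])
  also have "\<dots> = (\<Sum>v\<in>B1. 1)"
    by (rule sum.mono_neutral_cong_right) (use fin in auto)
  also have "\<dots> = of_nat (card B1)" by simp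
  finally have "mult_trace f = of_nat (card B1)" using nz by simp
  moreover have "B1 \<noteq> {}"
  proof
    assume "B1 = {}"
    then have "?V1 \<subseteq> {0}" using B1(3) by simp
    then show False using f by blast
  qed
  ultimately show ?thesis using fin by simp
qed

text \<open>The elements \<open>y\<close> that satisfy the second hypothesis form a left ideal. It is nil, since otherwise
  it would contain an idempotent \<open>f \<noteq> 0\<close>, whose trace vanishes because \<open>f = f * f\<close>. Its intersection
  with a block is contained in the radical of the block and is therefore 0.\<close>

lemma mult_trace_nondegenerate:
  assumes y: "y \<in> block_space" "\<And>z. z \<in> block_space \<Longrightarrow> mult_trace (z * y) = 0"
  shows "y = 0"
proof -
  let ?N = "{y \<in> block_space. \<forall>z\<in>block_space. mult_trace (z * y) = 0}"
  have sN: "A.subspace ?N"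
    by (rule subspace_zeros[OF block_space_subspace])
       (simp_all add: distrib_left mult_trace_add mult_trace_scale mult_trace_zero flip: A.scale_mult_right)
  have left: "a * x \<in> ?N" if "a \<in> block_space" "x \<in> ?N" for a x
    using that block_space_mult by (auto simp flip: mult.assoc)
  have nil: "\<exists>k. fd.npow x k = 0" if x: "x \<in> ?N" for x
  proof (rule ccontr)
    assume "\<nexists>k. fd.npow x k = 0"
    then obtain f where f: "f \<in> ?N" "f * f = f" "f \<noteq> 0"
      using fd.idempotent_exists[OF sN _ x] left by blast
    then have "mult_trace (f * f) = 0" by blast
    then show False using mult_trace_idempotent f by auto
  qed
  have zero: "?N \<inter> Bs i \<subseteq> {0}" if i: "i \<in> S" for i
  proof (rule nil_left_ideal_of_Bs[OF S_in[OF i]])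
    show "left_ideal_of sA (Bs i) (?N \<inter> Bs i)"
      unfolding left_ideal_of_def
    proof (intro conjI ballI)
      show "A.subspace (?N \<inter> Bs i)" by (rule A.subspace_inter[OF sN Bs_subspace[OF S_in[OF i]]])
      fix a x assume "a \<in> Bs i" "x \<in> ?N \<inter> Bs i"
      then show "a * x \<in> ?N \<inter> Bs i" using left[of a x] Bs_sub_block_space[OF i] Bs_mult[OF S_in[OF i]] by blast
    qed auto
  qed (use nil in blast)
  obtain f where f: "\<And>i. i \<in> S \<Longrightarrow> f i \<in> Bs i" "y = (\<Sum>i\<in>S. f i)" by (rule block_space_decomp[OF y(1)]) blast
  have yN: "y \<in> ?N" using y by blast
  have "f i = 0" if i: "i \<in> S" for i
  proof (rule Bs_annihilator[OF S_in[OF i] f(1)[OF i]])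
    fix b assume b: "b \<in> Bs i"
    have "b * y = b * f i" unfolding f(2) by (rule Bs_mult_sum[OF i b f(1)])
    moreover have "b * y \<in> ?N" using left[OF _ yN] Bs_sub_block_space[OF i] b by blast
    moreover have "b * f i \<in> Bs i" using Bs_mult[OF S_in[OF i] b f(1)[OF i]] .
    ultimately show "b * f i = 0" using zero[OF i] by auto
  qed
  then show ?thesis using f(2) by simp
qed

definition gram :: "nat \<Rightarrow> nat \<Rightarrow> 'f" where "gram k l = mult_trace (e k * e l)"

lemma gram_det: "det_fun D gram \<noteq> 0"
proof (rule det_fun_nonzero)
  fix v assume v: "\<And>i. i < D \<Longrightarrow> (\<Sum>j<D. gram i j * v j) = 0"
  let ?y = "\<Sum>j<D. sA (v j) (e j)"
  have ek: "mult_trace (e k * ?y) = 0" if "k < D" for k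
    using v[OF that] by (simp add: sum_distrib_left mult_trace_sum mult_trace_scale gram_def mult.commute flip: A.scale_mult_right)
  have "?y = 0"
  proof (rule mult_trace_nondegenerate[OF block_space_combination])
    fix z assume "z \<in> block_space"
    have "z * ?y = (\<Sum>k<D. sA (coordinate k z) (e k * ?y))"
      by (subst block_space_expand[OF \<open>z \<in> block_space\<close>]) (simp only: sum_distrib_right A.scale_mult_left)
    then show "mult_trace (z * ?y) = 0" by (simp only: mult_trace_sum mult_trace_scale) (simp add: ek)
  qed
  then show "\<forall>j<D. v j = 0" using coordinate_combination[of _ v] coordinate_zero by metis
qed

lemma mult_trace_gram:
  assumes "y \<in> block_space" "z \<in> block_space"
  shows "mult_trace (y * z) = (\<Sum>k<D. \<Sum>l<D. coordinate k y * gram k l * coordinate l z)"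
proof -
  have "y * z = (\<Sum>k<D. sA (coordinate k y) (e k)) * (\<Sum>l<D. sA (coordinate l z) (e l))"
    using block_space_expand[OF assms(1)] block_space_expand[OF assms(2)] by simp
  also have "\<dots> = (\<Sum>k<D. \<Sum>l<D. sA (coordinate k y) (sA (coordinate l z) (e k * e l)))"
    by (simp add: sum_product mult.commute flip: A.scale_mult_left A.scale_mult_right)
  finally show ?thesis by (simp only: mult_trace_sum mult_trace_scale gram_def) (simp add: mult_ac)
qed

end

section \<open>A determinant as a polynomial function\<close>

text \<open>The coefficient of \<open>T f\<close> is, up to transposition, the determinant formed by the columns
  \<open>f 0, \<dots>, f (n - 1)\<close> of \<open>x\<close>. It vanishes unless \<open>f\<close> is a permutation, when it is the signed determinant of \<open>x\<close>.\<close>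

lemma (in vector_space) alternating_sum_scale_det_fun:
  shows "(\<Sum>p | p permutes {..<n}. \<Sum>f \<in> {..<n} \<rightarrow>\<^sub>E {..<n}. scale (of_int (sign p) * (\<Prod>i<n. x (p i) (f i))) (T f))
     = scale (det_fun n x) (\<Sum>p | p permutes {..<n}. scale (of_int (sign p)) (T (restrict p {..<n})))"
proof -
  have D: "(\<Sum>p | p permutes {..<n}. of_int (sign p) * (\<Prod>i<n. x (p i) (f i))) = det_fun n (\<lambda>i j. x j (f i))" for f :: "nat \<Rightarrow> nat"
    by (simp add: det_fun_Leibniz)
  have Z: "det_fun n (\<lambda>i j. x j (f i)) = 0" if f: "f \<in> {..<n} \<rightarrow>\<^sub>E {..<n}" and ni: "\<not> inj_on f {..<n}" for f
  proof -
    from ni obtain i j where "i < n" "j < n" "i \<noteq> j" "f i = f j" by (auto simp: inj_on_def)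
    then show ?thesis by (intro det_fun_identical_rows[of i n j]) auto
  qed
  have P: "det_fun n (\<lambda>i j. x j (restrict p {..<n} i)) = of_int (sign p) * det_fun n x" if "p permutes {..<n}" for p
  proof -
    have "det_fun n (\<lambda>i j. x j (restrict p {..<n} i)) = det_fun n (\<lambda>i. (\<lambda>i j. x j i) (p i))"
      by (rule det_fun_cong) auto
    also have "\<dots> = of_int (sign p) * det_fun n x"
      using det_fun_permute_rows[OF that, of "\<lambda>i j. x j i"] by (simp only: det_fun_transpose[of n x])
    finally show ?thesis .
  qed
  let ?R = "(\<lambda>p. restrict p {..<n}) ` {p. p permutes {..<n}}"
  have inj: "inj_on (\<lambda>p. restrict p {..<n}) {p. p permutes {..<n}}"
  proof (rule inj_onI, rule ext)
    fix p q i assume pq: "p \<in> {p. p permutes {..<n}}" "q \<in> {p. p permutes {..<n}}" "restrict p {..<n} = restrict q {..<n}"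
    show "p i = q i"
    proof (cases "i < n")
      case True then show ?thesis using fun_cong[OF pq(3), of i] by simp
    next
      case False then show ?thesis using pq(1,2) by (simp add: permutes_not_in)
    qed
  qed
  have lt: "p i < n \<longleftrightarrow> i < n" if "p permutes {..<n}" for p i
    using permutes_in_image[OF that, of i] by simp
  have sub: "?R \<subseteq> {..<n} \<rightarrow>\<^sub>E {..<n}" by (auto simp: lt split: if_splits)
  have notR: "\<not> inj_on f {..<n}" if f: "f \<in> ({..<n} \<rightarrow>\<^sub>E {..<n}) - ?R" for f
  proof
    assume inj: "inj_on f {..<n}"
    define p where "p i = (if i < n then f i else i)" for i
    have "f ` {..<n} \<subseteq> {..<n}" using f by auto
    then have "bij_betw f {..<n} {..<n}"
      using inj by (simp add: bij_betw_def endo_inj_surj)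
    then have "bij_betw p {..<n} {..<n}" by (subst bij_betw_cong[where g = f]) (auto simp: p_def)
    then have "p permutes {..<n}" by (rule bij_imp_permutes) (simp add: p_def)
    moreover have "restrict p {..<n} = f" using f by (intro ext) (auto simp: p_def PiE_def extensional_def)
    ultimately show False using f by blast
  qed
  have "(\<Sum>p | p permutes {..<n}. \<Sum>f \<in> {..<n} \<rightarrow>\<^sub>E {..<n}. scale (of_int (sign p) * (\<Prod>i<n. x (p i) (f i))) (T f))
    = (\<Sum>f \<in> {..<n} \<rightarrow>\<^sub>E {..<n}. scale (det_fun n (\<lambda>i j. x j (f i))) (T f))"
    by (subst sum.swap, rule sum.cong) (simp_all only: D[symmetric] scale_sum_left)
  also have "\<dots> = (\<Sum>f \<in> ?R. scale (det_fun n (\<lambda>i j. x j (f i))) (T f))"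
    by (rule sum.mono_neutral_right) (use sub Z notR in \<open>auto intro!: finite_PiE\<close>)
  also have "\<dots> = (\<Sum>p | p permutes {..<n}. scale (det_fun n (\<lambda>i j. x j (restrict p {..<n} i))) (T (restrict p {..<n})))"
    by (subst sum.reindex[OF inj]) simp
  also have "\<dots> = (\<Sum>p | p permutes {..<n}. scale (of_int (sign p) * det_fun n x) (T (restrict p {..<n})))"
    by (rule sum.cong[OF refl]) (simp only: P mem_Collect_eq)
  also have "\<dots> = scale (det_fun n x) (\<Sum>p | p permutes {..<n}. scale (of_int (sign p)) (T (restrict p {..<n})))"
    by (simp add: scale_sum_right mult.commute)
  finally show ?thesis .
qed

context wedderburn_action begin

text \<open>Density prescribes the values on the basis of \<open>Bs i\<close>; the other blocks are annihilated by \<open>Bs i\<close>.\<close>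

lemma dual_operator_Bs:
  assumes i: "i \<in> {1..q}" and x: "x \<in> comp_basis i" and u: "u \<in> Bs i"
  shows "\<exists>f. block_op (Bs i) f \<and> f x = u \<and> (\<forall>y\<in>(\<Union>j\<in>{1..q}. comp_basis j) - {x}. f y = 0)"
proof -
  have iq: "i \<le> q" using i by simp
  have "\<exists>f. block_op (Bs i) f \<and> (\<forall>t\<in>comp_basis i - {x}. f t = 0) \<and> f x = u"
    by (rule dual_operator[OF Bs_simple[OF i] ac Bs_annihilator[OF i] comp_basis_finite[OF iq] comp_basis_independent[OF iq] _ x u])
       (use comp_basis_span[OF iq] component_Bs[OF i] in auto)
  then obtain f where f: "block_op (Bs i) f" "\<And>t. t \<in> comp_basis i - {x} \<Longrightarrow> f t = 0" "f x = u" by blast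
  have "f y = 0" if "j \<in> {1..q}" "y \<in> comp_basis j" "y \<noteq> x" for j y
  proof (cases "j = i")
    case True
    then show ?thesis using f(2) that by blast
  next
    case False
    have "y \<in> Bs j" using comp_basis_sub[of j] component_Bs that by auto
    show ?thesis
      by (rule block_op_kill[OF f(1)], rule Bs_orthogonal[OF i that(1) False[symmetric] _ \<open>y \<in> Bs j\<close>])
  qed
  then show ?thesis using f by blast
qed

end

context block begin

definition slots :: "nat \<Rightarrow> nat set" where "slots i = {l. l < D \<and> e l \<in> comp_basis i}"

lemma slots_cover: "l < D \<Longrightarrow> \<exists>i\<in>S. l \<in> slots i"
  using e_image by (force simp: slots_def)

lemma slots_disjoint: "i \<in> S \<Longrightarrow> j \<in> S \<Longrightarrow> i \<noteq> j \<Longrightarrow> slots i \<inter> slots j = {}"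
  using comp_basis_disjoint[OF S_le S_le] by (auto simp: slots_def)

lemma slots_finite: "finite (slots i)" by (simp add: slots_def)

lemma slots_nonempty: assumes "i \<in> S" shows "slots i \<noteq> {}"
proof
  assume "slots i = {}"
  have "comp_basis i = {}"
  proof (rule ccontr)
    assume "comp_basis i \<noteq> {}"
    then obtain x where x: "x \<in> comp_basis i" by blast
    then have "x \<in> e ` {..<D}" unfolding e_image using assms by blast
    then show False using \<open>slots i = {}\<close> x by (auto simp: slots_def)
  qed
  then have "Bs i = {0}" using comp_basis_span[OF S_le[OF assms]] component_Bs[OF S_in[OF assms]] by simp
  then show False using Bs_nonzero[OF S_in[OF assms]] by simp
qed

definition basis_at :: "nat set \<Rightarrow> (nat \<Rightarrow> 'a) \<Rightarrow> bool" where
  "basis_at X a \<longleftrightarrow> (\<forall>l\<in>X. a l \<in> e ` {..<D})"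

text \<open>On tuples of basis elements, \<open>T\<close> agrees with \<open>c\<close> times the product of the coordinate functionals
  dual to \<open>e l\<close>, for \<open>l\<close> in \<open>X\<close>.\<close>

definition detects :: "nat set \<Rightarrow> ((nat \<Rightarrow> 'a) \<Rightarrow> 'a) \<Rightarrow> 'a \<Rightarrow> bool" where
  "detects X T c \<longleftrightarrow> const_poly X T \<and> (\<forall>a. basis_at X a \<longrightarrow> T a = (if \<forall>l\<in>X. a l = e l then c else 0))"

lemma detects_mult:
  assumes "detects X T c" "detects Y U d" "X \<inter> Y = {}"
  shows "detects (X \<union> Y) (\<lambda>a. T a * U a) (c * d)"
  using assms const_poly_mult[of X T Y U] by (auto simp: detects_def basis_at_def)

lemma detects_single:
  assumes i: "i \<in> S" and l: "l \<in> slots i" and u: "u \<in> Bs i"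
  shows "\<exists>T. detects {l} T u"
proof -
  obtain f where f: "block_op (Bs i) f" "f (e l) = u" "\<And>y. y \<in> (\<Union>j\<in>{1..q}. comp_basis j) - {e l} \<Longrightarrow> f y = 0"
    using dual_operator_Bs[OF S_in[OF i] _ u, of "e l"] l by (auto simp: slots_def)
  have sub: "e ` {..<D} \<subseteq> (\<Union>j\<in>{1..q}. comp_basis j)" unfolding e_image using S by blast
  have "detects {l} (\<lambda>a. f (a l)) u"
    unfolding detects_def basis_at_def
  proof (intro conjI allI impI block_op_const_poly[OF f(1)])
    fix a assume "\<forall>k\<in>{l}. a k \<in> e ` {..<D}"
    then have "a l \<in> (\<Union>j\<in>{1..q}. comp_basis j)" using sub by blast
    then show "f (a l) = (if \<forall>k\<in>{l}. a k = e k then u else 0)" using f(2,3) by auto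
  qed
  then show ?thesis by blast
qed

text \<open>Every variable uses up one factor from the block, so \<open>c\<close> is written as a sum of products; this is
  possible by \<open>Bs_products_span\<close>.\<close>

lemma detects_list:
  assumes i: "i \<in> S"
  shows "ls \<noteq> [] \<Longrightarrow> distinct ls \<Longrightarrow> set ls \<subseteq> slots i \<Longrightarrow> c \<in> Bs i \<Longrightarrow> \<exists>T. detects (set ls) T c"
proof (induction ls arbitrary: c)
  case (Cons l ls)
  show ?case
  proof (cases "ls = []")
    case True
    then show ?thesis using detects_single[OF i, of l c] Cons.prems by simp
  next
    case False
    let ?G = "{u * v | u v. u \<in> Bs i \<and> v \<in> Bs i}"
    let ?Q = "{c. \<exists>T. detects (set (l # ls)) T c}"
    have prod: "\<exists>T. detects (set (l # ls)) T (u * v)" if uv: "u \<in> Bs i" "v \<in> Bs i" for u v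
    proof -
      obtain T where T: "detects {l} T u" using detects_single[OF i _ uv(1), of l] Cons.prems by auto
      obtain U where U: "detects (set ls) U v" using Cons.IH[OF False _ _ uv(2)] Cons.prems by auto
      show ?thesis using detects_mult[OF T U] Cons.prems by auto
    qed
    have addQ: "x + y \<in> ?Q" if xy: "x \<in> ?Q" "y \<in> ?Q" for x y
    proof -
      obtain T U where "detects (set (l # ls)) T x" "detects (set (l # ls)) U y" using xy by blast
      then have "detects (set (l # ls)) (\<lambda>a. T a + U a) (x + y)"
        unfolding detects_def by (auto intro: const_poly.add)
      then show ?thesis by blast
    qed
    have scQ: "sA d x \<in> ?Q" if x: "x \<in> ?Q" for d x
    proof -
      obtain T where "detects (set (l # ls)) T x" using x by blast
      then have "detects (set (l # ls)) (\<lambda>a. sA d (T a)) (sA d x)"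
        unfolding detects_def by (auto intro: const_poly_scale)
      then show ?thesis by blast
    qed
    have "0 \<in> Bs i" using A.subspace_0[OF Bs_subspace[OF S_in[OF i]]] .
    then have "0 * 0 \<in> ?Q" using prod by blast
    then have "A.subspace ?Q" using addQ scQ by (intro A.subspaceI) auto
    moreover have "?G \<subseteq> ?Q" using prod by blast
    ultimately have "A.span ?G \<subseteq> ?Q" by (intro A.span_minimal)
    then show ?thesis using Bs_products_span[OF S_in[OF i]] Cons.prems(4) by blast
  qed
qed simp

lemma detects_block:
  assumes i: "i \<in> S" and c: "c \<in> Bs i"
  shows "\<exists>T. detects (slots i) T c"
proof -
  obtain ls where ls: "set ls = slots i" "distinct ls" using finite_distinct_list[OF slots_finite] by blast
  then have "ls \<noteq> []" using slots_nonempty[OF i] by auto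
  then show ?thesis using detects_list[OF i _ ls(2) _ c] ls(1) by auto
qed

lemma detects_const: "detects {} (\<lambda>_. c) c"
  by (simp add: detects_def const_poly_const)

lemma detects_factor:
  assumes "S' \<subseteq> {i}" "S' \<subseteq> S" "c \<in> component i"
  shows "\<exists>T. detects (\<Union>j\<in>S'. slots j) T c"
proof (cases "S' = {}")
  case True
  then show ?thesis using detects_const by auto
next
  case False
  then have "S' = {i}" "i \<in> S" using assms by auto
  then show ?thesis using detects_block[of i c] assms(3) component_Bs[OF S_in, of i] by auto
qed

text \<open>For each block in \<open>S'\<close>, one factor of the product that belongs to it is replaced by a polynomial
  in the variables of this block.\<close>

lemma detects_product:
  assumes "ps \<noteq> []" "\<forall>(i, c)\<in>set ps. c \<in> component i" "S' \<subseteq> S" "S' \<subseteq> fst ` set ps"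
  shows "\<exists>T. detects (\<Union>j\<in>S'. slots j) T (nprod (map snd ps))"
  using assms
proof (induction ps arbitrary: S')
  case (Cons p ps)
  obtain i c where p: "p = (i, c)" by force
  show ?case
  proof (cases "ps = []")
    case True
    then show ?thesis using detects_factor[of S' i c] Cons.prems p by auto
  next
    case False
    let ?S1 = "S' \<inter> {i}" and ?S2 = "S' - {i}"
    obtain T where T: "detects (\<Union>j\<in>?S1. slots j) T c"
      using detects_factor[of ?S1 i c] Cons.prems p by auto
    obtain U where U: "detects (\<Union>j\<in>?S2. slots j) U (nprod (map snd ps))"
      using Cons.IH[OF False, of ?S2] Cons.prems p by auto
    have "(\<Union>j\<in>?S1. slots j) \<inter> (\<Union>j\<in>?S2. slots j) = {}"
      using slots_disjoint Cons.prems(3) by blast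
    from detects_mult[OF T U this]
    have "detects ((\<Union>j\<in>?S1. slots j) \<union> (\<Union>j\<in>?S2. slots j)) (\<lambda>a. T a * U a) (nprod (map snd (p # ps)))"
      using False by (simp add: p nprod_Cons)
    moreover have "(\<Union>j\<in>?S1. slots j) \<union> (\<Union>j\<in>?S2. slots j) = (\<Union>j\<in>S'. slots j)" by blast
    ultimately show ?thesis by metis
  qed
qed simp

definition alt_value :: "((nat \<Rightarrow> 'a) \<Rightarrow> 'a) \<Rightarrow> (nat \<Rightarrow> 'a) \<Rightarrow> 'a" where
  "alt_value F \<kappa> = (\<Sum>p | p permutes {..<D}. sA (of_int (sign p)) (F (\<lambda>i. if i < D then e (p i) else \<kappa> i)))"

text \<open>Only the identity permutation puts every basis element in its own place.\<close>

lemma alt_value_detects: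
  assumes "detects {..<D} T c"
  shows "alt_value T \<kappa> = c"
proof -
  have "alt_value T \<kappa> = (\<Sum>p\<in>{id}. sA (of_int (sign p)) (T (\<lambda>i. if i < D then e (p i) else \<kappa> i)))"
    unfolding alt_value_def
  proof (rule sum.mono_neutral_right)
    show "finite {p. p permutes {..<D}}" by (simp add: finite_permutations)
    show "{id} \<subseteq> {p. p permutes {..<D}}" by (simp add: permutes_id)
    show "\<forall>p\<in>{p. p permutes {..<D}} - {id}. sA (of_int (sign p)) (T (\<lambda>i. if i < D then e (p i) else \<kappa> i)) = 0"
    proof
      fix p assume "p \<in> {p. p permutes {..<D}} - {id}"
      then have p: "p permutes {..<D}" "p \<noteq> id" by auto
      have lt: "p i < D" if "i < D" for i using permutes_in_image[OF p(1), of i] that by simp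
      have "\<exists>l<D. e (p l) \<noteq> e l"
      proof (rule ccontr)
        assume no: "\<not> (\<exists>l<D. e (p l) \<noteq> e l)"
        have "p l = l" for l
        proof (cases "l < D")
          case True
          then show ?thesis using no e_inj[OF lt[OF True] True] by blast
        next
          case False
          then show ?thesis using p(1) by (simp add: permutes_not_in)
        qed
        then show False using p(2) by auto
      qed
      moreover have "basis_at {..<D} (\<lambda>i. if i < D then e (p i) else \<kappa> i)"
        unfolding basis_at_def using lt by auto
      ultimately have "T (\<lambda>i. if i < D then e (p i) else \<kappa> i) = 0"
        using assms unfolding detects_def by (auto simp: basis_at_def)
      then show "sA (of_int (sign p)) (T (\<lambda>i. if i < D then e (p i) else \<kappa> i)) = 0" by simp
    qed
  qed
  also have "\<dots> = T (\<lambda>i. if i < D then e i else \<kappa> i)" by (simp add: sign_id cong: if_cong)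
  also have "\<dots> = c" using assms unfolding detects_def basis_at_def by auto
  finally show ?thesis .
qed

lemma multilin_slots_expand:
  assumes F: "multilin I F" and b: "\<And>i. i < D \<Longrightarrow> b i = (\<Sum>j<D. sA (x i j) (e j))" and "m \<le> D" "{..<m} \<subseteq> I"
  shows "F b = (\<Sum>f\<in>{..<m} \<rightarrow>\<^sub>E {..<D}. sA (\<Prod>i<m. x i (f i)) (F (\<lambda>i. if i < m then e (f i) else b i)))"
  using assms(3,4)
proof (induction m)
  case (Suc m)
  have P: "{..<Suc m} \<rightarrow>\<^sub>E {..<D} = (\<lambda>(j, f). f(m := j)) ` ({..<D} \<times> ({..<m} \<rightarrow>\<^sub>E {..<D}))"
    by (simp add: lessThan_Suc PiE_insert_eq)
  have inj: "inj_on (\<lambda>(j, f). f(m := j)) ({..<D} \<times> ({..<m} \<rightarrow>\<^sub>E {..<D}))"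
    by (rule inj_combinator) simp
  have step: "F (\<lambda>i. if i < m then e (f i) else b i)
      = (\<Sum>j<D. sA (x m j) (F (\<lambda>i. if i < Suc m then e ((f(m := j)) i) else b i)))" for f
  proof -
    let ?a = "\<lambda>i. if i < m then e (f i) else b i"
    have "F ?a = F (?a(m := \<Sum>j<D. sA (x m j) (e j)))" using b[of m] Suc.prems by (simp add: fun_upd_idem)
    also have "\<dots> = (\<Sum>j<D. sA (x m j) (F (?a(m := e j))))"
      by (rule multilin_slot_sum[OF F]) (use Suc.prems in auto)
    also have "\<dots> = (\<Sum>j<D. sA (x m j) (F (\<lambda>i. if i < Suc m then e ((f(m := j)) i) else b i)))"
      by (intro sum.cong refl arg_cong2[where f = sA] arg_cong[where f = F]) (auto simp: less_Suc_eq)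
    finally show ?thesis .
  qed
  have "F b = (\<Sum>f\<in>{..<m} \<rightarrow>\<^sub>E {..<D}. sA (\<Prod>i<m. x i (f i)) (F (\<lambda>i. if i < m then e (f i) else b i)))"
    by (rule Suc.IH) (use Suc.prems in auto)
  also have "\<dots> = (\<Sum>f\<in>{..<m} \<rightarrow>\<^sub>E {..<D}. \<Sum>j<D. sA (\<Prod>i<Suc m. x i ((f(m := j)) i)) (F (\<lambda>i. if i < Suc m then e ((f(m := j)) i) else b i)))"
    unfolding step A.scale_sum_right by (intro sum.cong refl) simp
  also have "\<dots> = (\<Sum>j<D. \<Sum>f\<in>{..<m} \<rightarrow>\<^sub>E {..<D}. sA (\<Prod>i<Suc m. x i ((f(m := j)) i)) (F (\<lambda>i. if i < Suc m then e ((f(m := j)) i) else b i)))"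
    by (rule sum.swap)
  also have "\<dots> = (\<Sum>(j, f)\<in>{..<D} \<times> ({..<m} \<rightarrow>\<^sub>E {..<D}). sA (\<Prod>i<Suc m. x i ((f(m := j)) i)) (F (\<lambda>i. if i < Suc m then e ((f(m := j)) i) else b i)))"
    by (rule sum.cartesian_product)
  also have "\<dots> = (\<Sum>f\<in>{..<Suc m} \<rightarrow>\<^sub>E {..<D}. sA (\<Prod>i<Suc m. x i (f i)) (F (\<lambda>i. if i < Suc m then e (f i) else b i)))"
    unfolding P by (subst sum.reindex[OF inj]) (simp add: case_prod_unfold del: prod.lessThan_Suc)
  finally show ?case .
qed simp

text \<open>An alternating multilinear function of \<open>D\<close> vectors of a space of dimension \<open>D\<close> is a multiple of
  the determinant.\<close>

lemma antisymmetrize: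
  assumes F: "multilin {..<D + c} F"
  shows "\<exists>G. multilin {..<D + c} G \<and> (\<forall>a. (\<forall>i<D. a i \<in> block_space) \<longrightarrow> G a = sA (block_det a) (alt_value F a))"
proof (intro exI conjI allI impI)
  let ?G = "\<lambda>a. \<Sum>p | p permutes {..<D}. sA (of_int (sign p)) (F (\<lambda>i. a (p i)))"
  have img: "p ` {..<D + c} = {..<D + c}" if "p permutes {..<D}" for p
    by (rule permutes_image[OF permutes_subset[OF that]]) auto
  have ren: "multilin {..<D + c} (\<lambda>a. F (\<lambda>i. a (p i)))" if "p permutes {..<D}" for p
    using multilin_rename[OF F, of p] permutes_inj_on[OF that] img[OF that] by auto
  show "multilin {..<D + c} ?G"
    by (rule multilin_sum[OF F]) (auto intro: multilin.scale ren)
  fix a :: "nat \<Rightarrow> 'a" assume a: "\<forall>i<D. a i \<in> block_space"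
  have lt: "p i < D" if "p permutes {..<D}" "i < D" for p i using permutes_in_image[OF that(1), of i] that(2) by simp
  have expand: "F (\<lambda>i. a (p i)) = (\<Sum>f\<in>{..<D} \<rightarrow>\<^sub>E {..<D}. sA (\<Prod>i<D. coordinate (f i) (a (p i))) (F (\<lambda>i. if i < D then e (f i) else a i)))"
    if p: "p permutes {..<D}" for p
  proof -
    have "F (\<lambda>i. a (p i)) = (\<Sum>f\<in>{..<D} \<rightarrow>\<^sub>E {..<D}. sA (\<Prod>i<D. coordinate (f i) (a (p i))) (F (\<lambda>i. if i < D then e (f i) else a (p i))))"
    proof (rule multilin_slots_expand[OF F])
      show "a (p i) = (\<Sum>j<D. sA (coordinate j (a (p i))) (e j))" if "i < D" for i
        by (rule block_space_expand) (use a lt[OF p that] in auto)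
    qed auto
    also have "\<dots> = (\<Sum>f\<in>{..<D} \<rightarrow>\<^sub>E {..<D}. sA (\<Prod>i<D. coordinate (f i) (a (p i))) (F (\<lambda>i. if i < D then e (f i) else a i)))"
    proof -
      have "(\<lambda>i. if i < D then e (f i) else a (p i)) = (\<lambda>i. if i < D then e (f i) else a i)" for f
        using permutes_not_in[OF p] by (auto simp: fun_eq_iff)
      then show ?thesis by (simp only:)
    qed
    finally show ?thesis .
  qed
  have "?G a = (\<Sum>p | p permutes {..<D}. \<Sum>f\<in>{..<D} \<rightarrow>\<^sub>E {..<D}. sA (of_int (sign p) * (\<Prod>i<D. coordinate (f i) (a (p i)))) (F (\<lambda>i. if i < D then e (f i) else a i)))"
  proof (rule sum.cong[OF refl])
    fix p assume "p \<in> {p. p permutes {..<D}}"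
    then have p: "p permutes {..<D}" by simp
    show "sA (of_int (sign p)) (F (\<lambda>i. a (p i))) = (\<Sum>f\<in>{..<D} \<rightarrow>\<^sub>E {..<D}. sA (of_int (sign p) * (\<Prod>i<D. coordinate (f i) (a (p i)))) (F (\<lambda>i. if i < D then e (f i) else a i)))"
      by (subst expand[OF p]) (simp add: A.scale_sum_right)
  qed
  also have "\<dots> = sA (det_fun D (\<lambda>i j. coordinate j (a i))) (\<Sum>p | p permutes {..<D}. sA (of_int (sign p)) (F (\<lambda>i. if i < D then e (restrict p {..<D} i) else a i)))"
    by (rule A.alternating_sum_scale_det_fun[where n = D and x = "\<lambda>i j. coordinate j (a i)" and T = "\<lambda>f. F (\<lambda>i. if i < D then e (f i) else a i)"])
  also have "\<dots> = sA (block_det a) (alt_value F a)"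
  proof -
    have "(\<lambda>i. if i < D then e (restrict p {..<D} i) else a i) = (\<lambda>i. if i < D then e (p i) else a i)" for p
      by (auto simp: fun_eq_iff)
    then show ?thesis by (simp only: block_det_def alt_value_def)
  qed
  finally show "?G a = sA (block_det a) (alt_value F a)" .
qed

text \<open>The last \<open>c\<close> variables are fixed at \<open>\<kappa>\<close>. It matters that \<open>c\<close> stays fixed while the number of
  variables grows.\<close>

definition seed :: "nat \<Rightarrow> (nat \<Rightarrow> 'a) \<Rightarrow> 'a \<Rightarrow> bool" where
  "seed c \<kappa> z \<longleftrightarrow> z \<noteq> 0 \<and> (\<exists>G. multilin {..<D + c} G \<and>
     (\<forall>a. (\<forall>i<D. a i \<in> block_space) \<longrightarrow> (\<forall>j. D \<le> j \<longrightarrow> j < D + c \<longrightarrow> a j = \<kappa> j) \<longrightarrow> G a = sA (block_det a) z))"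

text \<open>By \<open>detects_product\<close> there is a polynomial with constants whose alternating sum is the given
  nonzero product. Some summand, with one assignment of its constants, also has a nonzero
  alternating sum. Its constants are moved to the variables from \<open>D\<close> on, and the summand is
  antisymmetrized.\<close>

lemma seed_exists:
  assumes ps: "ps \<noteq> []" "\<forall>(i, c)\<in>set ps. c \<in> component i" "S \<subseteq> fst ` set ps" "nprod (map snd ps) \<noteq> 0"
  shows "\<exists>c \<kappa> z. seed c \<kappa> z"
proof -
  have "(\<Union>j\<in>S. slots j) = {..<D}" using slots_cover by (auto simp: slots_def)
  then obtain T where T: "detects {..<D} T (nprod (map snd ps))"
    using detects_product[OF ps(1,2) _ ps(3)] by auto
  let ?\<Phi> = "\<lambda>G. alt_value G (\<lambda>_. 0)"
  have "?\<Phi> T \<noteq> 0" using alt_value_detects[OF T] ps(4) by simp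
  moreover have "const_poly {..<D} T" using T by (simp add: detects_def)
  moreover have "?\<Phi> (\<lambda>_. 0) = 0" by (simp add: alt_value_def)
  moreover have "?\<Phi> (\<lambda>a. F a + G a) = ?\<Phi> F + ?\<Phi> G" for F G
    by (simp add: alt_value_def A.scale_right_distrib sum.distrib)
  ultimately obtain G where G: "const_mono {..<D} G" "?\<Phi> G \<noteq> 0"
    using const_poly_extract[of "{..<D}" T ?\<Phi>] by metis
  then obtain K \<kappa> F where F: "finite K" "K \<inter> {..<D} = {}" "multilin ({..<D} \<union> K) F"
      "\<And>a. (\<forall>k\<in>K. a k = \<kappa> k) \<Longrightarrow> F a = G a"
    unfolding const_mono_def using finite.emptyI by (metis sup_bot.right_neutral)
  have Gdep: "G a = G b" if "\<And>i. i < D \<Longrightarrow> a i = b i" for a b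
    using G(1) that unfolding const_mono_def by auto
  let ?c = "card K"
  have "card K = card {D..<D + ?c}" by simp
  then obtain h where h: "bij_betw h K {D..<D + ?c}" using F(1) finite_same_card_bij by blast
  \<comment> \<open>moves the constants to the variables \<open>D, \<dots>, D + c - 1\<close> and keeps the determinant arguments\<close>
  define r where "r i = (if i < D then i else h i)" for i
  have hK: "h k \<in> {D..<D + ?c}" if "k \<in> K" for k using h that by (auto simp: bij_betw_def)
  have rK: "r k = h k" if "k \<in> K" for k using that F(2) by (auto simp: r_def)
  have "r ` {..<D} = {..<D}" by (auto simp: r_def)
  moreover have "r ` K = {D..<D + ?c}" using h rK by (auto simp: bij_betw_def)
  ultimately have img: "r ` ({..<D} \<union> K) = {..<D + ?c}" by (auto simp: image_Un)
  have inj: "inj_on r ({..<D} \<union> K)"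
  proof (rule inj_onI)
    fix x y assume xy: "x \<in> {..<D} \<union> K" "y \<in> {..<D} \<union> K" "r x = r y"
    have A: "r x < D \<longleftrightarrow> x < D" if "x \<in> {..<D} \<union> K" for x
    proof (cases "x < D")
      case False
      then have "x \<in> K" using that by auto
      then show ?thesis using hK[of x] rK[of x] False by simp
    qed (simp add: r_def)
    show "x = y"
    proof (cases "x < D")
      case True
      then have "y < D" using A xy by metis
      then show ?thesis using True xy(3) by (simp add: r_def)
    next
      case False
      then have "\<not> y < D" using A xy by metis
      with False have xK: "x \<in> K" "y \<in> K" using xy by auto
      then have "h x = h y" using xy(3) rK by simp
      then show ?thesis using h xK unfolding bij_betw_def by (blast dest: inj_onD)
    qed
  qed
  have F': "multilin {..<D + ?c} (\<lambda>a. F (\<lambda>i. a (r i)))" using multilin_rename[OF F(3) inj] img by simp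
  obtain G' where G': "multilin {..<D + ?c} G'" "\<And>a. (\<forall>i<D. a i \<in> block_space) \<Longrightarrow> G' a = sA (block_det a) (alt_value (\<lambda>a. F (\<lambda>i. a (r i))) a)"
    using antisymmetrize[OF F'] by blast
  define \<kappa>' where "\<kappa>' j = \<kappa> (inv_into K h j)" for j
  have "alt_value (\<lambda>a. F (\<lambda>i. a (r i))) a = ?\<Phi> G" if a: "\<forall>j. D \<le> j \<longrightarrow> j < D + ?c \<longrightarrow> a j = \<kappa>' j" for a
    unfolding alt_value_def
  proof (intro sum.cong refl arg_cong2[where f = sA])
    fix p
    let ?a = "\<lambda>i. if i < D then e (p i) else a i"
    have "F (\<lambda>i. ?a (r i)) = G (\<lambda>i. ?a (r i))"
    proof (rule F(4), rule ballI)
      fix k assume k: "k \<in> K"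
      have "?a (r k) = a (h k)" using hK[OF k] rK[OF k] by auto
      also have "\<dots> = \<kappa>' (h k)" using a hK[OF k] by auto
      also have "\<dots> = \<kappa> k" using h k by (simp add: \<kappa>'_def bij_betw_def inv_into_f_f)
      finally show "?a (r k) = \<kappa> k" .
    qed
    also have "\<dots> = G (\<lambda>i. if i < D then e (p i) else 0)" by (rule Gdep) (simp add: r_def)
    finally show "F (\<lambda>i. ?a (r i)) = G (\<lambda>i. if i < D then e (p i) else 0)" .
  qed
  then have "seed ?c \<kappa>' (?\<Phi> G)" unfolding seed_def using G' G(2) by auto
  then show ?thesis by blast
qed

lemma trace_step:
  assumes G: "multilin I G" "{..<D} \<subseteq> I" and W: "multilin Y W" "Y \<inter> I = {}" and D: "D > 0"
  shows "multilin (I \<union> Y) (\<lambda>a. \<Sum>i<D. G (a(i := W a * a i)))"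
proof -
  have "multilin (I \<union> Y) (\<lambda>a. G (a(i := W a * a i)))" if i: "i < D" for i
  proof -
    have iI: "i \<in> I" using i G(2) by auto
    then have "multilin (Y \<union> {i}) (\<lambda>a. W a * act 1 (a i))" using W by (intro multilin.mult multilin.var) auto
    then have "multilin (I - {i} \<union> (Y \<union> {i})) (\<lambda>a. G (a(i := W a * act 1 (a i))))"
      by (rule multilin_subst[OF G(1) iI]) (use W(2) in auto)
    moreover have "I - {i} \<union> (Y \<union> {i}) = I \<union> Y" using iI by auto
    ultimately show ?thesis by (simp add: act_one)
  qed
  then show ?thesis using D by (intro multilin_sum[of _ "\<lambda>a. G (a(0 := W a * a 0))"]) auto
qed

text \<open>A further variable, fixed at an element \<open>b\<close> of nonzero trace, is absorbed by a trace. This adjusts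
  the number of variables modulo \<open>2 * D\<close>.\<close>

lemma seed_pad:
  assumes D: "D > 0" and s: "seed c \<kappa> z"
  shows "\<exists>\<kappa>' z'. seed (Suc c) \<kappa>' z'"
proof -
  obtain G where z: "z \<noteq> 0" and G: "multilin {..<D + c} G"
    "\<And>a. (\<forall>i<D. a i \<in> block_space) \<Longrightarrow> (\<forall>j. D \<le> j \<longrightarrow> j < D + c \<longrightarrow> a j = \<kappa> j) \<Longrightarrow> G a = sA (block_det a) z"
    using s unfolding seed_def by blast
  obtain b where b: "b \<in> block_space" "mult_trace b \<noteq> 0"
  proof -
    have "e 0 \<noteq> 0" using e_in_adapted_basis[OF D] adapted_basis_independent A.dependent_zero by metis
    then obtain w where "w \<in> block_space" "mult_trace (w * e 0) \<noteq> 0" using mult_trace_nondegenerate[OF e_in_block_space[OF D]] by blast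
    then show ?thesis using that block_space_mult e_in_block_space[OF D] by blast
  qed
  let ?m = "D + c"
  let ?G = "\<lambda>a. \<Sum>i<D. G (a(i := act 1 (a ?m) * a i))"
  have "multilin ({..<?m} \<union> {?m}) ?G"
    by (rule trace_step[OF G(1) _ multilin.var _ D]) auto
  then have "multilin {..<D + Suc c} ?G" by (simp add: lessThan_Suc Un_commute)
  moreover have "?G a = sA (block_det a) (sA (mult_trace b) z)"
    if a: "\<forall>i<D. a i \<in> block_space" "\<forall>j. D \<le> j \<longrightarrow> j < D + Suc c \<longrightarrow> a j = (\<kappa>(?m := b)) j" for a
  proof -
    have am: "a ?m = b" using a(2) by simp
    have "G (a(i := b * a i)) = sA (block_det (a(i := b * a i))) z" if "i < D" for i
      by (rule G(2)) (use a that block_space_mult b(1) in auto)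
    then have "?G a = (\<Sum>i<D. sA (block_det (a(i := b * a i))) z)" by (simp add: act_one am)
    also have "\<dots> = sA (mult_trace b * block_det a) z"
      using block_det_trace[of a b] a(1) by (simp flip: A.scale_sum_left)
    finally show ?thesis by (simp add: mult.commute)
  qed
  moreover have "sA (mult_trace b) z \<noteq> 0" using b z by simp
  ultimately have "seed (Suc c) (\<kappa>(?m := b)) (sA (mult_trace b) z)" unfolding seed_def by blast
  then show ?thesis by blast
qed

lemma seed_pads:
  assumes "D > 0" "seed c \<kappa> z"
  shows "\<exists>\<kappa>' z'. seed (c + r) \<kappa>' z'"
proof (induction r)
  case 0
  then show ?case using assms(2) by auto
next
  case (Suc r)
  then show ?case using seed_pad[OF assms(1)] by auto
qed

end

section \<open>Products of determinants\<close>

context block begin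

definition in_domain :: "nat \<Rightarrow> (nat \<Rightarrow> 'a) \<Rightarrow> nat set \<Rightarrow> (nat \<Rightarrow> 'a) \<Rightarrow> bool" where
  "in_domain c \<kappa> I a \<longleftrightarrow> (\<forall>i<D. a i \<in> block_space) \<and> (\<forall>j. D \<le> j \<longrightarrow> j < D + c \<longrightarrow> a j = \<kappa> j) \<and> (\<forall>j\<in>I. a j \<in> block_space)"

text \<open>The seed is multiplied by the scalar function \<open>Q\<close> of further variables \<open>I\<close> with values in the
  block space. The function \<open>Q\<close> has to ignore the determinant arguments, because these are multiplied
  by block elements when another factor is adjoined.\<close>

definition realized :: "nat \<Rightarrow> (nat \<Rightarrow> 'a) \<Rightarrow> 'a \<Rightarrow> nat set \<Rightarrow> ((nat \<Rightarrow> 'a) \<Rightarrow> 'f) \<Rightarrow> bool" where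
  "realized c \<kappa> z I Q \<longleftrightarrow> I \<inter> {..<D + c} = {} \<and> (\<forall>a i x. i < D \<longrightarrow> Q (a(i := x)) = Q a) \<and>
     (\<exists>G. multilin ({..<D + c} \<union> I) G \<and> (\<forall>a. in_domain c \<kappa> I a \<longrightarrow> G a = sA (Q a * block_det a) z))"

lemma realized_start: "seed c \<kappa> z \<Longrightarrow> realized c \<kappa> z {} (\<lambda>_. 1)"
  unfolding seed_def realized_def in_domain_def by auto

lemma realized_pair:
  assumes realized: "realized c \<kappa> z I Q" and D: "D > 0" and uv: "u \<notin> I" "v \<notin> I" "u \<noteq> v" "D + c \<le> u" "D + c \<le> v"
  shows "realized c \<kappa> z (I \<union> {u, v}) (\<lambda>a. Q a * mult_trace (a u * a v))"
proof -
  obtain G where I: "I \<inter> {..<D + c} = {}" and Q: "\<And>a i x. i < D \<Longrightarrow> Q (a(i := x)) = Q a"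
    and G: "multilin ({..<D + c} \<union> I) G" "\<And>a. in_domain c \<kappa> I a \<Longrightarrow> G a = sA (Q a * block_det a) z"
    using realized unfolding realized_def by blast
  let ?W = "\<lambda>a. act 1 (a u) * act 1 (a v)"
  let ?G = "\<lambda>a. \<Sum>i<D. G (a(i := ?W a * a i))"
  have "multilin ({u} \<union> {v}) ?W" using uv by (intro multilin.mult multilin.var) auto
  then have "multilin (({..<D + c} \<union> I) \<union> ({u} \<union> {v})) ?G"
    using uv D by (intro trace_step[OF G(1)]) auto
  moreover have "({..<D + c} \<union> I) \<union> ({u} \<union> {v}) = {..<D + c} \<union> (I \<union> {u, v})" by auto
  ultimately have hp: "multilin ({..<D + c} \<union> (I \<union> {u, v})) ?G" by simp
  have val: "?G a = sA (Q a * mult_trace (a u * a v) * block_det a) z" if a: "in_domain c \<kappa> (I \<union> {u, v}) a" for a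
  proof -
    let ?b = "a u * a v"
    have b: "?b \<in> block_space" using a unfolding in_domain_def by (intro block_space_mult) auto
    have aBS: "a i \<in> block_space" if "i < D" for i using a that unfolding in_domain_def by auto
    have "G (a(i := ?b * a i)) = sA (Q a * block_det (a(i := ?b * a i))) z" if i: "i < D" for i
    proof -
      have "in_domain c \<kappa> I (a(i := ?b * a i))"
        using a block_space_mult[OF b aBS[OF i]] i I unfolding in_domain_def by auto
      then show ?thesis using G(2) Q[OF i] by simp
    qed
    then have "?G a = (\<Sum>i<D. sA (Q a * block_det (a(i := ?b * a i))) z)" by (simp add: act_one)
    also have "\<dots> = sA (Q a * (\<Sum>i<D. block_det (a(i := ?b * a i)))) z"
      by (simp only: A.scale_sum_left[symmetric] sum_distrib_left)
    also have "(\<Sum>i<D. block_det (a(i := ?b * a i))) = mult_trace ?b * block_det a"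
      by (rule block_det_trace) (rule aBS)
    finally show ?thesis by (simp only: mult.assoc)
  qed
  show ?thesis unfolding realized_def
  proof (intro conjI allI impI exI[of _ ?G] hp val)
    show "(I \<union> {u, v}) \<inter> {..<D + c} = {}" using I uv by auto
    show "Q (a(i := x)) * mult_trace ((a(i := x)) u * (a(i := x)) v) = Q a * mult_trace (a u * a v)" if "i < D" for a i x
      using Q[OF that] that uv by simp
  qed
qed

lemma realized_pairs:
  fixes m :: nat
  assumes realized: "realized c \<kappa> z I Q" and D: "D > 0"
    and inj: "inj_on ys {..<m}" "inj_on zs {..<m}" "ys ` {..<m} \<inter> zs ` {..<m} = {}"
    and new: "\<And>i. i < m \<Longrightarrow> ys i \<notin> I \<and> D + c \<le> ys i" "\<And>i. i < m \<Longrightarrow> zs i \<notin> I \<and> D + c \<le> zs i"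
  shows "realized c \<kappa> z (I \<union> ys ` {..<m} \<union> zs ` {..<m}) (\<lambda>a. Q a * (\<Prod>i<m. mult_trace (a (ys i) * a (zs i))))"
  using inj new
proof (induction m)
  case 0
  then show ?case using realized by simp
next
  case (Suc m)
  have IH: "realized c \<kappa> z (I \<union> ys ` {..<m} \<union> zs ` {..<m}) (\<lambda>a. Q a * (\<Prod>i<m. mult_trace (a (ys i) * a (zs i))))"
  proof (rule Suc.IH)
    show "inj_on ys {..<m}" by (rule inj_on_subset[OF Suc.prems(1)]) auto
    show "inj_on zs {..<m}" by (rule inj_on_subset[OF Suc.prems(2)]) auto
    show "ys ` {..<m} \<inter> zs ` {..<m} = {}" using Suc.prems(3) by (auto simp: lessThan_Suc)
  qed (use Suc.prems(4,5) in auto)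
  have "ys m \<notin> ys ` {..<m}" "zs m \<notin> zs ` {..<m}"
    using inj_on_image_mem_iff[OF Suc.prems(1), of m "{..<m}"] inj_on_image_mem_iff[OF Suc.prems(2), of m "{..<m}"]
    by auto
  moreover have "ys m \<notin> zs ` {..<Suc m}" "zs m \<notin> ys ` {..<Suc m}"
    using Suc.prems(3) by auto
  ultimately have "realized c \<kappa> z (I \<union> ys ` {..<m} \<union> zs ` {..<m} \<union> {ys m, zs m})
      (\<lambda>a. Q a * (\<Prod>i<m. mult_trace (a (ys i) * a (zs i))) * mult_trace (a (ys m) * a (zs m)))"
    using Suc.prems(4,5)[of m] by (intro realized_pair[OF IH D]) auto
  moreover have "I \<union> ys ` {..<m} \<union> zs ` {..<m} \<union> {ys m, zs m} = I \<union> ys ` {..<Suc m} \<union> zs ` {..<Suc m}"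
    by (auto simp: lessThan_Suc)
  ultimately show ?case by (simp add: mult.assoc)
qed

text \<open>By \<open>realized_pairs\<close>, the product of the values of the trace form is realized for each matching of
  the variables \<open>ys\<close> with the variables \<open>zs\<close>. By \<open>det_fun_Gram\<close>, their alternating sum is the product
  of the two determinants and the nonzero Gram determinant.\<close>

lemma realized_columns:
  assumes realized: "realized c \<kappa> z I Q" and D: "D > 0"
    and inj: "inj_on ys {..<D}" "inj_on zs {..<D}" "ys ` {..<D} \<inter> zs ` {..<D} = {}"
    and new: "\<And>i. i < D \<Longrightarrow> ys i \<notin> I \<and> D + c \<le> ys i" "\<And>i. i < D \<Longrightarrow> zs i \<notin> I \<and> D + c \<le> zs i"
  shows "realized c \<kappa> z (I \<union> ys ` {..<D} \<union> zs ` {..<D}) (\<lambda>a. Q a * (block_det (\<lambda>i. a (ys i)) * block_det (\<lambda>i. a (zs i))))"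
proof -
  let ?I = "I \<union> ys ` {..<D} \<union> zs ` {..<D}"
  let ?P = "{p. p permutes {..<D}}"
  let ?R = "\<lambda>p a. Q a * (\<Prod>i<D. mult_trace (a (ys i) * a (zs (p i))))"
  have "realized c \<kappa> z ?I (?R p)" if p: "p permutes {..<D}" for p
  proof -
    have img: "(\<lambda>i. zs (p i)) ` {..<D} = zs ` {..<D}"
      using permutes_image[OF p] by (metis image_image)
    have lt: "p i < D" if "i < D" for i using permutes_in_image[OF p, of i] that by simp
    have "inj_on (\<lambda>i. zs (p i)) {..<D}"
      using comp_inj_on[of p "{..<D}" zs] permutes_inj_on[OF p] permutes_image[OF p] inj(2) by (simp add: o_def)
    from realized_pairs[OF realized D inj(1) this] show ?thesis
      using inj(3) new lt unfolding img by blast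
  qed
  then have "\<forall>p\<in>?P. \<exists>G. multilin ({..<D + c} \<union> ?I) G \<and> (\<forall>a. in_domain c \<kappa> ?I a \<longrightarrow> G a = sA (?R p a * block_det a) z)"
    unfolding realized_def by blast
  from bchoice[OF this] obtain G where "\<forall>p\<in>?P. multilin ({..<D + c} \<union> ?I) (G p) \<and> (\<forall>a. in_domain c \<kappa> ?I a \<longrightarrow> G p a = sA (?R p a * block_det a) z)"
    by (elim exE)
  then have G: "\<And>p. p \<in> ?P \<Longrightarrow> multilin ({..<D + c} \<union> ?I) (G p)"
      "\<And>p a. p \<in> ?P \<Longrightarrow> in_domain c \<kappa> ?I a \<Longrightarrow> G p a = sA (?R p a * block_det a) z"
    by blast+
  let ?G = "\<lambda>a. \<Sum>p\<in>?P. sA (of_int (sign p) / det_fun D gram) (G p a)"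
  have "id \<in> ?P" by (simp add: permutes_id)
  then have hp: "multilin ({..<D + c} \<union> ?I) ?G" by (intro multilin_sum[OF G(1)] multilin.scale G(1))
  have val: "?G a = sA (Q a * (block_det (\<lambda>i. a (ys i)) * block_det (\<lambda>i. a (zs i))) * block_det a) z" if a: "in_domain c \<kappa> ?I a" for a
  proof -
    have y: "a (ys i) \<in> block_space" "a (zs i) \<in> block_space" if "i < D" for i using a that unfolding in_domain_def by auto
    have lt: "p i < D" if "p \<in> ?P" "i < D" for p i using permutes_in_image[of p "{..<D}" i] that by simp
    have "?G a = (\<Sum>p\<in>?P. sA (of_int (sign p) / det_fun D gram) (sA (?R p a * block_det a) z))"
      by (rule sum.cong) (use G(2) a in auto)
    also have "\<dots> = (\<Sum>p\<in>?P. sA (Q a * block_det a / det_fun D gram * (of_int (sign p) * (\<Prod>i<D. mult_trace (a (ys i) * a (zs (p i)))))) z)"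
      by (rule sum.cong) (simp_all add: field_simps)
    also have "\<dots> = sA (Q a * block_det a / det_fun D gram * (\<Sum>p\<in>?P. of_int (sign p) * (\<Prod>i<D. mult_trace (a (ys i) * a (zs (p i)))))) z"
      by (simp only: A.scale_sum_left[symmetric] sum_distrib_left)
    also have "(\<Sum>p\<in>?P. of_int (sign p) * (\<Prod>i<D. mult_trace (a (ys i) * a (zs (p i)))))
      = (\<Sum>p\<in>?P. of_int (sign p) * (\<Prod>i<D. \<Sum>k<D. \<Sum>l<D. coordinate k (a (ys i)) * gram k l * coordinate l (a (zs (p i)))))"
      by (intro sum.cong refl arg_cong2[where f = "(*)"] prod.cong mult_trace_gram) (use y lt in auto)
    also have "\<dots> = det_fun D gram * block_det (\<lambda>i. a (ys i)) * block_det (\<lambda>i. a (zs i))"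
      unfolding block_det_def by (rule det_fun_Gram)
    finally show ?thesis using gram_det by (simp add: field_simps)
  qed
  show ?thesis unfolding realized_def
  proof (intro conjI allI impI exI[of _ ?G] hp val)
    show "?I \<inter> {..<D + c} = {}" using realized new unfolding realized_def by (auto simp: leD)
    fix a i x assume i: "i < D"
    have "block_det (\<lambda>k. (a(i := x)) (ys k)) = block_det (\<lambda>k. a (ys k))" "block_det (\<lambda>k. (a(i := x)) (zs k)) = block_det (\<lambda>k. a (zs k))"
    proof -
      have "ys k \<noteq> i" "zs k \<noteq> i" if "k < D" for k
        using new(1)[OF that] new(2)[OF that] i by auto
      then show "block_det (\<lambda>k. (a(i := x)) (ys k)) = block_det (\<lambda>k. a (ys k))" "block_det (\<lambda>k. (a(i := x)) (zs k)) = block_det (\<lambda>k. a (zs k))"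
        unfolding block_det_def by (auto intro!: det_fun_cong)
    qed
    moreover have "Q (a(i := x)) = Q a" using realized i unfolding realized_def by blast
    ultimately show "Q (a(i := x)) * (block_det (\<lambda>k. (a(i := x)) (ys k)) * block_det (\<lambda>k. (a(i := x)) (zs k))) = Q a * (block_det (\<lambda>k. a (ys k)) * block_det (\<lambda>k. a (zs k)))"
      by simp
  qed
qed

lemma realized_all_columns:
  fixes cl :: "nat \<Rightarrow> nat \<Rightarrow> nat" and k :: nat
  assumes s: "seed c \<kappa> z" and D: "D > 0"
    and inj: "inj_on (\<lambda>(j, i). cl j i) ({..<2 * k} \<times> {..<D})" and new: "\<And>j i. j < 2 * k \<Longrightarrow> i < D \<Longrightarrow> D + c \<le> cl j i"
  shows "realized c \<kappa> z ((\<lambda>(j, i). cl j i) ` ({..<2 * k} \<times> {..<D})) (\<lambda>a. \<Prod>j<2 * k. block_det (\<lambda>i. a (cl j i)))"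
  using inj new
proof (induction k)
  case 0
  then show ?case using realized_start[OF s] by simp
next
  case (Suc k)
  let ?f = "\<lambda>(j, i). cl j i"
  let ?I = "?f ` ({..<2 * k} \<times> {..<D})"
  have IH: "realized c \<kappa> z ?I (\<lambda>a. \<Prod>j<2 * k. block_det (\<lambda>i. a (cl j i)))"
    by (rule Suc.IH, rule inj_on_subset[OF Suc.prems(1)]) (use Suc.prems(2) in auto)
  have eqD: "j = j' \<and> i = i'" if "cl j i = cl j' i'" "j < 2 * Suc k" "j' < 2 * Suc k" "i < D" "i' < D" for j j' i i'
    using inj_onD[OF Suc.prems(1), of "(j, i)" "(j', i')"] that by simp
  have notin: "cl j i \<notin> ?I" if "2 * k \<le> j" "j < 2 * Suc k" "i < D" for j i
  proof
    assume "cl j i \<in> ?I"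
    then obtain j' i' where "j' < 2 * k" "i' < D" "cl j i = cl j' i'" by auto
    then show False using eqD[of j i j' i'] that by simp
  qed
  have "realized c \<kappa> z (?I \<union> cl (2 * k) ` {..<D} \<union> cl (Suc (2 * k)) ` {..<D})
     (\<lambda>a. (\<Prod>j<2 * k. block_det (\<lambda>i. a (cl j i))) * (block_det (\<lambda>i. a (cl (2 * k) i)) * block_det (\<lambda>i. a (cl (Suc (2 * k)) i))))"
  proof (rule realized_columns[OF IH D])
    show "inj_on (cl (2 * k)) {..<D}" by (rule inj_onI) (use eqD[of "2 * k" _ "2 * k"] in auto)
    show "inj_on (cl (Suc (2 * k))) {..<D}" by (rule inj_onI) (use eqD[of "Suc (2 * k)" _ "Suc (2 * k)"] in auto)
    show "cl (2 * k) ` {..<D} \<inter> cl (Suc (2 * k)) ` {..<D} = {}"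
      using eqD[of "2 * k" _ "Suc (2 * k)"] by auto
  qed (use notin Suc.prems(2) in auto)
  moreover have "?I \<union> cl (2 * k) ` {..<D} \<union> cl (Suc (2 * k)) ` {..<D} = ?f ` ({..<2 * Suc k} \<times> {..<D})"
  proof -
    have "{..<2 * Suc k} = {..<2 * k} \<union> {2 * k} \<union> {Suc (2 * k)}" by auto
    then have "{..<2 * Suc k} \<times> {..<D} = {..<2 * k} \<times> {..<D} \<union> Pair (2 * k) ` {..<D} \<union> Pair (Suc (2 * k)) ` {..<D}" by auto
    then show ?thesis by (simp only: image_Un image_image prod.case)
  qed
  moreover have "(\<Prod>j<2 * Suc k. block_det (\<lambda>i. a (cl j i))) = (\<Prod>j<2 * k. block_det (\<lambda>i. a (cl j i))) * (block_det (\<lambda>i. a (cl (2 * k) i)) * block_det (\<lambda>i. a (cl (Suc (2 * k)) i)))" for a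
    by (simp add: mult.assoc)
  ultimately show ?case by (simp only:)
qed

text \<open>The tableau of a ballot word distributes the further variables over columns, and the product of
  the determinants of the columns is realized. At tuples of basis elements its values are the
  weights of words, so independence follows from \<open>ballot_weights_independent\<close>.\<close>

lemma codim_ge_ballot:
  fixes k :: nat
  assumes \<gamma>: "is_basis sH \<gamma>" and D: "D > 0" and s: "seed c \<kappa> z"
  shows "card (ballot D (\<lambda>i. if i < D then 2 * k else 0)) \<le> H_codim sH sA act \<gamma> (D + c + D * (2 * k))"
proof -
  let ?M = "2 * k" and ?N = "D + c"
  let ?n = "?N + D * ?M"
  let ?B = "ballot D (\<lambda>i. if i < D then ?M else 0)"
  have "\<exists>G. multilin {..<?n} G \<and> (\<forall>a. in_domain c \<kappa> {?N..<?n} a \<longrightarrow>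
      G a = sA ((\<Prod>j<?M. block_det (\<lambda>i. a (?N + ballot_word.pos w j i))) * block_det a) z)" if w: "w \<in> ?B" for w
  proof -
    interpret ballot_word D ?M w by standard (rule w)
    let ?cl = "\<lambda>j i. ?N + pos j i"
    let ?f = "\<lambda>(j, i). ?N + pos j i"
    have f: "?f = (+) ?N \<circ> (\<lambda>(j, i). pos j i)" by (simp add: fun_eq_iff)
    have inj: "inj_on ?f ({..<?M} \<times> {..<D})"
      unfolding f by (rule comp_inj_on[OF bij_betw_imp_inj_on[OF pos_bij]]) simp
    have img: "?f ` ({..<?M} \<times> {..<D}) = {?N..<?n}"
    proof -
      have "(\<lambda>(j, i). pos j i) ` ({..<?M} \<times> {..<D}) = {..<D * ?M}"
        using pos_bij unfolding bij_betw_def by (rule conjunct2)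
      then have "?f ` ({..<?M} \<times> {..<D}) = (+) ?N ` {..<D * ?M}"
        by (simp only: f image_comp[symmetric])
      also have "\<dots> = {?N..<?n}" by (simp add: lessThan_atLeast0 add.commute)
      finally show ?thesis .
    qed
    have "realized c \<kappa> z (?f ` ({..<?M} \<times> {..<D})) (\<lambda>a. \<Prod>j<?M. block_det (\<lambda>i. a (?cl j i)))"
      by (rule realized_all_columns[where cl = ?cl and k = k, OF s D inj]) simp
    then have "realized c \<kappa> z {?N..<?n} (\<lambda>a. \<Prod>j<?M. block_det (\<lambda>i. a (?cl j i)))" unfolding img .
    moreover have "{..<?N} \<union> {?N..<?n} = {..<?n}" by auto
    ultimately show ?thesis unfolding realized_def by auto
  qed
  then have "\<forall>w\<in>?B. \<exists>G. multilin {..<?n} G \<and> (\<forall>a. in_domain c \<kappa> {?N..<?n} a \<longrightarrow>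
      G a = sA ((\<Prod>j<?M. block_det (\<lambda>i. a (?N + ballot_word.pos w j i))) * block_det a) z)" by (intro ballI)
  from bchoice[OF this] obtain G where G0: "\<forall>w\<in>?B. multilin {..<?n} (G w) \<and> (\<forall>a. in_domain c \<kappa> {?N..<?n} a \<longrightarrow>
      G w a = sA ((\<Prod>j<?M. block_det (\<lambda>i. a (?N + ballot_word.pos w j i))) * block_det a) z)"
    by (elim exE)
  have G1: "multilin {..<?n} (G w)" if "w \<in> ?B" for w
    by (rule conjunct1[OF bspec[OF G0 that]])
  have G2: "G w a = sA ((\<Prod>j<?M. block_det (\<lambda>i. a (?N + ballot_word.pos w j i))) * block_det a) z"
    if "w \<in> ?B" "in_domain c \<kappa> {?N..<?n} a" for w a
    by (rule conjunct2[OF bspec[OF G0 that(1)], THEN spec, THEN mp, OF that(2)])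
  \<comment> \<open>the word \<open>v\<close> as an assignment of basis elements to the further variables\<close>
  define asg where "asg v t = (if t < D then e t else if t < ?N then \<kappa> t else e (v ! (t - ?N)))" for v t
  have val: "G w (asg v) = sA (ballot_word.weight D ?M w v) z"
    if w: "w \<in> ?B" and v: "set v \<subseteq> {..<D}" "length v = D * ?M" for w v
  proof -
    interpret ballot_word D ?M w by standard (rule w)
    have vD: "v ! p < D" if "p < D * ?M" for p
    proof -
      have "v ! p \<in> set v" using that v(2) by simp
      then show ?thesis using v(1) by blast
    qed
    have "in_domain c \<kappa> {?N..<?n} (asg v)"
      unfolding in_domain_def
    proof (intro conjI allI impI ballI)
      fix t assume "t \<in> {?N..<?n}"
      then have "v ! (t - ?N) < D" "\<not> t < D" "\<not> t < ?N" by (auto intro!: vD)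
      then show "asg v t \<in> block_space" using e_in_block_space by (simp add: asg_def)
    qed (use e_in_block_space in \<open>auto simp: asg_def\<close>)
    then have "G w (asg v) = sA ((\<Prod>j<?M. block_det (\<lambda>i. asg v (?N + pos j i))) * block_det (asg v)) z" by (rule G2[OF w])
    moreover have "block_det (asg v) = 1"
    proof -
      have "block_det (asg v) = det_fun D (\<lambda>i l. if i = l then 1 else 0)"
        unfolding block_det_def by (rule det_fun_cong) (simp add: asg_def coordinate_e)
      also have "\<dots> = 1" by (subst det_fun_lower_triangular) auto
      finally show ?thesis .
    qed
    moreover have "(\<Prod>j<?M. block_det (\<lambda>i. asg v (?N + pos j i))) = weight v"
      unfolding weight_def
    proof (rule prod.cong[OF refl])
      fix j assume "j \<in> {..<?M}"
      then have j: "j < ?M" by simp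
      show "block_det (\<lambda>i. asg v (?N + pos j i)) = det_fun D (\<lambda>i l. if v ! pos j i = l then 1 else 0)"
        unfolding block_det_def
      proof (rule det_fun_cong)
        fix i l assume il: "i < D" "l < D"
        have "pos j i < D * ?M" using pos[OF j il(1)] len by simp
        then show "coordinate l (asg v (?N + pos j i)) = (if v ! pos j i = l then 1 else 0)"
          using vD il by (simp add: asg_def coordinate_e)
      qed
    qed
    ultimately show ?thesis by simp
  qed
  obtain wl where wl: "bij_betw wl {..<card ?B} ?B"
    using ex_bij_betw_nat_finite[OF finite_ballot, of D] by (auto simp: atLeast0LessThan)
  have wlB: "wl i \<in> ?B" if "i < card ?B" for i using wl that by (auto simp: bij_betw_def)
  have z: "z \<noteq> 0" using s by (simp add: seed_def)
  show ?thesis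
  proof (rule codim_lower[OF \<gamma> _ adapted_basis_finite adapted_basis_independent adapted_basis_span])
    show "1 \<le> ?n" using D by simp
    show "finite {ts. set ts \<subseteq> adapted_basis \<and> length ts = ?n}" by (rule finite_lists_length_eq[OF adapted_basis_finite])
    show "multilin {..<?n} (G (wl i))" if "i < card ?B" for i by (rule G1[OF wlB[OF that]])
    fix cc assume c0: "\<And>a. (\<Sum>i<card ?B. sA (cc i) (G (wl i) a)) = 0"
    define c' where "c' w = cc (inv_into {..<card ?B} wl w)" for w
    have c': "c' (wl i) = cc i" if "i < card ?B" for i
      using wl that by (simp add: c'_def bij_betw_def inv_into_f_f)
    have zero: "(\<Sum>w\<in>?B. c' w * ballot_word.weight D ?M w v) = 0" if v: "set v \<subseteq> {..<D}" "length v = D * ?M" for v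
    proof -
      have "(\<Sum>i<card ?B. sA (cc i) (G (wl i) (asg v))) = (\<Sum>i<card ?B. sA (c' (wl i) * ballot_word.weight D ?M (wl i) v) z)"
        by (rule sum.cong) (use val[OF wlB v] c' in auto)
      also have "\<dots> = (\<Sum>w\<in>?B. sA (c' w * ballot_word.weight D ?M w v) z)"
        by (rule sum.reindex_bij_betw[OF wl])
      also have "\<dots> = sA (\<Sum>w\<in>?B. c' w * ballot_word.weight D ?M w v) z"
        by (rule A.scale_sum_left[symmetric])
      finally show ?thesis using c0[of "asg v"] z by simp
    qed
    have "c' w = 0" if "w \<in> ?B" for w by (rule ballot_weights_independent[OF zero that])
    then show "\<forall>i<card ?B. cc i = 0" using c' wlB by metis
  qed auto
qed

end

section \<open>Growth of the codimensions\<close>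

text \<open>The letters from \<open>A\<close> account for \<open>d ^ n\<close>, and each of the at most \<open>p\<close> letters from \<open>B\<close> for a
  linear factor that counts its possible places and values.\<close>

lemma card_sparse_words:
  fixes d p n :: nat
  assumes fin: "finite A" "finite B" and A: "card A \<le> d" and d: "d \<ge> 1"
  shows "card {ts. length ts = n \<and> set ts \<subseteq> A \<union> B \<and> length (filter (\<lambda>x. x \<in> B) ts) \<le> p} \<le> d ^ n * (1 + card B * n) ^ p"
proof (induction n arbitrary: p)
  case 0
  have "{ts. length ts = 0 \<and> set ts \<subseteq> A \<union> B \<and> length (filter (\<lambda>x. x \<in> B) ts) \<le> p} \<subseteq> {[]}" by auto
  from card_mono[OF _ this] show ?case by simp
next
  case (Suc n)
  define W where "W m p = {ts. length ts = m \<and> set ts \<subseteq> A \<union> B \<and> length (filter (\<lambda>x. x \<in> B) ts) \<le> p}" for m p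
  have finW: "finite (W m p)" for m p
    by (rule finite_subset[OF _ finite_lists_length_eq[of "A \<union> B" m]]) (use fin in \<open>auto simp: W_def\<close>)
  have IH: "card (W n p) \<le> d ^ n * (1 + card B * n) ^ p" for p using Suc[of p] by (simp add: W_def)
  let ?b = "card B"
  let ?C = "\<lambda>X Y. (\<lambda>(x, ts). x # ts) ` (X \<times> Y)"
  have cardC: "card (?C X Y) \<le> card X * card Y" if "finite X" "finite Y" for X :: "'a set" and Y
    using card_image_le[of "X \<times> Y" "\<lambda>(x, ts). x # ts"] that by (simp add: card_cartesian_product)
  show ?case
  proof (cases p)
    case 0
    have "W (Suc n) 0 \<subseteq> ?C A (W n 0)"
    proof
      fix ts assume ts: "ts \<in> W (Suc n) 0"
      then obtain x us where "ts = x # us" by (cases ts) (auto simp: W_def)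
      then show "ts \<in> ?C A (W n 0)" using ts by (auto simp: W_def split: if_splits)
    qed
    then have "card (W (Suc n) 0) \<le> card A * card (W n 0)"
      using card_mono[of "?C A (W n 0)" "W (Suc n) 0"] cardC[OF fin(1) finW[of n 0]] fin finW by fastforce
    also have "\<dots> \<le> d * (d ^ n * (1 + ?b * n) ^ 0)" by (intro mult_le_mono A IH)
    finally show ?thesis by (simp add: W_def 0)
  next
    case (Suc r)
    have "W (Suc n) (Suc r) \<subseteq> ?C A (W n (Suc r)) \<union> ?C B (W n r)"
    proof
      fix ts assume ts: "ts \<in> W (Suc n) (Suc r)"
      then obtain x us where "ts = x # us" by (cases ts) (auto simp: W_def)
      then show "ts \<in> ?C A (W n (Suc r)) \<union> ?C B (W n r)" using ts by (auto simp: W_def split: if_splits)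
    qed
    then have "card (W (Suc n) (Suc r)) \<le> card (?C A (W n (Suc r)) \<union> ?C B (W n r))"
      by (rule card_mono[rotated]) (use fin finW in auto)
    also have "\<dots> \<le> card (?C A (W n (Suc r))) + card (?C B (W n r))" by (rule card_Un_le)
    also have "\<dots> \<le> card A * card (W n (Suc r)) + ?b * card (W n r)"
      by (intro add_mono cardC fin finW)
    also have "\<dots> \<le> d * (d ^ n * (1 + ?b * n) ^ Suc r) + ?b * (d ^ n * (1 + ?b * n) ^ r)"
      by (intro add_mono mult_le_mono A IH order_refl)
    also have "\<dots> \<le> d ^ Suc n * ((1 + ?b * n) ^ Suc r + ?b * (1 + ?b * n) ^ r)"
    proof -
      have "?b * (d ^ n * (1 + ?b * n) ^ r) \<le> d * (?b * (d ^ n * (1 + ?b * n) ^ r))" using d by simp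
      then show ?thesis by (simp add: algebra_simps)
    qed
    also have "(1 + ?b * n) ^ Suc r + ?b * (1 + ?b * n) ^ r = (1 + ?b * Suc n) * (1 + ?b * n) ^ r"
      by (simp add: algebra_simps)
    also have "\<dots> \<le> (1 + ?b * Suc n) * (1 + ?b * Suc n) ^ r"
      by (intro mult_le_mono power_mono) auto
    finally show ?thesis by (simp add: W_def Suc)
  qed
qed

context wedderburn_action begin

text \<open>The index of a component is recorded with each factor of the product; the set \<open>S\<close> collects the
  indices of the blocks.\<close>

definition admissible :: "nat set \<Rightarrow> bool" where
  "admissible S \<longleftrightarrow> (\<exists>ps. ps \<noteq> [] \<and> (\<forall>(i, c)\<in>set ps. i \<le> q \<and> c \<in> component i) \<and> fst ` set ps - {0} = S \<and> nprod (map snd ps) \<noteq> 0)"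

definition block_dim :: "nat set \<Rightarrow> nat" where "block_dim S = card (\<Union>i\<in>S. comp_basis i)"

lemma admissible_sub: "admissible S \<Longrightarrow> S \<subseteq> {1..q}"
  unfolding admissible_def by fastforce

lemma finite_blocks: "S \<subseteq> {1..q} \<Longrightarrow> finite (\<Union>i\<in>S. comp_basis i)"
proof -
  assume S: "S \<subseteq> {1..q}"
  then have "finite S" by (rule finite_subset) simp
  moreover have "finite (comp_basis i)" if "i \<in> S" for i using S that by (intro comp_basis_finite) auto
  ultimately show ?thesis by (rule finite_UN_I)
qed

text \<open>If all blocks were 0, the algebra would coincide with its radical and be nilpotent.\<close>

lemma exists_admissible:
  assumes nn: "\<not> nilpotent_algebra TYPE('a)"
  shows "\<exists>S. admissible S \<and> block_dim S \<ge> 1"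
proof -
  obtain p where p: "\<And>xs. p < length (filter (\<lambda>x. x \<in> J) xs) \<Longrightarrow> nprod xs = 0"
    using fd.radical_nilpotent unfolding J_def by blast
  obtain xs :: "'a list" where xs: "length xs = Suc p" "nprod xs \<noteq> 0"
    using nn unfolding nilpotent_algebra_def by (metis le_add1 plus_1_eq_Suc)
  have "\<exists>i\<in>{1..q}. \<exists>c\<in>Bs i. c \<noteq> 0"
  proof (rule ccontr)
    assume no: "\<not> (\<exists>i\<in>{1..q}. \<exists>c\<in>Bs i. c \<noteq> 0)"
    have "x \<in> J" for x
    proof -
      obtain f where f: "\<And>i. i \<le> q \<Longrightarrow> f i \<in> component i" "x = (\<Sum>i\<le>q. f i)" by (rule component_decomp[of x]) blast
      have "(\<Sum>i\<in>{1..q}. f i) = 0"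
      proof (rule sum.neutral, rule ballI)
        fix i assume i: "i \<in> {1..q}"
        then have "f i \<in> Bs i" using f(1)[of i] component_Bs[OF i] by simp
        then show "f i = 0" using no i by blast
      qed
      then have "x = f 0" using f(2) by (simp only: sum_atMost_split) simp
      then show ?thesis using f(1)[of 0] by (simp add: component_def)
    qed
    then have "filter (\<lambda>x. x \<in> J) xs = xs" by simp
    then show False using p[of xs] xs by simp
  qed
  then obtain i c where ic: "i \<in> {1..q}" "c \<in> Bs i" "c \<noteq> 0" by blast
  have "admissible {i}"
    unfolding admissible_def using ic component_Bs[OF ic(1)] by (intro exI[of _ "[(i, c)]"]) auto
  moreover have "block_dim {i} \<ge> 1"
  proof -
    have iq: "i \<le> q" using ic by simp
    have "comp_basis i \<noteq> {}" using comp_basis_span[OF iq] component_Bs[OF ic(1)] Bs_nonzero[OF ic(1)] by force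
    then show ?thesis using comp_basis_finite[OF iq] by (simp add: block_dim_def Suc_le_eq card_gt_0_iff)
  qed
  ultimately show ?thesis by blast
qed

lemma filter_length_mono:
  assumes "\<And>x. x \<in> set xs \<Longrightarrow> P (f x) \<Longrightarrow> R (g x)"
  shows "length (filter P (map f xs)) \<le> length (filter R (map g xs))"
  using assms by (induction xs) (auto simp: le_SucI)

definition sparse_tuples :: "nat \<Rightarrow> nat \<Rightarrow> nat set \<Rightarrow> 'a list set" where
  "sparse_tuples p n S = {ts. length ts = n \<and> set ts \<subseteq> (\<Union>i\<in>S. comp_basis i) \<union> comp_basis 0 \<and> length (filter (\<lambda>x. x \<in> comp_basis 0) ts) \<le> p}"

text \<open>Some monomial does not vanish at the tuple. Its factors are the entries of the tuple, moved by \<open>H\<close>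
  inside their components. So their indices form an admissible set, and at most \<open>p\<close> of them are in
  the radical.\<close>

lemma nonzero_tuple_sparse:
  assumes p: "\<And>xs. p < length (filter (\<lambda>x. x \<in> J) xs) \<Longrightarrow> nprod xs = 0"
    and ts: "length ts = n" "set ts \<subseteq> adapted_basis" and F: "multilin {..<n} F" "F (tuple ts) \<noteq> 0"
  shows "\<exists>S. admissible S \<and> ts \<in> sparse_tuples p n S"
proof -
  obtain L where L: "snd ` set L \<subseteq> monos_on {..<n}" "\<And>a. F a = (\<Sum>(c, m)\<leftarrow>L. sA c (mono_val m a))"
    using multilin_expansion[OF F(1)] by blast
  have "\<exists>m\<in>monos_on {..<n}. mono_val m (tuple ts) \<noteq> 0"
  proof (rule ccontr)
    assume "\<not> (\<exists>m\<in>monos_on {..<n}. mono_val m (tuple ts) \<noteq> 0)"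
    then have "(\<Sum>(c, m)\<leftarrow>L. sA c (mono_val m (tuple ts))) = 0"
      using L(1) by (induction L) auto
    then show False using F(2) L(2) by simp
  qed
  then obtain m where m: "m \<in> monos_on {..<n}" "mono_val m (tuple ts) \<noteq> 0" by blast
  have mm: "m \<noteq> []" "distinct (map fst m)" "fst ` set m = {..<n}" using m(1) by (simp_all add: monos_on_def)
  define ix where "ix x = (SOME i. i \<le> q \<and> x \<in> comp_basis i)" for x
  have ix: "ix x \<le> q \<and> x \<in> comp_basis (ix x)" if "x \<in> adapted_basis" for x
    unfolding ix_def by (rule someI_ex) (use that in \<open>auto simp: adapted_basis_def\<close>)
  have ix_eq: "ix x = i" if "x \<in> comp_basis i" "i \<le> q" for x i
  proof (rule ccontr)
    assume "ix x \<noteq> i"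
    moreover have "x \<in> adapted_basis" using that by (auto simp: adapted_basis_def)
    ultimately show False using ix[of x] comp_basis_disjoint[of "ix x" i] that by blast
  qed
  let ?g = "\<lambda>(i, h). (ix (ts ! i), act h (ts ! i))"
  define ps where "ps = map ?g m"
  have lt: "i < n" if "(i, h) \<in> set m" for i h using mm(3) that by force
  have inEA: "ts ! i \<in> adapted_basis" if "i < n" for i using ts that nth_mem by blast
  have val: "map snd ps = map (\<lambda>(i, h). act h (tuple ts i)) m"
    unfolding ps_def by (auto simp: tuple_def ts(1) dest: lt)
  have nz: "nprod (map snd ps) \<noteq> 0" using m(2) unfolding val mono_val_def .
  have comps: "\<forall>(i, c)\<in>set ps. i \<le> q \<and> c \<in> component i"
  proof (clarsimp simp: ps_def)
    fix i h assume "(i, h) \<in> set m"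
    then have "ix (ts ! i) \<le> q" "ts ! i \<in> comp_basis (ix (ts ! i))" using ix[OF inEA[OF lt]] by blast+
    then show "ix (ts ! i) \<le> q \<and> act h (ts ! i) \<in> component (ix (ts ! i))"
      using component_inv comp_basis_sub by blast
  qed
  have ixs: "fst ` set ps = ix ` set ts"
  proof -
    have "fst ` set ps = (\<lambda>i. ix (ts ! i)) ` (fst ` set m)"
      unfolding ps_def by (simp add: image_image case_prod_unfold)
    also have "\<dots> = ix ` set ts" unfolding mm(3) using ts(1) by (auto simp: set_conv_nth image_def)
    finally show ?thesis .
  qed
  let ?S = "fst ` set ps - {0}"
  have "ps \<noteq> []" using mm(1) by (simp add: ps_def)
  then have "admissible ?S" unfolding admissible_def using comps nz by blast
  moreover have "ts \<in> sparse_tuples p n ?S"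
    unfolding sparse_tuples_def
  proof (intro CollectI conjI ts(1))
    show "set ts \<subseteq> (\<Union>i\<in>?S. comp_basis i) \<union> comp_basis 0"
    proof
      fix x assume x: "x \<in> set ts"
      then have "x \<in> comp_basis (ix x)" using ix ts(2) by blast
      moreover have "ix x \<in> fst ` set ps" using x ixs by blast
      ultimately show "x \<in> (\<Union>i\<in>?S. comp_basis i) \<union> comp_basis 0" by (cases "ix x = 0") auto
    qed
    have "mset (map fst m) = mset [0..<n]"
      using mm(2,3) by (intro set_eq_iff_mset_eq_distinct[THEN iffD1]) (auto simp: atLeast0LessThan)
    then have "image_mset ((!) ts) (mset (map fst m)) = image_mset ((!) ts) (mset [0..<n])" by simp
    then have "mset (map ((!) ts) (map fst m)) = mset (map ((!) ts) [0..<n])" by (simp only: mset_map)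
    moreover have "map ((!) ts) [0..<n] = ts" using ts(1) map_nth by blast
    ultimately have ms: "mset (map (\<lambda>x. ts ! fst x) m) = mset ts" by (simp add: o_def)
    have "length (filter (\<lambda>x. x \<in> comp_basis 0) ts) = length (filter (\<lambda>x. x \<in> comp_basis 0) (map (\<lambda>x. ts ! fst x) m))"
      using ms by (metis mset_filter size_mset)
    also have "\<dots> \<le> length (filter (\<lambda>x. x \<in> J) (map (\<lambda>x. snd (?g x)) m))"
    proof (rule filter_length_mono)
      fix x :: "nat \<times> 'h" assume "ts ! fst x \<in> comp_basis 0"
      then have "ts ! fst x \<in> J" using comp_basis_sub[of 0] by (auto simp: component_def)
      then show "snd (?g x) \<in> J" using J_inv by (auto simp: H_invariant_def case_prod_unfold)
    qed
    also have "map (\<lambda>x. snd (?g x)) m = map snd ps" by (simp add: ps_def)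
    finally show "length (filter (\<lambda>x. x \<in> comp_basis 0) ts) \<le> p" using p[of "map snd ps"] nz by linarith
  qed
  ultimately show ?thesis by blast
qed

lemma codim_le_poly:
  assumes \<gamma>: "is_basis sH \<gamma>" and d: "d \<ge> 1" "\<And>S. admissible S \<Longrightarrow> block_dim S \<le> d"
  shows "\<exists>p. \<forall>n\<ge>1. H_codim sH sA act \<gamma> n \<le> 2 ^ q * (d ^ n * (1 + card (comp_basis 0) * n) ^ p) * card adapted_basis"
proof -
  obtain p where p: "\<And>xs. p < length (filter (\<lambda>x. x \<in> J) xs) \<Longrightarrow> nprod xs = 0"
    using fd.radical_nilpotent unfolding J_def by blast
  have "H_codim sH sA act \<gamma> n \<le> 2 ^ q * (d ^ n * (1 + card (comp_basis 0) * n) ^ p) * card adapted_basis" if n: "n \<ge> 1" for n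
  proof -
    let ?T = "{S. admissible S}"
    have T: "finite ?T" "card ?T \<le> 2 ^ q"
    proof -
      have sub: "?T \<subseteq> Pow {1..q}" using admissible_sub by blast
      then show "finite ?T" by (rule finite_subset) simp
      show "card ?T \<le> 2 ^ q" using card_mono[OF _ sub] by (simp add: card_Pow)
    qed
    let ?X = "\<Union>S\<in>?T. sparse_tuples p n S"
    have finS: "finite (sparse_tuples p n S)" if "S \<in> ?T" for S
    proof (rule finite_subset)
      show "sparse_tuples p n S \<subseteq> {ts. set ts \<subseteq> adapted_basis \<and> length ts = n}"
        using admissible_sub[of S] that unfolding sparse_tuples_def adapted_basis_def by fastforce
    qed (rule finite_lists_length_eq[OF adapted_basis_finite])
    have "card ?X \<le> (\<Sum>S\<in>?T. card (sparse_tuples p n S))" by (rule card_UN_le[OF T(1)])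
    also have "\<dots> \<le> (\<Sum>S\<in>?T. d ^ n * (1 + card (comp_basis 0) * n) ^ p)"
    proof (rule sum_mono)
      fix S assume S: "S \<in> ?T"
      then have "admissible S" by simp
      show "card (sparse_tuples p n S) \<le> d ^ n * (1 + card (comp_basis 0) * n) ^ p"
        unfolding sparse_tuples_def
        by (rule card_sparse_words[OF finite_blocks[OF admissible_sub[OF \<open>admissible S\<close>]] comp_basis_finite _ d(1)])
           (use d(2)[OF \<open>admissible S\<close>] in \<open>auto simp: block_dim_def\<close>)
    qed
    also have "\<dots> \<le> 2 ^ q * (d ^ n * (1 + card (comp_basis 0) * n) ^ p)"
      using T(2) by (simp only: sum_constant of_nat_id mult_le_mono1)
    finally have X: "card ?X \<le> 2 ^ q * (d ^ n * (1 + card (comp_basis 0) * n) ^ p)" .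
    have "H_codim sH sA act \<gamma> n \<le> card ?X * card adapted_basis"
    proof (rule codim_upper[OF \<gamma> n adapted_basis_finite adapted_basis_independent adapted_basis_span])
      show "finite ?X" using T(1) finS by blast
      fix ts F assume "length ts = n" "set ts \<subseteq> adapted_basis" "multilin {..<n} F" "F (tuple ts) \<noteq> 0"
      from nonzero_tuple_sparse[OF p this] obtain S where "admissible S" "ts \<in> sparse_tuples p n S" by blast
      then show "ts \<in> ?X" by blast
    qed
    then show ?thesis using mult_le_mono1[OF X, of "card adapted_basis"] by linarith
  qed
  then show ?thesis by blast
qed

lemma codim_positive:
  assumes \<gamma>: "is_basis sH \<gamma>" and nn: "\<not> nilpotent_algebra TYPE('a)" and n: "n \<ge> 1"
  shows "1 \<le> H_codim sH sA act \<gamma> n"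
proof -
  obtain xs :: "'a list" where xs: "length xs = n" "nprod xs \<noteq> 0"
    using nn n unfolding nilpotent_algebra_def by blast
  let ?m = "map (\<lambda>k. (k, 1)) [0..<n]"
  let ?F = "mono_val ?m"
  have F: "multilin {..<n} ?F"
    using generator_is_mono[OF permutes_id n, of "\<lambda>_. 1"] by (intro multilin_mono_on) simp
  have "?F (tuple xs) = nprod xs"
  proof -
    have "map (\<lambda>(i, h). act h (tuple xs i)) ?m = xs"
      using xs(1) by (intro nth_equalityI) (auto simp: act_one tuple_def)
    then show ?thesis by (simp only: mono_val_def)
  qed
  then have nz: "?F (tuple xs) \<noteq> 0" using xs(2) by simp
  show ?thesis
  proof (rule codim_lower[OF \<gamma> n adapted_basis_finite adapted_basis_independent adapted_basis_span])
    show "finite {ts. set ts \<subseteq> adapted_basis \<and> length ts = n}" by (rule finite_lists_length_eq[OF adapted_basis_finite])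
    show "multilin {..<n} ?F" if "i < 1" for i :: nat by (rule F)
    fix c :: "nat \<Rightarrow> 'f" assume "\<And>a. (\<Sum>i<1. sA (c i) (?F a)) = 0"
    from this[of "tuple xs"] have "sA (c 0) (?F (tuple xs)) = 0" by (simp only: lessThan_Suc One_nat_def) simp
    then show "\<forall>i<1. c i = 0" using nz by (simp only: A.scale_eq_0_iff less_one) simp
  qed auto
qed

text \<open>Write \<open>n = d + (c + r) + d * (2 * k)\<close> with \<open>r < 2 * d\<close>. The determinant of the seed takes \<open>d\<close>
  variables, the constants take \<open>c + r\<close>, and the rest forms \<open>2 * k\<close> columns. For the finitely many
  smaller \<open>n\<close> it suffices that the codimension is positive.\<close>

lemma codim_ge_poly:
  assumes \<gamma>: "is_basis sH \<gamma>" and nn: "\<not> nilpotent_algebra TYPE('a)"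
    and S: "admissible S" "block_dim S = d" and d: "d \<ge> 1"
  shows "\<exists>N. \<forall>n\<ge>1. real d ^ n \<le> real d ^ N * real n ^ (d + d * d) * real (H_codim sH sA act \<gamma> n)"
proof -
  note admS = S(1)
  have Sq: "S \<subseteq> {1..q}" by (rule admissible_sub[OF S(1)])
  have "finite (\<Union>i\<in>S. comp_basis i)" by (rule finite_blocks[OF Sq])
  from ex_bij_betw_nat_finite[OF this] obtain e where e0: "bij_betw e {0..<card (\<Union>i\<in>S. comp_basis i)} (\<Union>i\<in>S. comp_basis i)"
    by (elim exE)
  have card_S: "card (\<Union>i\<in>S. comp_basis i) = d" using S(2) unfolding block_dim_def .
  have e: "bij_betw e {..<d} (\<Union>i\<in>S. comp_basis i)"
    using e0 unfolding card_S atLeast0LessThan .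
  interpret block sH sA act Basis J B Bs q S d e
    by (rule block.intro[OF wedderburn_action_axioms block_axioms.intro[OF Sq e]])
  obtain ps where ps: "ps \<noteq> []" "\<forall>(i, c)\<in>set ps. i \<le> q \<and> c \<in> component i" "fst ` set ps - {0} = S" "nprod (map snd ps) \<noteq> 0"
    using admS unfolding admissible_def by (elim exE conjE)
  have "\<exists>c \<kappa> z. seed c \<kappa> z"
  proof (rule seed_exists[OF ps(1) _ _ ps(4)])
    show "\<forall>(i, c)\<in>set ps. c \<in> component i" using ps(2) by fast
    show "S \<subseteq> fst ` set ps" unfolding ps(3)[symmetric] by (rule Diff_subset)
  qed
  then obtain c \<kappa> z where s: "seed c \<kappa> z" by (elim exE)
  have d0: "d > 0" using d by simp
  let ?N = "4 * d + c"
  have big: "real d ^ n \<le> real d ^ ?N * real n ^ (d + d * d) * real (H_codim sH sA act \<gamma> n)" if n: "n \<ge> 3 * d + c" for n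
  proof -
    define k where "k = (n - d - c) div (2 * d)"
    define r where "r = (n - d - c) mod (2 * d)"
    have nkr: "n = d + (c + r) + d * (2 * k)"
    proof -
      have "n - d - c = 2 * d * k + r" by (simp add: k_def r_def)
      then show ?thesis using n by (simp add: algebra_simps)
    qed
    have r: "r < 2 * d" using d0 by (simp add: r_def)
    have k: "2 * k \<ge> 1"
    proof -
      have "2 * d \<le> n - d - c" using n by simp
      then have "k \<ge> 1" unfolding k_def using d0 by (simp add: div_greater_zero_iff Suc_le_eq)
      then show ?thesis by simp
    qed
    obtain \<kappa>' z' where s': "seed (c + r) \<kappa>' z'" using seed_pads[OF d0 s] by blast
    let ?b = "real (card (ballot d (\<lambda>i. if i < d then 2 * k else 0)))"
    have cod: "?b \<le> real (H_codim sH sA act \<gamma> n)"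
      using codim_ge_ballot[OF \<gamma> d0 s', of k] nkr by simp
    have "2 * k \<le> d * (2 * k)" using d0 by simp
    then have kn: "2 * k + d \<le> n" using nkr by linarith
    have d1: "1 \<le> real d" using d by simp
    have "real d ^ n = real d ^ (d + (c + r)) * real d ^ (d * (2 * k))"
      by (subst nkr) (simp add: power_add)
    also have "\<dots> \<le> real d ^ (3 * d + c) * (?b * (real d ^ d * real (2 * k + d) ^ (d + d * d)))"
      using r d1 by (intro mult_mono power_increasing card_rectangular_ballot[OF k]) auto
    also have "\<dots> \<le> real d ^ (3 * d + c) * (real (H_codim sH sA act \<gamma> n) * (real d ^ d * real n ^ (d + d * d)))"
      using kn by (intro mult_left_mono mult_mono cod power_mono) auto
    also have "\<dots> = real d ^ ?N * real n ^ (d + d * d) * real (H_codim sH sA act \<gamma> n)"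
    proof -
      have "?N = (3 * d + c) + d" by simp
      then have "real d ^ ?N = real d ^ (3 * d + c) * real d ^ d" by (simp only: power_add)
      then show ?thesis by (simp only: mult_ac)
    qed
    finally show ?thesis .
  qed
  have small: "real d ^ n \<le> real d ^ ?N * real n ^ (d + d * d) * real (H_codim sH sA act \<gamma> n)" if n: "n \<ge> 1" "n < 3 * d + c" for n
  proof -
    have "real d ^ n \<le> real d ^ ?N" using d n by (intro power_increasing) auto
    also have "\<dots> = real d ^ ?N * 1 * 1" by simp
    also have "\<dots> \<le> real d ^ ?N * real n ^ (d + d * d) * real (H_codim sH sA act \<gamma> n)"
      using n codim_positive[OF \<gamma> nn n(1)] by (intro mult_mono one_le_power) auto
    finally show ?thesis .
  qed
  show ?thesis using big small by (metis not_less)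
qed

end

theorem theorem5:
  fixes sH :: "'f::{alg_closed_field, field_char_0} \<Rightarrow> 'h::ring_1 \<Rightarrow> 'h"
    and sA :: "'f \<Rightarrow> 'a::ring \<Rightarrow> 'a"
    and act :: "'h \<Rightarrow> 'a \<Rightarrow> 'a"
    and \<gamma> :: "'l \<Rightarrow> 'h"
    and B J :: "'a set" and Bs :: "nat \<Rightarrow> 'a set" and q :: nat
  assumes action: "generalized_action sH sA act"
    and fin_H: "finite_dim sH"
    and fin_A: "finite_dim sA"
    and non_nilpotent: "\<not> nilpotent_algebra TYPE('a)"
    and basis: "is_basis sH \<gamma>"
    and J_def: "J = jacobson_radical sA UNIV"
    and J_inv: "H_invariant act J"
    and B_subalgebra: "subalgebra sA B"
    and B_inv: "H_invariant act B"
    and A_sum: "UNIV = {b + j | b j. b \<in> B \<and> j \<in> J}"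
    and A_direct: "B \<inter> J = {0}"
    and B_sum: "internal_direct_sum {1..q} Bs B"
    and Bs_ideal: "\<And>i. i \<in> {1..q} \<Longrightarrow> ideal_of sA B (Bs i)"
    and Bs_inv: "\<And>i. i \<in> {1..q} \<Longrightarrow> H_invariant act (Bs i)"
    and Bs_simple: "\<And>i. i \<in> {1..q} \<Longrightarrow> H_simple sA act (Bs i)"
    and Bs_semisimple: "\<And>i. i \<in> {1..q} \<Longrightarrow> semisimple_algebra sA (Bs i)"
  shows "\<exists>C1 C2 r1 r2 :: real. \<exists>d :: nat. C1 > 0 \<and> C2 > 0 \<and> d \<ge> 1 \<and>
    (\<forall>n\<ge>1. C1 * real n powr r1 * real d ^ n \<le> real (H_codim sH sA act \<gamma> n) \<and>
           real (H_codim sH sA act \<gamma> n) \<le> C2 * real n powr r2 * real d ^ n)"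
proof -
  interpret act: generalized_action sH sA act by (rule action)
  obtain S0 where S0: "finite S0" "act.A.span S0 = UNIV" using fin_A unfolding finite_dim_def by blast
  obtain Basis where Bas: "Basis \<subseteq> S0" "act.A.independent Basis" "S0 \<subseteq> act.A.span Basis"
    by (rule act.A.basis_exists[of S0])
  have spanB: "act.A.span Basis = UNIV"
    using act.A.span_minimal[OF Bas(3) act.A.subspace_span] S0(2) by auto
  interpret fd: fd_algebra sA Basis
    by standard (use Bas spanB finite_subset[OF Bas(1) S0(1)] in auto)
  interpret wedderburn_action sH sA act Basis J B Bs q
  proof (intro wedderburn_action.intro wedderburn_action_axioms.intro action fd.fd_algebra_axioms)
    show "\<exists>z. poly p z = 0" if "degree p > 0" for p :: "'f poly"
      by (rule alg_closed_imp_poly_has_root[OF that])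
  qed (fact J_def J_inv A_sum A_direct B_sum Bs_ideal Bs_simple Bs_semisimple)+
  let ?T = "{S. admissible S}"
  have finT: "finite ?T" by (rule finite_subset[of _ "Pow {1..q}"]) (use admissible_sub in auto)
  define d where "d = Max (block_dim ` ?T)"
  obtain S1 where S1: "admissible S1" "block_dim S1 \<ge> 1" using exists_admissible[OF non_nilpotent] by blast
  then have ne: "block_dim ` ?T \<noteq> {}" by blast
  have le: "block_dim S \<le> d" if "admissible S" for S unfolding d_def using finT that by (intro Max_ge) auto
  have d: "d \<ge> 1" using le[OF S1(1)] S1(2) by simp
  have "d \<in> block_dim ` ?T" unfolding d_def using finT ne by (intro Max_in) auto
  then obtain S where S: "admissible S" "block_dim S = d" by auto
  obtain N where N: "\<And>n. n \<ge> 1 \<Longrightarrow> real d ^ n \<le> real d ^ N * real n ^ (d + d * d) * real (H_codim sH sA act \<gamma> n)"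
    using codim_ge_poly[OF basis non_nilpotent S d] by blast
  obtain p where p: "\<And>n. n \<ge> 1 \<Longrightarrow> H_codim sH sA act \<gamma> n \<le> 2 ^ q * (d ^ n * (1 + card (comp_basis 0) * n) ^ p) * card adapted_basis"
    using codim_le_poly[OF basis d le] by blast
  let ?r = "d + d * d"
  let ?C1 = "1 / real d ^ N" and ?C2 = "2 ^ q * real (1 + card (comp_basis 0)) ^ p * real (card adapted_basis) + 1"
  have lower: "?C1 * real n powr (- real ?r) * real d ^ n \<le> real (H_codim sH sA act \<gamma> n)" if n: "n \<ge> 1" for n
  proof -
    have pos: "real d ^ N > 0" "real n ^ ?r > 0" using d n by auto
    have "real n powr (- real ?r) = 1 / real n ^ ?r"
      using n by (simp add: powr_minus powr_realpow inverse_eq_divide del: of_nat_add)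
    then have "?C1 * real n powr (- real ?r) * real d ^ n = real d ^ n / (real d ^ N * real n ^ ?r)" by simp
    also have "\<dots> \<le> real (H_codim sH sA act \<gamma> n)"
      using N[OF n] pos by (simp add: divide_le_eq mult.commute)
    finally show ?thesis .
  qed
  have upper: "real (H_codim sH sA act \<gamma> n) \<le> ?C2 * real n powr real p * real d ^ n" if n: "n \<ge> 1" for n
  proof -
    have "real (H_codim sH sA act \<gamma> n) \<le> real (2 ^ q * (d ^ n * (1 + card (comp_basis 0) * n) ^ p) * card adapted_basis)"
      using p[OF n] by (simp only: of_nat_le_iff)
    also have "\<dots> = 2 ^ q * (real d ^ n * real (1 + card (comp_basis 0) * n) ^ p) * real (card adapted_basis)" by simp
    also have "\<dots> \<le> 2 ^ q * (real d ^ n * (real (1 + card (comp_basis 0)) * real n) ^ p) * real (card adapted_basis)"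
    proof -
      have "1 + card (comp_basis 0) * n \<le> (1 + card (comp_basis 0)) * n" using n by simp
      then have "real (1 + card (comp_basis 0) * n) \<le> real (1 + card (comp_basis 0)) * real n" by (metis of_nat_le_iff of_nat_mult)
      then show ?thesis by (intro mult_right_mono mult_left_mono power_mono) auto
    qed
    also have "\<dots> = (2 ^ q * real (1 + card (comp_basis 0)) ^ p * real (card adapted_basis)) * (real n ^ p * real d ^ n)"
      by (simp only: power_mult_distrib mult_ac)
    also have "\<dots> \<le> ?C2 * (real n ^ p * real d ^ n)" by (intro mult_right_mono) auto
    also have "real n ^ p = real n powr real p" using n by (simp add: powr_realpow)
    finally show ?thesis by (simp only: mult.assoc)
  qed
  have C: "?C1 > 0" "?C2 > 0" using d by (auto intro: add_nonneg_pos)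
  show ?thesis
    by (intro exI conjI allI impI) (fact C d lower upper)+
qed

end
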